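(* Let $Z$ be a finite set of $d$ points in $\mathbb{P}^2=\mathbb{P}^2_{\mathbb{C}}$, with dual line arrangement $\mathcal{A}_Z:f_Z=0$, and let $(a_Z,b_Z)$, $a_Z\leq b_Z$, be the generic splitting type of the derivation bundle $E_Z$ of $\mathcal{A}_Z$. Then $$a_Z\leq\min\left(mdr(f_Z),\left\lfloor\frac{d-1}{2}\right\rfloor\right).$$ Moreover, if $Z$ admits an unexpected curve (of some degree), then $$a_Z=mdr(f_Z).$$
   Context: Work over $\mathbb{C}$, $S=\mathbb{C}[x,y,z]$. Unexpected curves: a finite set $Z\subset\mathbb{P}^2$ admits unexpected curves of degree $j\geq 2$ if, for a generic point $q\in\mathbb{P}^2$ (i.e. for $q$ in a nonempty Zariski open subset), $$h^0(\mathbb{P}^2,\mathcal{O}_{\mathbb{P}^2}(j)\otimes\mathcal{I}(Z+(j-1)q))>\max\left(0,\ h^0(\mathbb{P}^2,\mathcal{O}_{\mathbb{P}^2}(j)\otimes\mathcal{I}(Z))-\binom{j}{2}\right),$$ where $\mathcal{I}(Z)$ is the ideal sheaf of functions vanishing on $Z$ and $\mathcal{I}(Z+(j-1)q)$ is the ideal sheaf of functions vanishing on $Z$ and vanishing to order $j-1$ at $q$. Dual arrangement: a point $(a:b:c)\in\mathbb{P}^2$ is dual to the line $ax+by+cz=0$; $\mathcal{A}_Z$ is the arrangement of the $d$ lines dual to the points of $Z$, and $f_Z\in S$ is the product of the corresponding linear forms. For $f=f_Z$, $AR(f)$ is the graded $S$-module of triples $(a,b,c)\in S^3$ with $af_x+bf_y+cf_z=0$,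 and $mdr(f)$ is the smallest $r\geq 0$ such that $AR(f)_r\neq 0$ (triples of homogeneous polynomials of degree $r$). The derivation bundle $E_Z$ is the rank 2 vector bundle on $\mathbb{P}^2$ associated with $AR(f_Z)$, i.e. the kernel of the morphism $(f_x,f_y,f_z):\mathcal{O}_{\mathbb{P}^2}^3\to\mathcal{O}_{\mathbb{P}^2}(d-1)$. Its generic splitting type $(a_Z,b_Z)$, with $a_Z\leq b_Z$, is defined by $E_Z|_L\cong\mathcal{O}_L(-a_Z)\oplus\mathcal{O}_L(-b_Z)$ for a generic line $L\subset\mathbb{P}^2$; one has $a_Z+b_Z=d-1$. *)

theory Defs
  imports "HOL-Analysis.Analysis" "HOL-Library.Function_Algebras"
begin

(* Polynomials in C[x,y,z] are represented by the polynomial functions they induce on C^3. *)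

definition hom_poly :: "nat \<Rightarrow> (complex^3 \<Rightarrow> complex) \<Rightarrow> bool" where
  "hom_poly r g \<longleftrightarrow>
     (\<exists>c. g = (\<lambda>v. \<Sum>i\<le>r. \<Sum>j\<le>r - i. c i j * v$1 ^ i * v$2 ^ j * v$3 ^ (r - i - j)))"

definition pderiv3 :: "3 \<Rightarrow> (complex^3 \<Rightarrow> complex) \<Rightarrow> complex^3 \<Rightarrow> complex" where
  "pderiv3 i g v = deriv (\<lambda>t. g (v + t *s axis i 1)) 0"

interpretation fun_space: vector_space "\<lambda>(c::complex) (g::complex^3 \<Rightarrow> complex) v. c * g v"
  by unfold_locales (auto simp: fun_eq_iff algebra_simps plus_fun_def)


section \<open>The projective plane and its Zariski topology\<close>

definition proj_rel :: "complex^3 \<Rightarrow> complex^3 \<Rightarrow> bool" where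
  "proj_rel u v \<longleftrightarrow> u \<noteq> 0 \<and> v \<noteq> 0 \<and> (\<exists>c. c \<noteq> 0 \<and> u = c *s v)"

lemma part_equivp_proj_rel: "part_equivp proj_rel"
proof (rule part_equivpI)
  have "proj_rel (axis 1 1) (axis 1 1)"
    by (auto simp: proj_rel_def intro!: exI[of _ 1])
  then show "\<exists>v. proj_rel v v" ..
  show "symp proj_rel"
  proof (rule sympI)
    fix u v assume "proj_rel u v"
    then obtain c where "u \<noteq> 0" "v \<noteq> 0" "c \<noteq> 0" "u = c *s v"
      by (auto simp: proj_rel_def)
    then show "proj_rel v u"
      by (auto simp: proj_rel_def intro!: exI[of _ "inverse c"])
  qed
  show "transp proj_rel"
  proof (rule transpI)
    fix u v w assume "proj_rel u v" "proj_rel v w"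
    then obtain c e where "u \<noteq> 0" "w \<noteq> 0" "c \<noteq> 0" "u = c *s v" "e \<noteq> 0" "v = e *s w"
      by (auto simp: proj_rel_def)
    then show "proj_rel u w"
      by (auto simp: proj_rel_def intro!: exI[of _ "c * e"])
  qed
qed

quotient_type proj2 = "complex^3" / partial: proj_rel
  by (rule part_equivp_proj_rel)

definition zariski_open :: "proj2 set \<Rightarrow> bool" where
  "zariski_open U \<longleftrightarrow>
     (\<exists>G. (\<forall>g\<in>G. \<exists>r. hom_poly r g) \<and> U = {p. \<exists>g\<in>G. g (rep_proj2 p) \<noteq> 0})"

definition generically :: "(proj2 \<Rightarrow> bool) \<Rightarrow> bool" where
  "generically P \<longleftrightarrow> (\<exists>U. zariski_open U \<and> U \<noteq> {} \<and> (\<forall>p\<in>U. P p))"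


section \<open>Line arrangements and Jacobian syzygies\<close>

definition dual_form :: "proj2 \<Rightarrow> complex^3 \<Rightarrow> complex" where
  "dual_form p v = (\<Sum>i\<in>UNIV. rep_proj2 p $ i * v $ i)"

definition dual_line :: "proj2 \<Rightarrow> proj2 set" where
  "dual_line p = {q. dual_form p (rep_proj2 q) = 0}"

(* Well defined up to a nonzero constant factor, depending on the chosen representatives. *)
definition arr_poly :: "proj2 set \<Rightarrow> complex^3 \<Rightarrow> complex" where
  "arr_poly Z v = (\<Prod>p\<in>Z. dual_form p v)"

definition AR :: "(complex^3 \<Rightarrow> complex) \<Rightarrow> nat \<Rightarrow> (complex^3 \<Rightarrow> complex^3) set" where
  "AR f r = {\<rho>. (\<forall>i. hom_poly r (\<lambda>v. \<rho> v $ i)) \<and>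
                (\<forall>v. (\<Sum>i\<in>UNIV. \<rho> v $ i * pderiv3 i f v) = 0)}"

definition mdr :: "(complex^3 \<Rightarrow> complex) \<Rightarrow> nat" where
  "mdr f = (LEAST r. \<exists>\<rho>\<in>AR f r. \<rho> \<noteq> (\<lambda>v. 0))"


section \<open>Sheaves\<close>

definition cone :: "proj2 set \<Rightarrow> (complex^3) set" where
  "cone U = {v. v \<noteq> 0 \<and> abs_proj2 v \<in> U}"

definition restr :: "proj2 set \<Rightarrow> (complex^3 \<Rightarrow> 'a::zero) \<Rightarrow> complex^3 \<Rightarrow> 'a" where
  "restr V s v = (if v \<in> cone V then s v else 0)"

(* For a closed subvariety X and an open U of the plane, this is O_X(n)(U Int X).
   A section of O_X(n) is represented by a function on the punctured affine cone which is locally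
   a quotient of homogeneous polynomials with degree difference n.  All sections are extended
   by 0 outside the cone of their domain, so that equality of sections is equality of functions. *)
definition twist :: "proj2 set \<Rightarrow> int \<Rightarrow> proj2 set \<Rightarrow> (complex^3 \<Rightarrow> complex) set" where
  "twist X n U = {s. (\<forall>v. v \<notin> cone (U \<inter> X) \<longrightarrow> s v = 0) \<and>
     (\<forall>p\<in>U \<inter> X. \<exists>V g h k l. zariski_open V \<and> p \<in> V \<and> V \<subseteq> U \<and>
        hom_poly k g \<and> hom_poly l h \<and> int k - int l = n \<and>
        (\<forall>v\<in>cone (V \<inter> X). h v \<noteq> 0 \<and> s v = g v / h v))}"

definition ideal_sheaf :: "proj2 set \<Rightarrow> proj2 set \<Rightarrow> (complex^3 \<Rightarrow> complex) set" where
  "ideal_sheaf X U = {g \<in> twist UNIV 0 U. \<forall>v\<in>cone (U \<inter> X). g v = 0}"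

(* The kernel of (f_x, f_y, f_z) : O^3 -> O(d-1), for f homogeneous of degree d. *)
definition syz_sheaf :: "(complex^3 \<Rightarrow> complex) \<Rightarrow> proj2 set \<Rightarrow> (complex^3 \<Rightarrow> complex^3) set" where
  "syz_sheaf f U = {\<rho>. (\<forall>i. (\<lambda>v. \<rho> v $ i) \<in> twist UNIV 0 U) \<and>
                       (\<forall>v. (\<Sum>i\<in>UNIV. \<rho> v $ i * pderiv3 i f v) = 0)}"

(* The product I_X E, where E = syz_sheaf f: sections that are locally finite sums of products. *)
definition ideal_syz_sheaf ::
  "(complex^3 \<Rightarrow> complex) \<Rightarrow> proj2 set \<Rightarrow> proj2 set \<Rightarrow> (complex^3 \<Rightarrow> complex^3) set" where
  "ideal_syz_sheaf f X U = {\<rho> \<in> syz_sheaf f U.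
     \<forall>p\<in>U. \<exists>V (n::nat) g e. zariski_open V \<and> p \<in> V \<and> V \<subseteq> U \<and>
       (\<forall>k<n. g k \<in> ideal_sheaf X V \<and> e k \<in> syz_sheaf f V) \<and>
       (\<forall>v\<in>cone V. \<rho> v = (\<Sum>k<n. g k v *s e k v))}"

definition split_sheaf :: "proj2 set \<Rightarrow> int \<Rightarrow> int \<Rightarrow> proj2 set \<Rightarrow> (complex^3 \<Rightarrow> complex^2) set" where
  "split_sheaf L a b U = {s. (\<lambda>v. s v $ 1) \<in> twist L (- a) U \<and> (\<lambda>v. s v $ 2) \<in> twist L (- b) U}"

(* E|_L is isomorphic to O_L(-a) + O_L(-b), where E = syz_sheaf f.  With i : L -> P^2 the inclusion,
   i_* (E|_L) = E / I_L E, so an isomorphism is the same as an O-linear morphism of sheaves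
   Phi : E -> i_* (O_L(-a) + O_L(-b)) with kernel I_L E that is surjective as a morphism of sheaves,
   i.e. locally. *)
definition restriction_splits ::
  "(complex^3 \<Rightarrow> complex) \<Rightarrow> proj2 set \<Rightarrow> int \<Rightarrow> int \<Rightarrow> bool" where
  "restriction_splits f L a b \<longleftrightarrow>
     (\<exists>\<Phi> :: proj2 set \<Rightarrow> (complex^3 \<Rightarrow> complex^3) \<Rightarrow> (complex^3 \<Rightarrow> complex^2).
        (\<forall>U. zariski_open U \<longrightarrow>
           (\<forall>\<rho>\<in>syz_sheaf f U. \<Phi> U \<rho> \<in> split_sheaf L a b U) \<and>
           (\<forall>\<rho>\<in>syz_sheaf f U. \<forall>\<sigma>\<in>syz_sheaf f U.
              \<Phi> U (\<lambda>v. \<rho> v + \<sigma> v) = (\<lambda>v. \<Phi> U \<rho> v + \<Phi> U \<sigma> v)) \<and>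
           (\<forall>g\<in>twist UNIV 0 U. \<forall>\<rho>\<in>syz_sheaf f U.
              \<Phi> U (\<lambda>v. g v *s \<rho> v) = (\<lambda>v. g v *s \<Phi> U \<rho> v)) \<and>
           (\<forall>V \<rho>. zariski_open V \<and> V \<subseteq> U \<and> \<rho> \<in> syz_sheaf f U \<longrightarrow>
              \<Phi> V (restr V \<rho>) = restr V (\<Phi> U \<rho>)) \<and>
           (\<forall>\<rho>\<in>syz_sheaf f U. \<Phi> U \<rho> = (\<lambda>v. 0) \<longleftrightarrow> \<rho> \<in> ideal_syz_sheaf f L U) \<and>
           (\<forall>s\<in>split_sheaf L a b U. \<forall>p\<in>U. \<exists>V \<rho>. zariski_open V \<and> p \<in> V \<and> V \<subseteq> U \<and>
              \<rho> \<in> syz_sheaf f V \<and> \<Phi> V \<rho> = restr V s)))"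

definition generic_splitting_type :: "proj2 set \<Rightarrow> int \<Rightarrow> int \<Rightarrow> bool" where
  "generic_splitting_type Z a b \<longleftrightarrow>
     a \<le> b \<and> generically (\<lambda>p. restriction_splits (arr_poly Z) (dual_line p) a b)"


section \<open>Unexpected curves\<close>

(* All partial derivatives of order less than m vanish at q. *)
definition vanishes_to_order :: "nat \<Rightarrow> proj2 \<Rightarrow> (complex^3 \<Rightarrow> complex) \<Rightarrow> bool" where
  "vanishes_to_order m q s \<longleftrightarrow>
     (\<forall>is. length is < m \<longrightarrow> foldr pderiv3 is s (rep_proj2 q) = 0)"

(* Global sections of O(j) tensor I(Z), as a subsheaf of O(j). *)
definition sections_through :: "nat \<Rightarrow> proj2 set \<Rightarrow> (complex^3 \<Rightarrow> complex) set" where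
  "sections_through j Z = {s \<in> twist UNIV (int j) UNIV. \<forall>p\<in>Z. s (rep_proj2 p) = 0}"

definition admits_unexpected_curves :: "proj2 set \<Rightarrow> nat \<Rightarrow> bool" where
  "admits_unexpected_curves Z j \<longleftrightarrow> j \<ge> 2 \<and>
     generically (\<lambda>q.
       int (fun_space.dim {s \<in> sections_through j Z. vanishes_to_order (j - 1) q s}) >
       max 0 (int (fun_space.dim (sections_through j Z)) - int (j choose 2)))"

end

theory Submission
  imports Defs "HOL-Complex_Analysis.Cauchy_Integral_Formula"
    "HOL-Computational_Algebra.Field_as_Ring" "HOL-Computational_Algebra.Polynomial_Factorial"
begin

text \<open>
  Let \<open>L\<close> be the line dual to a generic point \<open>q\<close>; it contains no multiple point of the arrangement.
  Sections of \<open>O(n)\<close> on \<open>L\<close> are binary forms, so a splitting of \<open>E\<close> along \<open>L\<close> identifies the syzygies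
  of degree \<open>k\<close> on \<open>L\<close> with pairs of binary forms of degrees \<open>k - a\<close> and \<open>k - b\<close>. Comparing
  dimensions gives \<open>a + b = d - 1\<close>, and restricting a global syzygy gives \<open>a \<le> mdr\<close>.

  A curve \<open>s = 0\<close> of degree \<open>j\<close> with multiplicity \<open>j - 1\<close> at \<open>q\<close> is affine linear along the lines through
  \<open>q\<close>, hence determined by its values and slopes over a line not through \<open>q\<close>; if it passes through \<open>Z\<close>,
  these are the coordinates of a syzygy of degree \<open>j - 1\<close> on \<open>L\<close>. So such curves form a space of
  dimension at most \<open>max 0 (j - a) + max 0 (j - b)\<close>, whereas an unexpected curve makes it positive and
  larger than \<open>2 * j + 1 - d = (j - a) + (j - b)\<close>. This forces \<open>a < j < b\<close>, hence \<open>b \<ge> a + 2\<close>.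

  In that case the syzygy of degree \<open>a\<close> on \<open>L\<close> is unique up to scalars. Write it as a primitive
  polynomial family \<open>R(x, y, t)\<close>, where \<open>(x, y)\<close> are affine coordinates of \<open>q\<close> and \<open>t\<close> is a parameter
  on \<open>L\<close>. The derivation \<open>\<delta> = t d/dx + d/dy\<close> moves the line while fixing the point, so \<open>\<delta> R\<close> is a
  syzygy on \<open>L\<close> of degree at most \<open>a + 1 < b\<close> and therefore \<open>\<delta> R = \<lambda> R\<close>. By Gauss's lemma
  \<open>\<lambda>\<close> is a polynomial, and comparing degrees \<open>\<lambda> = 0\<close>. Thus \<open>R\<close> depends only on the point of the
  plane, and is a global syzygy of degree \<open>a\<close>.
\<close>

section \<open>Linear systems\<close>

text \<open>The splitting isomorphism acts on sections of degree 0, whereas the counts need syzygies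
  of every degree k along L, and these need not extend to the plane. A degree k syzygy on L is
  therefore compared with a section of O(k - a) + O(k - b) through charts of the plane in which both
  are divided by the k-th power of a nonvanishing coordinate; lifts to the plane are not unique, and
  only their values on L matter. Afterwards everything is polynomial algebra in an affine parameter
  of L.

  For q = (x : y : 1) the parametrisation is t -> (-1, t, x - t y), shifted by a constant \<kappa>
  when the point at infinity of L has to avoid the arrangement, so that all d intersection points
  get finite parameters. The derivation kills t and x - t y, hence the gradient of f along L, and so
  preserves syzygies. In degree a + 1 a generic line has a 2-dimensional space of syzygies if b >= a
  + 2; R and t R already fill it. The resulting relation is wanted over C[x, y], while the counts
  hold only line by line; fraction-free elimination transfers them.\<close>

lemma sum_eliminate:
  fixes c :: "'j \<Rightarrow> 'i \<Rightarrow> 'a::idom"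
  assumes "finite J" "p \<notin> J"
  shows "(\<Sum>j\<in>insert p J. (if j = p then - (\<Sum>j\<in>J. v j * c j i0) else c p i0 * v j) * c j i)
       = (\<Sum>j\<in>J. v j * (c p i0 * c j i - c j i0 * c p i))"
proof -
  have "(\<Sum>j\<in>J. (if j = p then - (\<Sum>j\<in>J. v j * c j i0) else c p i0 * v j) * c j i)
      = (\<Sum>j\<in>J. c p i0 * v j * c j i)"
    using assms by (intro sum.cong) auto
  moreover have "(\<Sum>j\<in>J. v j * (c p i0 * c j i - c j i0 * c p i))
      = (\<Sum>j\<in>J. c p i0 * v j * c j i) - (\<Sum>j\<in>J. v j * c j i0) * c p i"
    by (simp add: sum_distrib_left sum_subtractf algebra_simps)
  ultimately show ?thesis
    using assms by simp
qed

text \<open>Gaussian elimination without division, by induction on the equations: the unknown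
  \<open>p\<close> is solved from equation \<open>i0\<close> after the other unknowns have been
  scaled by the pivot \<open>c p i0\<close>, so an integral domain suffices. The remaining equations
  get 2x2 minors as coefficients and have one unknown less.\<close>

lemma homogeneous_system_nontrivial:
  fixes c :: "'j \<Rightarrow> 'i \<Rightarrow> 'a::idom"
  assumes "finite I" "finite J" "card I < card J"
  shows "\<exists>v. (\<exists>j\<in>J. v j \<noteq> 0) \<and> (\<forall>i\<in>I. (\<Sum>j\<in>J. v j * c j i) = 0)"
  using assms
proof (induction I arbitrary: J c rule: finite_induct)
  case empty
  then have "J \<noteq> {}" by auto
  then show ?case by (intro exI[of _ "\<lambda>_. 1"]) (simp add: ex_in_conv)
next
  case (insert i0 I)
  show ?case
  proof (cases "\<forall>j\<in>J. c j i0 = 0")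
    case True
    moreover have "card I < card J" using insert.prems insert.hyps by simp
    ultimately obtain v where v: "\<exists>j\<in>J. v j \<noteq> 0" "\<forall>i\<in>I. (\<Sum>j\<in>J. v j * c j i) = 0"
      using insert.IH[of J c] insert.prems by blast
    have "(\<Sum>j\<in>J. v j * c j i0) = 0" using True by (intro sum.neutral) simp
    then show ?thesis using v by (intro exI[of _ v]) simp
  next
    case False
    then obtain p where p: "p \<in> J" "c p i0 \<noteq> 0" by auto
    define K where "K = J - {p}"
    have K: "finite K" "p \<notin> K" "J = insert p K" "card I < card K"
      using insert.prems insert.hyps p by (auto simp: K_def)
    obtain v where v: "\<exists>j\<in>K. v j \<noteq> 0"
      "\<forall>i\<in>I. (\<Sum>j\<in>K. v j * (c p i0 * c j i - c j i0 * c p i)) = 0"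
      using insert.IH[OF K(1) K(4), of "\<lambda>j i. c p i0 * c j i - c j i0 * c p i"] by auto
    show ?thesis
    proof (intro exI conjI ballI)
      show "\<exists>j\<in>J. (if j = p then - (\<Sum>j\<in>K. v j * c j i0) else c p i0 * v j) \<noteq> 0"
        using v(1) K p by auto
      fix i assume "i \<in> insert i0 I"
      then show "(\<Sum>j\<in>J. (if j = p then - (\<Sum>j\<in>K. v j * c j i0) else c p i0 * v j) * c j i) = 0"
        unfolding K(3) sum_eliminate[OF K(1,2)] using v(2) by auto
    qed
  qed
qed

text \<open>The same elimination, now by induction on the unknowns. Either some unknown ends up with
  a zero column, which gives a relation over the ring, or the elimination succeeds and
  \<open>D\<close> is the product of the pivots. A homomorphism that does not kill \<open>D\<close>
  repeats every step, so the specialised system has only the zero solution. One \<open>D\<close>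
  serves all of \<open>H\<close>; in the application \<open>H\<close> consists of the evaluations at
  points of the dual plane.\<close>

lemma generic_elimination:
  fixes c :: "'j \<Rightarrow> 'i \<Rightarrow> 'a::idom" and H :: "('a \<Rightarrow> 'b::idom) set"
  assumes "finite J"
    and add: "\<And>h x y. h \<in> H \<Longrightarrow> h (x + y) = h x + h y"
    and mult: "\<And>h x y. h \<in> H \<Longrightarrow> h (x * y) = h x * h y"
    and one: "\<And>h. h \<in> H \<Longrightarrow> h 1 = 1"
  shows "(\<exists>v. (\<exists>j\<in>J. v j \<noteq> 0) \<and> (\<forall>i. (\<Sum>j\<in>J. v j * c j i) = 0)) \<or>
    (\<exists>D. D \<noteq> 0 \<and> (\<forall>h\<in>H. h D \<noteq> 0 \<longrightarrow>
       (\<forall>w. (\<forall>i. (\<Sum>j\<in>J. w j * h (c j i)) = 0) \<longrightarrow> (\<forall>j\<in>J. w j = 0))))"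
  using \<open>finite J\<close>
proof (induction J arbitrary: c rule: finite_induct)
  case empty
  show ?case by (intro disjI2 exI[of _ 1]) auto
next
  case (insert p J)
  have diff: "h (x - y) = h x - h y" if "h \<in> H" for h x y
    using add[OF that, of "x - y" y] by simp
  show ?case
  proof (cases "\<forall>i. c p i = 0")
    case True
    then show ?thesis
      using insert.hyps by (intro disjI1 exI[of _ "\<lambda>j. if j = p then 1 else 0"])
        (auto intro!: sum.neutral)
  next
    case False
    then obtain i0 where i0: "c p i0 \<noteq> 0" by auto
    from insert.IH[of "\<lambda>j i. c p i0 * c j i - c j i0 * c p i"]
    show ?thesis
    proof (elim disjE exE conjE)
      fix v assume 1: "\<exists>j\<in>J. v j \<noteq> 0"
        "\<forall>i. (\<Sum>j\<in>J. v j * (c p i0 * c j i - c j i0 * c p i)) = 0"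
      show ?thesis
      proof (intro disjI1 exI conjI allI)
        show "\<exists>j\<in>insert p J. (if j = p then - (\<Sum>j\<in>J. v j * c j i0) else c p i0 * v j) \<noteq> 0"
          using 1(1) insert.hyps i0 by auto
        show "(\<Sum>j\<in>insert p J. (if j = p then - (\<Sum>j\<in>J. v j * c j i0) else c p i0 * v j) * c j i) = 0"
          for i
          unfolding sum_eliminate[OF insert.hyps] using 1(2) by auto
      qed
    next
      fix D assume 2: "D \<noteq> 0" "\<forall>h\<in>H. h D \<noteq> 0 \<longrightarrow>
       (\<forall>w. (\<forall>i. (\<Sum>j\<in>J. w j * h (c p i0 * c j i - c j i0 * c p i)) = 0) \<longrightarrow> (\<forall>j\<in>J. w j = 0))"
      show ?thesis
      proof (intro disjI2 exI[of _ "D * c p i0"] conjI ballI impI allI)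
        show "D * c p i0 \<noteq> 0" using 2 i0 by simp
        fix h w j
        assume h: "h \<in> H" "h (D * c p i0) \<noteq> 0"
          and w: "\<forall>i. (\<Sum>j\<in>insert p J. w j * h (c j i)) = 0" and j: "j \<in> insert p J"
        have hn: "h D \<noteq> 0" "h (c p i0) \<noteq> 0" using h mult[OF h(1), of D "c p i0"] by auto
        have s: "(\<Sum>j\<in>J. w j * h (c j i)) = - w p * h (c p i)" for i
          using w insert.hyps by (simp add: eq_neg_iff_add_eq_0 add.commute)
        have "(\<Sum>j\<in>J. w j * h (c p i0 * c j i - c j i0 * c p i)) = 0" for i
        proof -
          have "(\<Sum>j\<in>J. w j * h (c p i0 * c j i - c j i0 * c p i)) =
             h (c p i0) * (\<Sum>j\<in>J. w j * h (c j i)) - h (c p i) * (\<Sum>j\<in>J. w j * h (c j i0))"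
            using h by (simp add: diff mult sum_distrib_left sum_subtractf algebra_simps)
          then show ?thesis unfolding s by simp
        qed
        then have J: "\<forall>j\<in>J. w j = 0" using 2(2) h(1) hn(1) by blast
        then have "w p * h (c p i0) = 0" using s[of i0] by simp
        then show "w j = 0" using J j hn by auto
      qed
    qed
  qed
qed

text \<open>Solutions are chosen one after another, each orthogonal to the earlier ones for the
  Hermitian form; pairwise orthogonal nonzero vectors are independent. Each choice costs one
  additional linear equation, which the inequality between the cardinalities allows \<open>n\<close>
  times.\<close>

lemma kernel_independent_family:
  fixes c :: "'j \<Rightarrow> 'i \<Rightarrow> complex"
  assumes "finite I" "finite J" "card I + n \<le> card J"
  shows "\<exists>x. (\<forall>l<n. \<forall>i\<in>I. (\<Sum>j\<in>J. x l j * c j i) = 0) \<and>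
    (\<forall>a. (\<forall>j\<in>J. (\<Sum>l<n. a l * x l j) = 0) \<longrightarrow> (\<forall>l<n. a l = 0))"
proof -
  have "\<exists>x. (\<forall>l<n. \<forall>i\<in>I. (\<Sum>j\<in>J. x l j * c j i) = 0) \<and> (\<forall>l<n. \<exists>j\<in>J. x l j \<noteq> 0) \<and>
     (\<forall>l<n. \<forall>m<n. l \<noteq> m \<longrightarrow> (\<Sum>j\<in>J. x l j * cnj (x m j)) = 0)"
    using assms(3)
  proof (induction n)
    case (Suc n)
    then obtain x where x: "\<forall>l<n. \<forall>i\<in>I. (\<Sum>j\<in>J. x l j * c j i) = 0" "\<forall>l<n. \<exists>j\<in>J. x l j \<noteq> 0"
     "\<forall>l<n. \<forall>m<n. l \<noteq> m \<longrightarrow> (\<Sum>j\<in>J. x l j * cnj (x m j)) = 0" by auto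
    \<comment> \<open>Index \<open>Inl i\<close> stands for a given equation, \<open>Inr l\<close>
      for orthogonality to the solution \<open>x l\<close>.\<close>
    define e where "e j i = (case i of Inl i \<Rightarrow> c j i | Inr l \<Rightarrow> cnj (x l j))" for j i
    have "card (I <+> {..<n}) < card J"
      using Suc.prems assms by (simp add: card_Plus)
    then obtain v where v: "\<exists>j\<in>J. v j \<noteq> 0" "\<forall>i\<in>I <+> {..<n}. (\<Sum>j\<in>J. v j * e j i) = 0"
      using homogeneous_system_nontrivial[of "I <+> {..<n}" J e] assms by auto
    have v1: "(\<Sum>j\<in>J. v j * c j i) = 0" if "i \<in> I" for i
      using v(2) that by (auto simp: e_def dest!: bspec[of _ _ "Inl i"])
    have v2: "(\<Sum>j\<in>J. v j * cnj (x l j)) = 0" if "l < n" for l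
      using v(2) that by (auto simp: e_def dest!: bspec[of _ _ "Inr l"])
    have v3: "(\<Sum>j\<in>J. x l j * cnj (v j)) = 0" if "l < n" for l
    proof -
      have "(\<Sum>j\<in>J. x l j * cnj (v j)) = cnj (\<Sum>j\<in>J. v j * cnj (x l j))"
        by (simp add: mult.commute)
      then show ?thesis using v2[OF that] by simp
    qed
    show ?case
      by (rule exI[of _ "x(n := v)"]) (use x v v1 v2 v3 in \<open>auto simp: less_Suc_eq\<close>)
  qed auto
  then obtain x where x: "\<forall>l<n. \<forall>i\<in>I. (\<Sum>j\<in>J. x l j * c j i) = 0" "\<forall>l<n. \<exists>j\<in>J. x l j \<noteq> 0"
     "\<forall>l<n. \<forall>m<n. l \<noteq> m \<longrightarrow> (\<Sum>j\<in>J. x l j * cnj (x m j)) = 0" by auto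
  have "a m = 0" if a: "\<forall>j\<in>J. (\<Sum>l<n. a l * x l j) = 0" and m: "m < n" for a m
  proof -
    have "0 = (\<Sum>j\<in>J. (\<Sum>l<n. a l * x l j) * cnj (x m j))"
      using a by simp
    also have "\<dots> = (\<Sum>l<n. a l * (\<Sum>j\<in>J. x l j * cnj (x m j)))"
      by (simp add: sum_distrib_left sum_distrib_right sum.swap[of _ J] mult.assoc)
    also have "\<dots> = (\<Sum>l<n. if l = m then a m * (\<Sum>j\<in>J. x m j * cnj (x m j)) else 0)"
      using x m by (intro sum.cong) auto
    also have "\<dots> = a m * (\<Sum>j\<in>J. x m j * cnj (x m j))"
      using m by simp
    finally have "a m * (\<Sum>j\<in>J. x m j * cnj (x m j)) = 0" by simp
    moreover have "(\<Sum>j\<in>J. x m j * cnj (x m j)) \<noteq> 0"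
    proof
      assume "(\<Sum>j\<in>J. x m j * cnj (x m j)) = 0"
      then have "(\<Sum>j\<in>J. complex_of_real ((cmod (x m j))\<^sup>2)) = 0"
        by (simp add: complex_norm_square del: of_real_power)
      then have "(\<Sum>j\<in>J. (cmod (x m j))\<^sup>2) = 0"
        by (simp only: of_real_sum[symmetric] of_real_eq_0_iff)
      then show False
        using x(2) m assms(2) by (subst (asm) sum_nonneg_eq_0_iff) auto
    qed
    ultimately show ?thesis by simp
  qed
  then show ?thesis using x by blast
qed

section \<open>Homogeneous polynomial functions\<close>

inductive hpoly :: "nat \<Rightarrow> (complex^3 \<Rightarrow> complex) \<Rightarrow> bool" where
  const: "hpoly 0 (\<lambda>_. c)"
| zero: "hpoly r (\<lambda>_. 0)"
| add: "hpoly r g \<Longrightarrow> hpoly r h \<Longrightarrow> hpoly r (\<lambda>v. g v + h v)"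
| coord: "hpoly r g \<Longrightarrow> hpoly (Suc r) (\<lambda>v. v $ i * g v)"

lemma hpoly_cmult: "hpoly r g \<Longrightarrow> hpoly r (\<lambda>v. c * g v)"
proof (induction rule: hpoly.induct)
  case (const c')
  then show ?case using hpoly.const[of "c * c'"] by simp
next
  case (zero r)
  then show ?case using hpoly.zero by simp
next
  case (add r g h)
  then show ?case using hpoly.add[OF add.IH] by (simp add: algebra_simps)
next
  case (coord r g i)
  then show ?case using hpoly.coord[OF coord.IH, of i] by (simp add: algebra_simps)
qed

lemma hpoly_sum: "(\<And>i. i \<in> I \<Longrightarrow> hpoly r (g i)) \<Longrightarrow> hpoly r (\<lambda>v. \<Sum>i\<in>I. g i v)"
  by (induction I rule: infinite_finite_induct) (auto intro: hpoly.zero hpoly.add)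

lemma hpoly_mult: "hpoly r g \<Longrightarrow> hpoly s h \<Longrightarrow> hpoly (r + s) (\<lambda>v. g v * h v)"
proof (induction rule: hpoly.induct)
  case (const c)
  then show ?case by (simp add: hpoly_cmult)
next
  case (zero r)
  then show ?case using hpoly.zero by simp
next
  case (add r g h)
  then show ?case using hpoly.add by (simp add: algebra_simps)
next
  case (coord r g i)
  then show ?case using hpoly.coord[of "r + s" _ i] by (simp add: mult.assoc)
qed

lemma hpoly_coord: "hpoly 1 (\<lambda>v. v $ i)"
  using hpoly.coord[OF hpoly.const[of 1], of i] by simp

lemma hpoly_minus: "hpoly r g \<Longrightarrow> hpoly r (\<lambda>v. - g v)"
  using hpoly_cmult[of r g "-1"] by simp

lemma hpoly_diff: "hpoly r g \<Longrightarrow> hpoly r h \<Longrightarrow> hpoly r (\<lambda>v. g v - h v)"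
  using hpoly.add[OF _ hpoly_minus, of r g h] by simp

lemma hpoly_power: "hpoly r g \<Longrightarrow> hpoly (r * n) (\<lambda>v. g v ^ n)"
proof (induction n)
  case 0
  then show ?case using hpoly.const[of 1] by simp
next
  case (Suc n)
  then show ?case using hpoly_mult[of r g "r * n"] by simp
qed

lemma hpoly_prod: "(\<And>i. i \<in> I \<Longrightarrow> hpoly (r i) (g i)) \<Longrightarrow> hpoly (\<Sum>i\<in>I. r i) (\<lambda>v. \<Prod>i\<in>I. g i v)"
  by (induction I rule: infinite_finite_induct) (auto intro: hpoly_mult hpoly.const)

text \<open>Multiplication by a coordinate shifts the coefficient array: by one in \<open>i\<close>
  for the first coordinate, by one in \<open>j\<close> for the second. For the third the entries
  stay in place, and zeros are added on the new antidiagonal \<open>i + j = Suc r\<close>.\<close>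

lemma hom_poly_iff_hpoly: "hom_poly r g \<longleftrightarrow> hpoly r g"
proof
  assume "hom_poly r g"
  then obtain c where g: "g = (\<lambda>v. \<Sum>i\<le>r. \<Sum>j\<le>r - i. c i j * v$1 ^ i * v$2 ^ j * v$3 ^ (r - i - j))"
    by (auto simp: hom_poly_def)
  show "hpoly r g"
    unfolding g
  proof (intro hpoly_sum)
    fix i j assume ij: "i \<in> {..r}" "j \<in> {..r - i}"
    have "hpoly ((i + j) + (r - i - j)) (\<lambda>v. ((c i j * v$1 ^ i) * v$2 ^ j) * v$3 ^ (r - i - j))"
      using hpoly_power[OF hpoly_coord] by (intro hpoly_mult hpoly_cmult) auto
    then show "hpoly r (\<lambda>v. c i j * v$1 ^ i * v$2 ^ j * v$3 ^ (r - i - j))"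
      using ij by simp
  qed
next
  assume "hpoly r g"
  then show "hom_poly r g"
  proof (induction rule: hpoly.induct)
    case (const c)
    then show ?case by (auto simp: hom_poly_def intro!: exI[of _ "\<lambda>_ _. c"])
  next
    case (zero r)
    then show ?case by (auto simp: hom_poly_def intro!: exI[of _ "\<lambda>_ _. 0"])
  next
    case (add r g h)
    then obtain c c' where g: "g = (\<lambda>v. \<Sum>i\<le>r. \<Sum>j\<le>r - i. c i j * v$1 ^ i * v$2 ^ j * v$3 ^ (r - i - j))"
      and h: "h = (\<lambda>v. \<Sum>i\<le>r. \<Sum>j\<le>r - i. c' i j * v$1 ^ i * v$2 ^ j * v$3 ^ (r - i - j))"
      unfolding hom_poly_def by blast
    show ?case unfolding hom_poly_def g h
      by (rule exI[of _ "\<lambda>i j. c i j + c' i j"]) (simp add: algebra_simps sum.distrib)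
  next
    case (coord r g i)
    then obtain c where g: "g = (\<lambda>v. \<Sum>i\<le>r. \<Sum>j\<le>r - i. c i j * v$1 ^ i * v$2 ^ j * v$3 ^ (r - i - j))"
      unfolding hom_poly_def by blast
    consider "i = 1" | "i = 2" | "i = 3" using exhaust_3 by blast
    then show ?case
    proof cases
      case 1
      show ?thesis unfolding hom_poly_def g 1
        by (rule exI[of _ "\<lambda>i j. if i = 0 then 0 else c (i - 1) j"])
          (simp add: sum.atMost_Suc_shift sum_distrib_left algebra_simps del: sum.atMost_Suc)
    next
      case 2
      have *: "(\<Sum>j\<le>Suc r - i. (if j = 0 then 0 else c i (j - 1)) * v$1 ^ i * v$2 ^ j * v$3 ^ (Suc r - i - j))
          = v$2 * (\<Sum>j\<le>r - i. c i j * v$1 ^ i * v$2 ^ j * v$3 ^ (r - i - j))" if "i \<le> r" for i and v :: "complex^3"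
        using that by (simp add: Suc_diff_le sum.atMost_Suc_shift sum_distrib_left algebra_simps del: sum.atMost_Suc)
      show ?thesis unfolding hom_poly_def g 2
      proof (intro exI[of _ "\<lambda>i j. if j = 0 then 0 else c i (j - 1)"] ext)
        fix v :: "complex^3"
        have "(\<Sum>i\<le>Suc r. \<Sum>j\<le>Suc r - i. (if j = 0 then 0 else c i (j - 1)) * v$1 ^ i * v$2 ^ j * v$3 ^ (Suc r - i - j)) = (\<Sum>i\<le>r. \<Sum>j\<le>Suc r - i. (if j = 0 then 0 else c i (j - 1)) * v$1 ^ i * v$2 ^ j * v$3 ^ (Suc r - i - j))"
          by simp
        also have "\<dots> = (\<Sum>i\<le>r. v$2 * (\<Sum>j\<le>r - i. c i j * v$1 ^ i * v$2 ^ j * v$3 ^ (r - i - j)))"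
          by (intro sum.cong refl *) auto
        finally show "v$2 * (\<Sum>i\<le>r. \<Sum>j\<le>r - i. c i j * v$1 ^ i * v$2 ^ j * v$3 ^ (r - i - j))
          = (\<Sum>i\<le>Suc r. \<Sum>j\<le>Suc r - i. (if j = 0 then 0 else c i (j - 1)) * v$1 ^ i * v$2 ^ j * v$3 ^ (Suc r - i - j))"
          by (simp add: sum_distrib_left)
      qed
    next
      case 3
      have *: "(\<Sum>j\<le>Suc r - i. (if i + j \<le> r then c i j else 0) * v$1 ^ i * v$2 ^ j * v$3 ^ (Suc r - i - j))
          = v$3 * (\<Sum>j\<le>r - i. c i j * v$1 ^ i * v$2 ^ j * v$3 ^ (r - i - j))" if "i \<le> r" for i and v :: "complex^3"
      proof -
        have "(\<Sum>j\<le>r - i. (if i + j \<le> r then c i j else 0) * v$1 ^ i * v$2 ^ j * v$3 ^ (Suc r - i - j))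
          = v$3 * (\<Sum>j\<le>r - i. c i j * v$1 ^ i * v$2 ^ j * v$3 ^ (r - i - j))"
          unfolding sum_distrib_left
        proof (intro sum.cong refl)
          fix j assume "j \<in> {..r - i}"
          then have "i + j \<le> r" "Suc r - i - j = Suc (r - i - j)" using that by auto
          then show "(if i + j \<le> r then c i j else 0) * v$1 ^ i * v$2 ^ j * v$3 ^ (Suc r - i - j)
             = v$3 * (c i j * v$1 ^ i * v$2 ^ j * v$3 ^ (r - i - j))" by simp
        qed
        then show ?thesis using that by (simp add: Suc_diff_le)
      qed
      show ?thesis unfolding hom_poly_def g 3
      proof (intro exI[of _ "\<lambda>i j. if i + j \<le> r then c i j else 0"] ext)
        fix v :: "complex^3"
        have "(\<Sum>i\<le>Suc r. \<Sum>j\<le>Suc r - i. (if i + j \<le> r then c i j else 0) * v$1 ^ i * v$2 ^ j * v$3 ^ (Suc r - i - j)) = (\<Sum>i\<le>r. \<Sum>j\<le>Suc r - i. (if i + j \<le> r then c i j else 0) * v$1 ^ i * v$2 ^ j * v$3 ^ (Suc r - i - j))"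
          by simp
        also have "\<dots> = (\<Sum>i\<le>r. v$3 * (\<Sum>j\<le>r - i. c i j * v$1 ^ i * v$2 ^ j * v$3 ^ (r - i - j)))"
          by (intro sum.cong refl *) auto
        finally show "v$3 * (\<Sum>i\<le>r. \<Sum>j\<le>r - i. c i j * v$1 ^ i * v$2 ^ j * v$3 ^ (r - i - j))
          = (\<Sum>i\<le>Suc r. \<Sum>j\<le>Suc r - i. (if i + j \<le> r then c i j else 0) * v$1 ^ i * v$2 ^ j * v$3 ^ (Suc r - i - j))"
          by (simp add: sum_distrib_left)
      qed
    qed
  qed
qed

lemma hpoly_homogeneous: "hpoly r g \<Longrightarrow> g (c *s v) = c ^ r * g v"
  by (induction rule: hpoly.induct) (auto simp: algebra_simps)

lemma hpoly_continuous: "hpoly r g \<Longrightarrow> continuous_on S g"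
  by (induction rule: hpoly.induct) (auto intro!: continuous_intros)

lemma hpoly_zero_eq_0: "hpoly r g \<Longrightarrow> r > 0 \<Longrightarrow> g 0 = 0"
  using hpoly_homogeneous[of r g 0 0] by (simp add: power_0_left)

lemma hpoly_linear: "hpoly 1 (\<lambda>v. \<Sum>i\<in>UNIV. c $ i * v $ i)"
  using hpoly_coord by (intro hpoly_sum hpoly_cmult) auto

lemma hpoly_compose:
  assumes "hpoly r g" "\<And>i. hpoly 1 (\<lambda>v. L v $ i)"
  shows "hpoly r (\<lambda>v. g (L v))"
  using assms(1)
proof (induction rule: hpoly.induct)
  case (coord r g i)
  then show ?case using hpoly_mult[OF assms(2)[of i], of r "\<lambda>v. g (L v)"] by simp
qed (auto intro: hpoly.intros)

text \<open>A polynomial gradient is constructed by induction together with the chain rule along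
  every complex line; the coordinate directions then identify it with \<open>pderiv3\<close>. The
  clause for \<open>r = 0\<close> repairs the truncated \<open>r - 1\<close>: a coordinate times a
  gradient component must again have degree \<open>r\<close> in the inductive step.\<close>

lemma pderiv3_hpoly:
  assumes "hpoly r g"
  shows "(\<forall>i. hpoly (r - 1) (pderiv3 i g)) \<and>
    (\<forall>v w t. ((\<lambda>t. g (v + t *s w)) has_field_derivative
        (\<Sum>i\<in>UNIV. w $ i * pderiv3 i g (v + t *s w))) (at t)) \<and> (r = 0 \<longrightarrow> (\<forall>i. pderiv3 i g = (\<lambda>_. 0)))"
proof -
  have "\<exists>G. (\<forall>i. hpoly (r - 1) (G i)) \<and>
    (\<forall>v w t. ((\<lambda>t. g (v + t *s w)) has_field_derivative
        (\<Sum>i\<in>UNIV. w $ i * G i (v + t *s w))) (at t)) \<and> (r = 0 \<longrightarrow> (\<forall>i. G i = (\<lambda>_. 0)))"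
    using assms
  proof (induction rule: hpoly.induct)
    case (const c)
    show ?case by (rule exI[of _ "\<lambda>_ _. 0"]) (auto intro: hpoly.zero)
  next
    case (zero r)
    show ?case by (rule exI[of _ "\<lambda>_ _. 0"]) (auto intro: hpoly.zero)
  next
    case (add r g h)
    then obtain G H where GH: "(\<forall>i. hpoly (r - 1) (G i))" 
     "\<And>v w t. ((\<lambda>t. g (v + t *s w)) has_field_derivative
        (\<Sum>i\<in>UNIV. w $ i * G i (v + t *s w))) (at t)" "(r = 0 \<longrightarrow> (\<forall>i. G i = (\<lambda>_. 0)))"
     "(\<forall>i. hpoly (r - 1) (H i))" 
     "\<And>v w t. ((\<lambda>t. h (v + t *s w)) has_field_derivative
        (\<Sum>i\<in>UNIV. w $ i * H i (v + t *s w))) (at t)" "(r = 0 \<longrightarrow> (\<forall>i. H i = (\<lambda>_. 0)))" by blast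
    have "((\<lambda>t. g (v + t *s w) + h (v + t *s w)) has_field_derivative
        (\<Sum>i\<in>UNIV. w $ i * (G i (v + t *s w) + H i (v + t *s w)))) (at t)" for v w t
      using DERIV_add[OF GH(2)[of v w t] GH(5)[of v w t]] by (simp add: distrib_left sum.distrib)
    then show ?case
      by (intro exI[of _ "\<lambda>i v. G i v + H i v"]) (use GH(1,3,4,6) in \<open>simp add: hpoly.add\<close>)
  next
    case (coord r g j)
    then obtain G where G: "(\<forall>i. hpoly (r - 1) (G i))" 
     "\<And>v w t. ((\<lambda>t. g (v + t *s w)) has_field_derivative
        (\<Sum>i\<in>UNIV. w $ i * G i (v + t *s w))) (at t)" "(r = 0 \<longrightarrow> (\<forall>i. G i = (\<lambda>_. 0)))" by blast
    have 1: "hpoly r (\<lambda>v. v $ j * G i v)" for i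
    proof (cases "r = 0")
      case True then show ?thesis using G(3) by (auto intro: hpoly.zero)
    next
      case False then show ?thesis using hpoly.coord[of "r - 1" "G i" j] G(1) by simp
    qed
    have 2: "hpoly r (\<lambda>v. (if i = j then 1 else 0) * g v)" for i
      using coord.hyps by (intro hpoly_cmult)
    have 3: "((\<lambda>t. (v + t *s w) $ j * g (v + t *s w)) has_field_derivative
        (\<Sum>i\<in>UNIV. w $ i * ((v + t *s w) $ j * G i (v + t *s w) + (if i = j then 1 else 0) * g (v + t *s w)))) (at t)"
      for v w t
    proof -
      have "((\<lambda>t. (v $ j + t * w $ j) * g (v + t *s w)) has_field_derivative
        w $ j * g (v + t *s w) + (\<Sum>i\<in>UNIV. w $ i * G i (v + t *s w)) * (v $ j + t * w $ j)) (at t)"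
        by (auto intro!: derivative_eq_intros G(2))
      moreover have "(\<Sum>i\<in>UNIV. w $ i * ((v + t *s w) $ j * G i (v + t *s w) + (if i = j then 1 else 0) * g (v + t *s w)))
        = w $ j * g (v + t *s w) + (\<Sum>i\<in>UNIV. w $ i * G i (v + t *s w)) * (v $ j + t * w $ j)"
      proof -
        have "(\<Sum>i\<in>UNIV. w $ i * ((if i = j then 1 else 0) * g (v + t *s w))) 
           = (\<Sum>i\<in>UNIV. if i = j then w $ j * g (v + t *s w) else 0)"
          by (intro sum.cong) auto
        then show ?thesis
          by (simp add: algebra_simps sum.distrib sum_distrib_left sum_distrib_right)
      qed
      ultimately show ?thesis by simp
    qed
    show ?case
    proof (intro exI[of _ "\<lambda>i v. v $ j * G i v + (if i = j then 1 else 0) * g v"] conjI allI)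
      show "hpoly (Suc r - 1) (\<lambda>v. v $ j * G i v + (if i = j then 1 else 0) * g v)" for i
        using hpoly.add[OF 1 2] by simp
    qed (use 3 in simp_all)
  qed
  then obtain G where G: "\<forall>i. hpoly (r - 1) (G i)" "\<And>v w t. ((\<lambda>t. g (v + t *s w)) has_field_derivative
        (\<Sum>i\<in>UNIV. w $ i * G i (v + t *s w))) (at t)" "r = 0 \<longrightarrow> (\<forall>i. G i = (\<lambda>_. 0))" by blast
  have "pderiv3 i g = G i" for i
  proof
    fix v
    have "((\<lambda>t. g (v + t *s axis i 1)) has_field_derivative (\<Sum>k\<in>UNIV. axis i 1 $ k * G k (v + 0 *s axis i 1))) (at 0)"
      by (rule G)
    moreover have "(\<Sum>k\<in>UNIV. axis i 1 $ k * G k (v + 0 *s axis i 1)) = (\<Sum>k\<in>UNIV. if k = i then G i v else 0)"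
      by (intro sum.cong) (auto simp: axis_def)
    ultimately show "pderiv3 i g v = G i v"
      unfolding pderiv3_def by (simp add: DERIV_imp_deriv)
  qed
  then show ?thesis using G by simp
qed

text \<open>Telescoping: the difference for a product with coordinate \<open>i\<close> is
  \<open>(v $ i - P v $ i) * g v + P v $ i * (g v - g (P v))\<close>, and both terms are multiples
  of \<open>l\<close>. The clause for \<open>r = 0\<close> again guards the truncated
  degree.\<close>

lemma hpoly_diff_divides:
  assumes "hpoly r g" "\<And>i. hpoly 1 (\<lambda>v. P v $ i)" "\<And>v i. v $ i - P v $ i = a i * l v" "hpoly 1 l"
  shows "\<exists>h. hpoly (r - 1) h \<and> (r = 0 \<longrightarrow> h = (\<lambda>_. 0)) \<and> (\<forall>v. g v - g (P v) = l v * h v)"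
  using assms(1)
proof (induction rule: hpoly.induct)
  case (const c)
  show ?case by (rule exI[of _ "\<lambda>_. 0"]) (auto intro: hpoly.zero)
next
  case (zero r)
  show ?case by (rule exI[of _ "\<lambda>_. 0"]) (auto intro: hpoly.zero)
next
  case (add r g g')
  then obtain h h' where h: "hpoly (r - 1) h" "r = 0 \<longrightarrow> h = (\<lambda>_. 0)" "\<forall>v. g v - g (P v) = l v * h v"
    "hpoly (r - 1) h'" "r = 0 \<longrightarrow> h' = (\<lambda>_. 0)" "\<forall>v. g' v - g' (P v) = l v * h' v" by blast
  have "g v + g' v - (g (P v) + g' (P v)) = l v * (h v + h' v)" for v
    using h(3,6) by (simp add: distrib_left) (metis add_diff_add)
  then show ?case
    by (intro exI[of _ "\<lambda>v. h v + h' v"]) (use h in \<open>simp add: hpoly.add\<close>)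
next
  case (coord r g i)
  then obtain h where h: "hpoly (r - 1) h" "r = 0 \<longrightarrow> h = (\<lambda>_. 0)" "\<forall>v. g v - g (P v) = l v * h v" by blast
  have 1: "hpoly r (\<lambda>v. P v $ i * h v)"
  proof (cases "r = 0")
    case True then show ?thesis using h by (auto intro: hpoly.zero)
  next
    case False then show ?thesis using hpoly_mult[OF assms(2)[of i] h(1)] by simp
  qed
  show ?case
  proof (intro exI[of _ "\<lambda>v. a i * g v + P v $ i * h v"] conjI allI)
    show "hpoly (Suc r - 1) (\<lambda>v. a i * g v + P v $ i * h v)"
      using 1 coord.hyps by (auto intro: hpoly.add hpoly_cmult)
    fix v
    have "v $ i * g v - P v $ i * g (P v) = (v $ i - P v $ i) * g v + P v $ i * (g v - g (P v))"
      by (simp add: algebra_simps)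
    also have "\<dots> = a i * l v * g v + P v $ i * (l v * h v)"
      by (simp only: assms(3) h(3))
    finally show "v $ i * g v - P v $ i * g (P v) = l v * (a i * g v + P v $ i * h v)"
      by (simp add: algebra_simps)
  qed simp
qed

text \<open>\<open>P\<close> is the projection onto the hyperplane along an axis \<open>k\<close>
  with nonzero coefficient \<open>q $ k\<close>. Since \<open>g\<close> vanishes on the image of
  \<open>P\<close>, the quotient of \<open>g v - g (P v)\<close> is the quotient of \<open>g\<close>
  itself.\<close>

lemma hpoly_divide_linear:
  assumes "hpoly r g" "q \<noteq> 0" and van: "\<And>v. (\<Sum>i\<in>UNIV. q $ i * v $ i) = 0 \<Longrightarrow> g v = 0"
  shows "\<exists>h. hpoly (r - 1) h \<and> (\<forall>v. g v = (\<Sum>i\<in>UNIV. q $ i * v $ i) * h v) \<and> (r = 0 \<longrightarrow> g = (\<lambda>_. 0))"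
proof -
  obtain k where k: "q $ k \<noteq> 0" using assms(2) by (auto simp: vec_eq_iff)
  define l where "l v = (\<Sum>i\<in>UNIV. q $ i * v $ i)" for v :: "complex^3"
  define P where "P v = v - (l v / q $ k) *s axis k 1" for v
  have l: "hpoly 1 l" unfolding l_def by (rule hpoly_linear)
  have P: "hpoly 1 (\<lambda>v. P v $ i)" for i
    using hpoly_diff[OF hpoly_coord[of i] hpoly_cmult[OF l, of "axis k 1 $ i / q $ k"]]
    by (simp add: P_def mult.commute)
  have lP: "l (P v) = 0" for v
  proof -
    have "l (P v) = l v - (\<Sum>i\<in>UNIV. q $ i * (l v / q $ k * axis k 1 $ i))"
      by (simp add: l_def P_def algebra_simps sum_subtractf)
    also have "(\<Sum>i\<in>UNIV. q $ i * (l v / q $ k * axis k 1 $ i)) = (\<Sum>i\<in>UNIV. if i = k then l v else 0)"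
      using k by (intro sum.cong) (auto simp: axis_def)
    finally show ?thesis by simp
  qed
  have "\<exists>h. hpoly (r - 1) h \<and> (r = 0 \<longrightarrow> h = (\<lambda>_. 0)) \<and> (\<forall>v. g v - g (P v) = l v * h v)"
    by (rule hpoly_diff_divides[OF assms(1) P _ l, of "\<lambda>i. axis k 1 $ i / q $ k"]) (simp add: P_def)
  moreover have "g (P v) = 0" for v using van lP by (simp add: l_def)
  ultimately show ?thesis unfolding l_def by fastforce
qed

section \<open>Sections of twisting sheaves\<close>

lemma rep_proj2_nonzero [simp]: "rep_proj2 p \<noteq> 0"
  using Quotient3_rep_reflp[OF Quotient3_proj2, of p] by (simp add: proj_rel_def)

lemma abs_rep_proj2 [simp]: "abs_proj2 (rep_proj2 p) = p"
  by (rule Quotient3_abs_rep[OF Quotient3_proj2])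

lemma rep_abs_proj2:
  assumes "v \<noteq> 0"
  obtains c where "c \<noteq> 0" "rep_proj2 (abs_proj2 v) = c *s v"
proof -
  have "proj_rel v v" using assms by (auto simp: proj_rel_def intro!: exI[of _ 1])
  then have "proj_rel (rep_proj2 (abs_proj2 v)) v"
    by (rule Quotient3_rep_abs[OF Quotient3_proj2])
  then show ?thesis using that by (auto simp: proj_rel_def)
qed

lemma abs_proj2_scale:
  assumes "v \<noteq> 0" "c \<noteq> 0"
  shows "abs_proj2 (c *s v) = abs_proj2 v"
proof -
  have "proj_rel (c *s v) v" using assms by (auto simp: proj_rel_def)
  then show ?thesis using Quotient3_rel[OF Quotient3_proj2] by metis
qed

lemma in_cone_iff: "v \<in> cone U \<longleftrightarrow> v \<noteq> 0 \<and> abs_proj2 v \<in> U"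
  by (simp add: cone_def)

lemma cone_nonzero: "v \<in> cone U \<Longrightarrow> v \<noteq> 0"
  by (simp add: cone_def)

lemma rep_in_cone_iff [simp]: "rep_proj2 p \<in> cone U \<longleftrightarrow> p \<in> U"
  by (simp add: cone_def)

lemma cone_scale: "c \<noteq> 0 \<Longrightarrow> c *s v \<in> cone U \<longleftrightarrow> v \<in> cone U"
  by (cases "v = 0") (auto simp: cone_def abs_proj2_scale)

lemma cone_Int: "cone (U \<inter> V) = cone U \<inter> cone V"
  by (auto simp: cone_def)

lemma cone_mono: "U \<subseteq> V \<Longrightarrow> cone U \<subseteq> cone V"
  by (auto simp: cone_def)

lemma cone_UNIV: "v \<in> cone UNIV \<longleftrightarrow> v \<noteq> 0"
  by (simp add: cone_def)

definition basic_open :: "(complex^3 \<Rightarrow> complex) \<Rightarrow> proj2 set" where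
  "basic_open g = {p. g (rep_proj2 p) \<noteq> 0}"

lemma zariski_open_basic: "hpoly r g \<Longrightarrow> zariski_open (basic_open g)"
  unfolding zariski_open_def basic_open_def hom_poly_iff_hpoly
  by (rule exI[of _ "{g}"]) auto

lemma cone_basic_open:
  assumes "hpoly r g"
  shows "v \<in> cone (basic_open g) \<longleftrightarrow> v \<noteq> 0 \<and> g v \<noteq> 0"
proof (cases "v = 0")
  case False
  then obtain c where "c \<noteq> 0" "rep_proj2 (abs_proj2 v) = c *s v" by (rule rep_abs_proj2)
  then show ?thesis using hpoly_homogeneous[OF assms, of c v] False
    by (simp add: cone_def basic_open_def)
qed (simp add: cone_def)

lemma zariski_open_basis:
  assumes "zariski_open U" "p \<in> U"
  obtains r g where "hpoly r g" "g (rep_proj2 p) \<noteq> 0" "basic_open g \<subseteq> U"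
  using assms unfolding zariski_open_def basic_open_def hom_poly_iff_hpoly by fastforce

lemma zariski_open_Int:
  assumes "zariski_open U" "zariski_open V"
  shows "zariski_open (U \<inter> V)"
proof -
  obtain G H where G: "\<forall>g\<in>G. \<exists>r. hpoly r g" "U = {p. \<exists>g\<in>G. g (rep_proj2 p) \<noteq> 0}"
    and H: "\<forall>g\<in>H. \<exists>r. hpoly r g" "V = {p. \<exists>g\<in>H. g (rep_proj2 p) \<noteq> 0}"
    using assms unfolding zariski_open_def hom_poly_iff_hpoly by blast
  show ?thesis unfolding zariski_open_def hom_poly_iff_hpoly
  proof (intro exI[of _ "{\<lambda>v. g v * h v | g h. g \<in> G \<and> h \<in> H}"] conjI ballI)
    fix f assume "f \<in> {\<lambda>v. g v * h v | g h. g \<in> G \<and> h \<in> H}"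
    then obtain g h where "g \<in> G" "h \<in> H" "f = (\<lambda>v. g v * h v)" by blast
    then show "\<exists>r. hpoly r f" using G(1) H(1) hpoly_mult by blast
  next
    show "U \<inter> V = {p. \<exists>f\<in>{\<lambda>v. g v * h v | g h. g \<in> G \<and> h \<in> H}. f (rep_proj2 p) \<noteq> 0}"
      unfolding G(2) H(2) by (auto, metis mult_eq_0_iff)
  qed
qed

lemma zariski_open_UNIV: "zariski_open UNIV"
  using zariski_open_basic[OF hpoly.const[of 1]] by (simp add: basic_open_def)

lemma open_cone:
  assumes "zariski_open U"
  shows "open (cone U)"
proof -
  have "\<exists>T. open T \<and> v \<in> T \<and> T \<subseteq> cone U" if v: "v \<in> cone U" for v
  proof -
    obtain r g where g: "hpoly r g" "g (rep_proj2 (abs_proj2 v)) \<noteq> 0" "basic_open g \<subseteq> U"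
      using zariski_open_basis[OF assms] v by (metis in_cone_iff)
    have "cone (basic_open g) = {v. v \<noteq> 0} \<inter> {v. g v \<noteq> 0}"
      using cone_basic_open[OF g(1)] by blast
    moreover have "open {v. g v \<noteq> 0}"
      using hpoly_continuous[OF g(1), of UNIV] by (intro open_Collect_neq) (auto intro!: continuous_intros)
    moreover have "open {v::complex^3. v \<noteq> 0}"
      by (intro open_Collect_neq continuous_intros)
    ultimately have "open (cone (basic_open g))" by auto
    moreover have "v \<in> cone (basic_open g)"
      using g(2) v by (auto simp: cone_def basic_open_def)
    ultimately show ?thesis using cone_mono[OF g(3)] by blast
  qed
  then show ?thesis by (subst open_subopen) blast
qed

lemma dual_form_hpoly: "hpoly 1 (dual_form p)"
  unfolding dual_form_def [abs_def] by (rule hpoly_linear)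

lemma dual_form_scale: "dual_form p (c *s v) = c * dual_form p v"
  using hpoly_homogeneous[OF dual_form_hpoly] by simp

lemma cone_dual_line: "v \<in> cone (dual_line p) \<longleftrightarrow> v \<noteq> 0 \<and> dual_form p v = 0"
proof (cases "v = 0")
  case False
  then obtain c where "c \<noteq> 0" "rep_proj2 (abs_proj2 v) = c *s v" by (rule rep_abs_proj2)
  then show ?thesis using False by (simp add: cone_def dual_line_def dual_form_scale)
qed (simp add: cone_def)

lemma twist_iff: "s \<in> twist X n U \<longleftrightarrow> (\<forall>v. v \<notin> cone (U \<inter> X) \<longrightarrow> s v = 0) \<and>
     (\<forall>p\<in>U \<inter> X. \<exists>V g h k l. zariski_open V \<and> p \<in> V \<and> V \<subseteq> U \<and>
        hpoly k g \<and> hpoly l h \<and> int k - int l = n \<and>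
        (\<forall>v\<in>cone (V \<inter> X). h v \<noteq> 0 \<and> s v = g v / h v))"
  unfolding twist_def hom_poly_iff_hpoly by simp

lemma twist_eq_0: "s \<in> twist X n U \<Longrightarrow> v \<notin> cone (U \<inter> X) \<Longrightarrow> s v = 0"
  by (simp add: twist_iff)

lemma twist_local:
  assumes "s \<in> twist X n U" "v \<in> cone (U \<inter> X)"
  obtains V g h k l where "zariski_open V" "v \<in> cone V" "V \<subseteq> U" "hpoly k g" "hpoly l h"
    "int k - int l = n" "\<And>v. v \<in> cone (V \<inter> X) \<Longrightarrow> h v \<noteq> 0" 
    "\<And>v. v \<in> cone (V \<inter> X) \<Longrightarrow> s v = g v / h v"
proof -
  have "abs_proj2 v \<in> U \<inter> X" "v \<noteq> 0" using assms(2) by (auto simp: in_cone_iff)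
  then obtain V g h k l where "zariski_open V" "abs_proj2 v \<in> V" "V \<subseteq> U" "hpoly k g" "hpoly l h"
    "int k - int l = n" "\<forall>v\<in>cone (V \<inter> X). h v \<noteq> 0 \<and> s v = g v / h v"
    using assms(1) unfolding twist_iff by blast
  then show ?thesis using that \<open>v \<noteq> 0\<close> by (simp add: in_cone_iff)
qed

lemma twistI:
  assumes "\<And>v. v \<notin> cone (U \<inter> X) \<Longrightarrow> s v = 0"
    and "\<And>v. v \<in> cone (U \<inter> X) \<Longrightarrow> \<exists>V s'. zariski_open V \<and> v \<in> cone V \<and> V \<subseteq> U \<and>
       s' \<in> twist X n V \<and> (\<forall>v\<in>cone (V \<inter> X). s v = s' v)"
  shows "s \<in> twist X n U"
  unfolding twist_iff
proof (intro conjI allI impI ballI)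
  fix p assume "p \<in> U \<inter> X"
  then have "rep_proj2 p \<in> cone (U \<inter> X)" by simp
  with assms(2) obtain V s' where V: "zariski_open V" "rep_proj2 p \<in> cone V" "V \<subseteq> U"
    "s' \<in> twist X n V" "\<forall>v\<in>cone (V \<inter> X). s v = s' v" by blast
  have "rep_proj2 p \<in> cone (V \<inter> X)" using V(2) \<open>p \<in> U \<inter> X\<close> by simp
  from twist_local[OF V(4) this] obtain W g h k l where W: "zariski_open W" "rep_proj2 p \<in> cone W" "W \<subseteq> V" "hpoly k g" "hpoly l h"
    "int k - int l = n" "\<And>v. v \<in> cone (W \<inter> X) \<Longrightarrow> h v \<noteq> 0" 
    "\<And>v. v \<in> cone (W \<inter> X) \<Longrightarrow> s' v = g v / h v" by metis
  have "\<forall>v\<in>cone (W \<inter> X). h v \<noteq> 0 \<and> s v = g v / h v"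
    using W(7,8) V(5) cone_mono[OF W(3)] by (simp add: cone_Int subset_iff)
  then show "\<exists>V g h k l. zariski_open V \<and> p \<in> V \<and> V \<subseteq> U \<and>
        hpoly k g \<and> hpoly l h \<and> int k - int l = n \<and>
        (\<forall>v\<in>cone (V \<inter> X). h v \<noteq> 0 \<and> s v = g v / h v)"
    using W V(3) by (metis rep_in_cone_iff subset_trans)
qed (use assms(1) in auto)

lemma twist_quotient:
  assumes "zariski_open U" "hpoly k g" "hpoly l h" "int k - int l = n"
    "\<And>v. v \<in> cone (U \<inter> X) \<Longrightarrow> h v \<noteq> 0"
    "\<And>v. v \<in> cone (U \<inter> X) \<Longrightarrow> s v = g v / h v"
    "\<And>v. v \<notin> cone (U \<inter> X) \<Longrightarrow> s v = 0"
  shows "s \<in> twist X n U"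
  unfolding twist_iff using assms by blast

lemma twist_restr:
  assumes "s \<in> twist X n U" "zariski_open V" "V \<subseteq> U"
  shows "restr V s \<in> twist X n V"
  unfolding twist_iff
proof (intro conjI allI impI ballI)
  fix v assume "v \<notin> cone (V \<inter> X)"
  then show "restr V s v = 0"
    using twist_eq_0[OF assms(1), of v] by (auto simp: restr_def cone_Int)
next
  fix p assume p: "p \<in> V \<inter> X"
  then have "rep_proj2 p \<in> cone (U \<inter> X)" using assms(3) by auto
  from twist_local[OF assms(1) this] obtain W g h k l where W: "zariski_open W" "rep_proj2 p \<in> cone W" "W \<subseteq> U" "hpoly k g" "hpoly l h"
    "int k - int l = n" "\<And>v. v \<in> cone (W \<inter> X) \<Longrightarrow> h v \<noteq> 0" 
    "\<And>v. v \<in> cone (W \<inter> X) \<Longrightarrow> s v = g v / h v" by metis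
  show "\<exists>W g h k l. zariski_open W \<and> p \<in> W \<and> W \<subseteq> V \<and>
        hpoly k g \<and> hpoly l h \<and> int k - int l = n \<and>
        (\<forall>v\<in>cone (W \<inter> X). h v \<noteq> 0 \<and> restr V s v = g v / h v)"
    by (intro exI[of _ "W \<inter> V"] exI[of _ g] exI[of _ h] exI[of _ k] exI[of _ l])
      (use W p assms(2) in \<open>auto simp: zariski_open_Int restr_def cone_Int\<close>)
qed

lemma twist_restrict_support:
  assumes "s \<in> twist X n U" "Y \<subseteq> X"
  shows "(\<lambda>v. if v \<in> cone Y then s v else 0) \<in> twist Y n U"
  unfolding twist_iff
proof (intro conjI allI impI ballI)
  fix v assume "v \<notin> cone (U \<inter> Y)"
  then show "(if v \<in> cone Y then s v else 0) = 0"
    using twist_eq_0[OF assms(1), of v] by (auto simp: cone_Int)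
next
  fix p assume p: "p \<in> U \<inter> Y"
  then have "rep_proj2 p \<in> cone (U \<inter> X)" using assms(2) by auto
  from twist_local[OF assms(1) this] obtain W g h k l where W: "zariski_open W" "rep_proj2 p \<in> cone W" "W \<subseteq> U" "hpoly k g" "hpoly l h"
    "int k - int l = n" "\<And>v. v \<in> cone (W \<inter> X) \<Longrightarrow> h v \<noteq> 0" 
    "\<And>v. v \<in> cone (W \<inter> X) \<Longrightarrow> s v = g v / h v" by metis
  have "cone Y \<subseteq> cone X" by (rule cone_mono[OF assms(2)])
  then show "\<exists>W g h k l. zariski_open W \<and> p \<in> W \<and> W \<subseteq> U \<and>
        hpoly k g \<and> hpoly l h \<and> int k - int l = n \<and>
        (\<forall>v\<in>cone (W \<inter> Y). h v \<noteq> 0 \<and> (if v \<in> cone Y then s v else 0) = g v / h v)"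
    by (intro exI[of _ "W"] exI[of _ g] exI[of _ h] exI[of _ k] exI[of _ l])
      (use W in \<open>auto simp: cone_Int\<close>)
qed

text \<open>Two supports are allowed so that a section living on a line can be multiplied by a
  function on the plane.\<close>

lemma twist_mult:
  assumes "s \<in> twist X m U" "s' \<in> twist Y n U" "X \<subseteq> Y"
  shows "(\<lambda>v. s v * s' v) \<in> twist X (m + n) U"
proof (rule twistI)
  fix v assume "v \<notin> cone (U \<inter> X)"
  then show "s v * s' v = 0" using twist_eq_0[OF assms(1)] by simp
next
  fix v assume v: "v \<in> cone (U \<inter> X)"
  have XY: "cone X \<subseteq> cone Y" by (rule cone_mono[OF assms(3)])
  from twist_local[OF assms(1) v] obtain V g h k l where V: "zariski_open V" "v \<in> cone V" "V \<subseteq> U" "hpoly k g" "hpoly l h"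
    "int k - int l = m" "\<And>v. v \<in> cone (V \<inter> X) \<Longrightarrow> h v \<noteq> 0" 
    "\<And>v. v \<in> cone (V \<inter> X) \<Longrightarrow> s v = g v / h v" by metis
  have "v \<in> cone (U \<inter> Y)" using v XY by (auto simp: cone_Int)
  from twist_local[OF assms(2) this] obtain V' g' h' k' l' where V': "zariski_open V'" "v \<in> cone V'" "V' \<subseteq> U" "hpoly k' g'" "hpoly l' h'"
    "int k' - int l' = n" "\<And>v. v \<in> cone (V' \<inter> Y) \<Longrightarrow> h' v \<noteq> 0" 
    "\<And>v. v \<in> cone (V' \<inter> Y) \<Longrightarrow> s' v = g' v / h' v" by metis
  define W where "W = V \<inter> V'"
  have "(\<lambda>v. if v \<in> cone (W \<inter> X) then (g v * g' v) / (h v * h' v) else 0) \<in> twist X (m + n) W"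
    by (rule twist_quotient[OF _ hpoly_mult[OF V(4) V'(4)] hpoly_mult[OF V(5) V'(5)]])
      (use V V' XY in \<open>auto simp: W_def zariski_open_Int cone_Int subset_iff\<close>)
  moreover have "\<forall>v\<in>cone (W \<inter> X). s v * s' v = (if v \<in> cone (W \<inter> X) then (g v * g' v) / (h v * h' v) else 0)"
    using V V' XY by (auto simp: W_def cone_Int subset_iff)
  moreover have "zariski_open W" "v \<in> cone W" "W \<subseteq> U"
    using V V' by (auto simp: W_def zariski_open_Int cone_Int)
  ultimately show "\<exists>W t. zariski_open W \<and> v \<in> cone W \<and> W \<subseteq> U \<and>
       t \<in> twist X (m + n) W \<and> (\<forall>v\<in>cone (W \<inter> X). s v * s' v = t v)" by blast
qed

lemma twist_add:
  assumes "s \<in> twist X n U" "s' \<in> twist X n U"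
  shows "(\<lambda>v. s v + s' v) \<in> twist X n U"
proof (rule twistI)
  fix v assume "v \<notin> cone (U \<inter> X)"
  then show "s v + s' v = 0" using twist_eq_0[OF assms(1)] twist_eq_0[OF assms(2)] by simp
next
  fix v assume v: "v \<in> cone (U \<inter> X)"
  from twist_local[OF assms(1) v] obtain V g h k l where V: "zariski_open V" "v \<in> cone V" "V \<subseteq> U" "hpoly k g" "hpoly l h"
    "int k - int l = n" "\<And>v. v \<in> cone (V \<inter> X) \<Longrightarrow> h v \<noteq> 0" 
    "\<And>v. v \<in> cone (V \<inter> X) \<Longrightarrow> s v = g v / h v" by metis
  from twist_local[OF assms(2) v] obtain V' g' h' k' l' where V': "zariski_open V'" "v \<in> cone V'" "V' \<subseteq> U" "hpoly k' g'" "hpoly l' h'"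
    "int k' - int l' = n" "\<And>v. v \<in> cone (V' \<inter> X) \<Longrightarrow> h' v \<noteq> 0" 
    "\<And>v. v \<in> cone (V' \<inter> X) \<Longrightarrow> s' v = g' v / h' v" by metis
  define W where "W = V \<inter> V'"
  have e: "k' + l = k + l'" using V(6) V'(6) by linarith
  have hp: "hpoly (k + l') (\<lambda>v. g v * h' v + g' v * h v)"
    using hpoly.add[OF hpoly_mult[OF V(4) V'(5)]] hpoly_mult[OF V'(4) V(5)] e by simp
  have "(\<lambda>v. if v \<in> cone (W \<inter> X) then (g v * h' v + g' v * h v) / (h v * h' v) else 0) \<in> twist X n W"
    by (rule twist_quotient[OF _ hp hpoly_mult[OF V(5) V'(5)]])
      (use V V' in \<open>auto simp: W_def zariski_open_Int cone_Int subset_iff\<close>)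
  moreover have "\<forall>v\<in>cone (W \<inter> X). s v + s' v = (if v \<in> cone (W \<inter> X) then (g v * h' v + g' v * h v) / (h v * h' v) else 0)"
    using V V' by (auto simp: W_def cone_Int subset_iff field_simps)
  moreover have "zariski_open W" "v \<in> cone W" "W \<subseteq> U"
    using V V' by (auto simp: W_def zariski_open_Int cone_Int)
  ultimately show "\<exists>W t. zariski_open W \<and> v \<in> cone W \<and> W \<subseteq> U \<and>
       t \<in> twist X n W \<and> (\<forall>v\<in>cone (W \<inter> X). s v + s' v = t v)" by blast
qed

lemma twist_hpoly:
  assumes "hpoly n g" "zariski_open U"
  shows "(\<lambda>v. if v \<in> cone (U \<inter> X) then g v else 0) \<in> twist X (int n) U"
  by (rule twist_quotient[OF assms(2,1) hpoly.const[of 1]]) auto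

lemma twist_const: "zariski_open U \<Longrightarrow> (\<lambda>v. if v \<in> cone U then c else 0) \<in> twist UNIV 0 U"
  using twist_hpoly[OF hpoly.const, of U UNIV c] by simp

lemma twist_cmult:
  assumes "s \<in> twist X n U"
  shows "(\<lambda>v. c * s v) \<in> twist X n U"
proof (rule twistI)
  fix v assume "v \<notin> cone (U \<inter> X)"
  then show "c * s v = 0" using twist_eq_0[OF assms(1)] by simp
next
  fix v assume v: "v \<in> cone (U \<inter> X)"
  from twist_local[OF assms(1) v] obtain V g h k l where V: "zariski_open V" "v \<in> cone V" "V \<subseteq> U" "hpoly k g" "hpoly l h"
    "int k - int l = n" "\<And>v. v \<in> cone (V \<inter> X) \<Longrightarrow> h v \<noteq> 0" 
    "\<And>v. v \<in> cone (V \<inter> X) \<Longrightarrow> s v = g v / h v" by metis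
  have "(\<lambda>v. if v \<in> cone (V \<inter> X) then c * g v / h v else 0) \<in> twist X n V"
    by (rule twist_quotient[OF V(1) hpoly_cmult[OF V(4), of c] V(5)]) (use V in auto)
  then show "\<exists>W t. zariski_open W \<and> v \<in> cone W \<and> W \<subseteq> U \<and>
       t \<in> twist X n W \<and> (\<forall>v\<in>cone (W \<inter> X). c * s v = t v)"
    using V by (intro exI[of _ V] exI conjI) auto
qed

lemma twist_homogeneous:
  assumes "s \<in> twist X n U" "c \<noteq> 0"
  shows "s (c *s v) = c powi n * s v"
proof (cases "v \<in> cone (U \<inter> X)")
  case True
  from twist_local[OF assms(1) True] obtain V g h k l where V: "zariski_open V" "v \<in> cone V" "V \<subseteq> U" "hpoly k g" "hpoly l h"
    "int k - int l = n" "\<And>v. v \<in> cone (V \<inter> X) \<Longrightarrow> h v \<noteq> 0" 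
    "\<And>v. v \<in> cone (V \<inter> X) \<Longrightarrow> s v = g v / h v" by metis
  have v: "v \<in> cone (V \<inter> X)" using V(2) True by (simp add: cone_Int)
  then have cv: "c *s v \<in> cone (V \<inter> X)" using assms(2) by (simp add: cone_scale)
  have "c powi n = c ^ k / c ^ l"
    using assms(2) V(6) by (metis power_int_diff power_int_of_nat)
  then show ?thesis
    using V(8)[OF v] V(8)[OF cv] hpoly_homogeneous[OF V(4)] hpoly_homogeneous[OF V(5)] by simp
next
  case False
  then have "c *s v \<notin> cone (U \<inter> X)" using assms(2) by (simp add: cone_scale)
  then show ?thesis using twist_eq_0[OF assms(1)] False by simp
qed

lemma twist_continuous:
  assumes "s \<in> twist UNIV n U" "zariski_open U"
  shows "continuous_on (cone U) s"
proof (rule continuous_at_imp_continuous_on, rule ballI)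
  fix v assume "v \<in> cone U"
  then have "v \<in> cone (U \<inter> UNIV)" by simp
  from twist_local[OF assms(1) this] obtain V g h k l where V: "zariski_open V" "v \<in> cone V" "V \<subseteq> U" "hpoly k g" "hpoly l h"
    "int k - int l = n" "\<And>v. v \<in> cone V \<Longrightarrow> h v \<noteq> 0" 
    "\<And>v. v \<in> cone V \<Longrightarrow> s v = g v / h v" by (metis Int_UNIV_right)
  have "continuous_on (cone V) (\<lambda>v. g v / h v)"
    using V by (intro continuous_on_divide hpoly_continuous) auto
  then have "continuous_on (cone V) s"
    by (rule continuous_on_eq) (simp add: V)
  then show "isCont s v"
    using open_cone[OF V(1)] V(2) by (simp add: continuous_on_eq_continuous_at)
qed

lemma continuous_on_line: "continuous_on S (\<lambda>t. u + t *s (v::complex^3))"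
proof -
  have "(\<lambda>t. u + t *s v) = (\<lambda>t. \<chi> i. u $ i + t * v $ i)"
    by (auto simp: vec_eq_iff)
  moreover have "continuous_on S (\<lambda>t. \<chi> i. u $ i + t * v $ i)"
    by (intro continuous_on_vec_lambda continuous_intros)
  ultimately show ?thesis by (simp only:)
qed

lemma hpoly_line_differentiable:
  "hpoly r g \<Longrightarrow> (\<lambda>t. g (u + t *s v)) field_differentiable (at t)"
  using pderiv3_hpoly field_differentiable_def by blast

lemma twist_line_holomorphic:
  assumes s: "s \<in> twist X n UNIV" and uv: "\<And>t. u + t *s v \<in> cone X"
  shows "(\<lambda>t. s (u + t *s v)) holomorphic_on UNIV"
  unfolding holomorphic_on_def
proof
  fix t0 :: complex
  have "u + t0 *s v \<in> cone (UNIV \<inter> X)" using uv by simp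
  from twist_local[OF s this] obtain V g h k l where V: "zariski_open V" "u + t0 *s v \<in> cone V" "hpoly k g" "hpoly l h"
    "\<And>v. v \<in> cone (V \<inter> X) \<Longrightarrow> h v \<noteq> 0" 
    "\<And>v. v \<in> cone (V \<inter> X) \<Longrightarrow> s v = g v / h v" by metis
  define T where "T = (\<lambda>t. u + t *s v) -` cone V"
  have "continuous_on UNIV (\<lambda>t. u + t *s v)" by (rule continuous_on_line)
  then have T: "open T" "t0 \<in> T"
    using open_cone[OF V(1)] V(2) by (auto simp: T_def intro: open_vimage)
  have in_VX: "u + t *s v \<in> cone (V \<inter> X)" if "t \<in> T" for t
    using that uv by (auto simp: T_def cone_Int)
  have "(\<lambda>t. g (u + t *s v) / h (u + t *s v)) field_differentiable at t0"
    using V(5)[OF in_VX[OF T(2)]] V(3,4)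
    by (intro field_differentiable_divide hpoly_line_differentiable) auto
  then obtain D where D: "((\<lambda>t. g (u + t *s v) / h (u + t *s v)) has_field_derivative D) (at t0)"
    by (auto simp: field_differentiable_def)
  have "((\<lambda>t. s (u + t *s v)) has_field_derivative D) (at t0)"
    by (rule has_field_derivative_transform_within_open[OF D T]) (simp add: V(6) in_VX)
  then have "(\<lambda>t. s (u + t *s v)) field_differentiable at t0"
    by (auto simp: field_differentiable_def)
  then show "(\<lambda>t. s (u + t *s v)) field_differentiable at t0 within UNIV" by simp
qed


text \<open>In an affine parameter of the line, the section is entire of polynomial growth, so Liouville's
  theorem applies.\<close>
lemma twist_line_polynomial:
  assumes s: "s \<in> twist X n UNIV"
    and uv: "\<And>w r. (w, r) \<noteq> (0, 0) \<Longrightarrow> w *s u + r *s v \<in> cone X"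
  shows "\<exists>p. (p \<noteq> 0 \<longrightarrow> int (degree p) \<le> n) \<and> (\<forall>t. s (u + t *s v) = poly p t) \<and>
    (0 \<le> n \<longrightarrow> s v = coeff p (nat n)) \<and> (n < 0 \<longrightarrow> s v = 0)"
proof -
  define F where "F t = s (u + t *s v)" for t
  define G where "G t = s (v + t *s u)" for t
  have holF: "F holomorphic_on UNIV"
    unfolding F_def using uv[of 1] by (intro twist_line_holomorphic[OF s]) simp
  have holG: "G holomorphic_on UNIV"
    unfolding G_def using uv[of _ 1] by (intro twist_line_holomorphic[OF s]) (simp add: add.commute)
  \<comment> \<open>\<open>F\<close> and \<open>G\<close> are the section in the two standard charts
    of the projective line, and homogeneity of degree \<open>n\<close> is the transition between
    them.\<close>
  have FG: "F t = t powi n * G (1 / t)" if "t \<noteq> 0" for t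
    using twist_homogeneous[OF s that, of "v + (1 / t) *s u"] that
    by (simp add: F_def G_def vector_add_ldistrib vector_smult_assoc add.commute)
  have contG: "continuous_on S G" for S
    using holG holomorphic_on_imp_continuous_on continuous_on_subset by blast
  have "compact (G ` cball 0 1)"
    by (intro compact_continuous_image contG compact_cball)
  then have "bounded (G ` cball 0 1)" by (rule compact_imp_bounded)
  then obtain B where "\<forall>x\<in>G ` cball 0 1. norm x \<le> B" unfolding bounded_iff by blast
  then have B: "norm (G t) \<le> B" if "norm t \<le> 1" for t using that by simp
  have B0: "0 \<le> B" using order_trans[OF norm_ge_zero B[of 0]] by simp
  \<comment> \<open>For \<open>t\<close> outside the unit disc, \<open>1 / t\<close> stays in the
    compact unit disc, where \<open>G\<close> is bounded. So \<open>F\<close> grows at most like the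
    \<open>n\<close>-th power.\<close>
  have FB: "norm (F t) \<le> B * norm t powi n" if "1 \<le> norm t" for t
  proof -
    have "norm (1 / t) \<le> 1" using that by (subst norm_divide, subst divide_le_eq_1_pos) auto
    then have "norm (G (1 / t)) \<le> B" by (rule B)
    moreover have "t \<noteq> 0" using that by auto
    ultimately show ?thesis
      using FG[of t] by (simp add: norm_mult norm_power_int mult.commute mult_right_mono)
  qed
  have lim: "(G \<longlongrightarrow> G 0) (at 0)"
    using contG[of UNIV] by (simp add: continuous_on_def)
  show ?thesis
  proof (cases "0 \<le> n")
    case True
    define m where "m = nat n"
    have n: "n = int m" using True by (simp add: m_def)
    define c where "c k = (deriv ^^ k) F 0 / fact k" for k
    have F: "F t = (\<Sum>k\<le>m. c k * t ^ k)" for t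
      unfolding c_def using FB n by (intro Liouville_polynomial[OF holF]) auto
    define p where "p = (\<Sum>k\<le>m. monom (c k) k)"
    have p: "poly p t = F t" for t by (simp add: p_def poly_sum poly_monom F)
    have deg: "degree p \<le> m"
      unfolding p_def by (intro degree_sum_le) (auto intro: order_trans[OF degree_monom_le])
    have cp: "coeff p m = c m" by (simp add: p_def coeff_sum)
    have GQ: "G t = (\<Sum>k\<le>m. c k * t ^ (m - k))" if "t \<noteq> 0" for t
    proof -
      have "F (1 / t) = (1 / t) ^ m * G t" using FG[of "1 / t"] that n by simp
      then have "G t = t ^ m * F (1 / t)" using that by (simp add: field_simps)
      also have "\<dots> = (\<Sum>k\<le>m. c k * t ^ (m - k))"
        unfolding F sum_distrib_left
      proof (intro sum.cong refl)
        fix k assume "k \<in> {..m}"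
        then have "t ^ m = t ^ (m - k) * t ^ k" by (simp flip: power_add)
        then show "t ^ m * (c k * (1 / t) ^ k) = c k * t ^ (m - k)"
          using that by (simp add: field_simps)
      qed
      finally show ?thesis .
    qed
    \<comment> \<open>The value at the point at infinity \<open>v\<close> is \<open>G 0\<close>,
      where the transition formula says nothing. It is recovered as the limit of the reversed
      polynomial, which leaves the top coefficient.\<close>
    have "((\<lambda>t. \<Sum>k\<le>m. c k * t ^ (m - k)) \<longlongrightarrow> (\<Sum>k\<le>m. c k * 0 ^ (m - k))) (at (0::complex))"
      by (intro tendsto_intros)
    then have "(G \<longlongrightarrow> (\<Sum>k\<le>m. c k * 0 ^ (m - k))) (at (0::complex))"
      by (rule Lim_transform_eventually) (simp add: eventually_at_filter GQ)
    then have "G 0 = (\<Sum>k\<le>m. c k * 0 ^ (m - k))"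
      using lim by (intro tendsto_unique[of "at (0::complex)" G]) auto
    also have "\<dots> = (\<Sum>k\<le>m. if k = m then c m else 0)"
      by (intro sum.cong) (auto simp: power_0_left)
    finally have "s v = coeff p m" by (simp add: G_def cp)
    then show ?thesis
      using p deg True n by (intro exI[of _ p]) (auto simp: F_def)
  next
    case False
    have small: "norm (F t) \<le> B / norm t" if "1 \<le> norm t" for t
    proof -
      have "norm t powi n \<le> norm t powi (-1)"
        using that False by (intro power_int_increasing) auto
      then have "B * norm t powi n \<le> B * norm t powi (-1)"
        using B0 mult_left_mono by blast
      then show ?thesis using FB[OF that] by (simp add: power_int_minus divide_inverse)
    qed
    have "(F \<longlongrightarrow> 0) at_infinity"
    proof (rule Lim_null_comparison)
      show "\<forall>\<^sub>F t in at_infinity. norm (F t) \<le> B / norm t"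
        using small by (auto simp: eventually_at_infinity)
      show "((\<lambda>t. B / norm t) \<longlongrightarrow> 0) (at_infinity :: complex filter)"
        by (rule tendsto_divide_0[OF tendsto_const filterlim_at_top_imp_at_infinity[OF filterlim_norm_at_top]])
    qed
    then have F0: "F t = 0" for t using Liouville_weak_0[OF holF] by blast
    have "G t = 0" if "t \<noteq> 0" for t
      using FG[of "1 / t"] F0 that by simp
    then have "(G \<longlongrightarrow> 0) (at 0)"
      by (intro Lim_transform_eventually[OF tendsto_const]) (simp add: eventually_at_filter)
    then have "G 0 = 0" using lim by (intro tendsto_unique[of "at (0::complex)" G]) auto
    then show ?thesis using F0 False by (intro exI[of _ 0]) (auto simp: F_def G_def)
  qed
qed

lemma twist_binary_form:
  assumes s: "s \<in> twist X (int n) UNIV"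
    and uv: "\<And>w r. (w, r) \<noteq> (0, 0) \<Longrightarrow> w *s u + r *s v \<in> cone X"
  obtains p where "degree p \<le> n" "\<And>t. s (u + t *s v) = poly p t"
    "\<And>w r. (w, r) \<noteq> (0, 0) \<Longrightarrow> s (w *s u + r *s v) = (\<Sum>i\<le>n. coeff p i * r ^ i * w ^ (n - i))"
proof -
  obtain p where p: "p \<noteq> 0 \<longrightarrow> degree p \<le> n" "\<And>t. s (u + t *s v) = poly p t" "s v = coeff p n"
    using twist_line_polynomial[OF s uv] by (metis nat_int of_nat_0_le_iff of_nat_le_iff)
  have deg: "degree p \<le> n" using p(1) by (cases "p = 0") auto
  have "s (w *s u + r *s v) = (\<Sum>i\<le>n. coeff p i * r ^ i * w ^ (n - i))" if "(w, r) \<noteq> (0, 0)" for w r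
  proof (cases "w = 0")
    case True
    then have "s (w *s u + r *s v) = r ^ n * coeff p n"
      using twist_homogeneous[OF s, of r v] that p(3) by simp
    also have "\<dots> = (\<Sum>i\<le>n. if i = n then coeff p n * r ^ n else 0)" by simp
    also have "\<dots> = (\<Sum>i\<le>n. coeff p i * r ^ i * w ^ (n - i))"
      using True by (intro sum.cong) (auto simp: power_0_left)
    finally show ?thesis .
  next
    case False
    have "s (w *s u + r *s v) = w ^ n * s (u + (r / w) *s v)"
      using twist_homogeneous[OF s False, of "u + (r / w) *s v"] False
      by (simp add: vector_add_ldistrib vector_smult_assoc)
    also have "\<dots> = (\<Sum>i\<le>n. w ^ n * (coeff p i * (r / w) ^ i))"
      unfolding p(2) poly_altdef sum_distrib_left
      using deg by (intro sum.mono_neutral_left) (auto simp: coeff_eq_0)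
    also have "\<dots> = (\<Sum>i\<le>n. coeff p i * r ^ i * w ^ (n - i))"
    proof (intro sum.cong refl)
      fix i assume "i \<in> {..n}"
      then have "w ^ n = w ^ (n - i) * w ^ i" by (simp flip: power_add)
      then show "w ^ n * (coeff p i * (r / w) ^ i) = coeff p i * r ^ i * w ^ (n - i)"
        using False by (simp add: field_simps)
    qed
    finally show ?thesis .
  qed
  then show ?thesis using that deg p(2) by blast
qed

section \<open>Restriction of the syzygy sheaf to a line\<close>

text \<open>The complement of a hyperplane is dense: a point of it is left along an axis
  \<open>k\<close> with \<open>q $ k \<noteq> 0\<close>, and continuity brings the value back. Later
  it serves to cancel a linear factor and to ignore a bad hyperplane in the verification of
  identities.\<close>

lemma vanish_off_hyperplane:
  fixes \<psi> :: "complex^3 \<Rightarrow> complex"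
  assumes S: "open S" "continuous_on S \<psi>" "v \<in> S" and q: "q \<noteq> 0"
    and zero: "\<And>v. v \<in> S \<Longrightarrow> (\<Sum>i\<in>UNIV. q $ i * v $ i) \<noteq> 0 \<Longrightarrow> \<psi> v = 0"
  shows "\<psi> v = 0"
proof (cases "(\<Sum>i\<in>UNIV. q $ i * v $ i) = 0")
  case True
  obtain k where k: "q $ k \<noteq> 0" using q by (auto simp: vec_eq_iff)
  define w :: "complex^3" where "w = axis k 1"
  have lw: "(\<Sum>i\<in>UNIV. q $ i * w $ i) = q $ k"
  proof -
    have "(\<Sum>i\<in>UNIV. q $ i * w $ i) = (\<Sum>i\<in>UNIV. if i = k then q $ k else 0)"
      by (intro sum.cong) (auto simp: w_def axis_def)
    then show ?thesis by simp
  qed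
  have lin: "(\<Sum>i\<in>UNIV. q $ i * (v + t *s w) $ i) = t * q $ k" for t
  proof -
    have "(\<Sum>i\<in>UNIV. q $ i * (v + t *s w) $ i) = 
      (\<Sum>i\<in>UNIV. q $ i * v $ i) + t * (\<Sum>i\<in>UNIV. q $ i * w $ i)"
      by (simp add: sum_distrib_left sum.distrib algebra_simps)
    then show ?thesis using True lw by simp
  qed
  define T where "T = (\<lambda>t. v + t *s w) -` S"
  have T: "open T" "0 \<in> T"
    using continuous_on_line[of UNIV v w] S by (auto simp: T_def intro: open_vimage)
  have "continuous_on T (\<lambda>t. \<psi> (v + t *s w))"
    by (rule continuous_on_compose2[OF S(2) continuous_on_line]) (auto simp: T_def)
  then have "((\<lambda>t. \<psi> (v + t *s w)) \<longlongrightarrow> \<psi> (v + 0 *s w)) (at 0)"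
    using T unfolding continuous_on_def by (metis at_within_open)
  moreover have "((\<lambda>t. \<psi> (v + t *s w)) \<longlongrightarrow> 0) (at 0)"
  proof (rule Lim_transform_within_open[OF tendsto_const T])
    fix t assume t: "t \<in> T" "t \<noteq> 0"
    have "\<psi> (v + t *s w) = 0"
      by (rule zero) (use t k lin[of t] in \<open>simp_all add: T_def\<close>)
    then show "0 = \<psi> (v + t *s w)" by simp
  qed
  ultimately have "\<psi> (v + 0 *s w) = 0"
    using tendsto_unique trivial_limit_at by blast
  then show ?thesis by simp
qed (use S zero in blast)

lemma dual_form_vanish_off:
  fixes \<psi> :: "complex^3 \<Rightarrow> complex"
  assumes "open S" "continuous_on S \<psi>" "v \<in> S"
    and "\<And>v. v \<in> S \<Longrightarrow> dual_form p v \<noteq> 0 \<Longrightarrow> \<psi> v = 0"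
  shows "\<psi> v = 0"
  using vanish_off_hyperplane[OF assms(1-3) rep_proj2_nonzero[of p]] assms(4)
  by (simp add: dual_form_def)

section \<open>Sections of the syzygy sheaf and those vanishing on a line\<close>

lemma syz_sheafD:
  assumes "\<rho> \<in> syz_sheaf f U"
  shows "(\<lambda>v. \<rho> v $ i) \<in> twist UNIV 0 U" "(\<Sum>i\<in>UNIV. \<rho> v $ i * pderiv3 i f v) = 0"
  using assms by (auto simp: syz_sheaf_def)

lemma syz_sheaf_add:
  "\<rho> \<in> syz_sheaf f U \<Longrightarrow> \<sigma> \<in> syz_sheaf f U \<Longrightarrow> (\<lambda>v. \<rho> v + \<sigma> v) \<in> syz_sheaf f U"
  by (auto simp: syz_sheaf_def sum.distrib distrib_right intro!: twist_add)

lemma syz_sheaf_scale: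
  assumes "g \<in> twist UNIV 0 U" "\<rho> \<in> syz_sheaf f U"
  shows "(\<lambda>v. g v *s \<rho> v) \<in> syz_sheaf f U"
  using assms twist_mult[OF assms(1) syz_sheafD(1)[OF assms(2)]]
  by (auto simp: syz_sheaf_def mult.assoc sum_distrib_left[symmetric])

lemma restr_component: "(\<lambda>v. restr V \<rho> v $ i) = restr V (\<lambda>v. \<rho> v $ i)"
  by (auto simp: restr_def)

lemma syz_sheaf_restr:
  assumes "\<rho> \<in> syz_sheaf f U" "zariski_open V" "V \<subseteq> U"
  shows "restr V \<rho> \<in> syz_sheaf f V"
proof -
  have "(\<lambda>v. restr V \<rho> v $ i) \<in> twist UNIV 0 V" for i
    unfolding restr_component by (rule twist_restr[OF syz_sheafD(1)[OF assms(1)] assms(2,3)])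
  moreover have "(\<Sum>i\<in>UNIV. restr V \<rho> v $ i * pderiv3 i f v) = 0" for v
    using syz_sheafD(2)[OF assms(1)] by (simp add: restr_def)
  ultimately show ?thesis by (simp add: syz_sheaf_def)
qed

text \<open>The local trivialisation of O(k) by powers of a nonvanishing coordinate, for negative
  \<open>k\<close> as well.\<close>

lemma coord_power_int_twist:
  assumes "zariski_open W" "\<And>v. v \<in> cone W \<Longrightarrow> v $ j \<noteq> 0"
  shows "(\<lambda>v. if v \<in> cone W then v $ j powi k else 0) \<in> twist UNIV k W"
proof (cases "0 \<le> k")
  case True
  show ?thesis
    by (rule twist_quotient[OF assms(1) hpoly_power[OF hpoly_coord, of "nat k" j] hpoly.const[of 1]])
      (use True in \<open>auto simp: power_int_def\<close>)
next
  case False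
  show ?thesis
    by (rule twist_quotient[OF assms(1) hpoly.const[of 1] hpoly_power[OF hpoly_coord, of "nat (- k)" j]])
      (use False assms(2) in \<open>auto simp: power_int_def field_simps\<close>)
qed

text \<open>For negative \<open>n\<close> the encoding still demands a local quotient of degree
  difference \<open>n\<close>, even for the zero section; a coordinate power multiplied by 0
  supplies it.\<close>

lemma twist_zero:
  assumes "zariski_open U"
  shows "(\<lambda>_. 0) \<in> twist X n U"
proof (rule twistI)
  fix v assume v: "v \<in> cone (U \<inter> X)"
  then have "v \<noteq> 0" by (rule cone_nonzero)
  then obtain j where j: "v $ j \<noteq> 0" by (auto simp: vec_eq_iff)
  define V where "V = U \<inter> basic_open (\<lambda>v. v $ j)"
  have V: "zariski_open V" "v \<in> cone V" "V \<subseteq> U"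
    using assms v zariski_open_basic[OF hpoly_coord] j \<open>v \<noteq> 0\<close>
    by (auto simp: V_def zariski_open_Int cone_Int cone_basic_open[OF hpoly_coord])
  have "(\<lambda>v. if v \<in> cone V then v $ j powi n else 0) \<in> twist UNIV n V"
    by (rule coord_power_int_twist[OF V(1)]) (auto simp: V_def cone_Int cone_basic_open[OF hpoly_coord])
  from twist_cmult[OF this, of 0] have "(\<lambda>_. 0) \<in> twist UNIV n V" by simp
  from twist_restrict_support[OF this, of X] have "(\<lambda>_. 0) \<in> twist X n V" by simp
  then show "\<exists>V s'. zariski_open V \<and> v \<in> cone V \<and> V \<subseteq> U \<and> s' \<in> twist X n V \<and>
      (\<forall>v\<in>cone (V \<inter> X). 0 = s' v)"
    using V by (intro exI[of _ V] exI[of _ "\<lambda>_. 0"]) auto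
qed simp

text \<open>The coordinate factor places the neighbourhood inside a standard affine chart, which is
  needed to bring quotients to degree 0. It also makes the degree of \<open>m\<close> positive, so
  that \<open>m\<close> vanishes at the origin.\<close>

lemma common_basic_open:
  assumes "zariski_open U" "p \<in> U"
  obtains r m j where "hpoly (Suc r) m" "m (rep_proj2 p) \<noteq> 0" "basic_open m \<subseteq> U"
    "\<And>v. m v \<noteq> 0 \<Longrightarrow> v $ j \<noteq> 0"
proof -
  obtain r g where g: "hpoly r g" "g (rep_proj2 p) \<noteq> 0" "basic_open g \<subseteq> U"
    using zariski_open_basis[OF assms] by blast
  obtain j where j: "rep_proj2 p $ j \<noteq> 0"
    using rep_proj2_nonzero[of p] by (metis vec_eq_iff zero_index)
  show ?thesis
    by (rule that[OF hpoly.coord[OF g(1), of j], of j]) (use g j in \<open>auto simp: basic_open_def\<close>)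
qed

text \<open>E is saturated in O^3, because the quotient O^3/E embeds into the torsion free sheaf
  O(d-1). So if a syzygy vanishes on the line, it is divisible by the equation of the line as a
  vector, and the quotient is again a syzygy. The product of ideal and sheaf is thereby replaced by
  a condition on values.\<close>

lemma ideal_syz_sheaf_iff:
  assumes f: "hpoly d f" and W: "zariski_open W" and \<sigma>: "\<sigma> \<in> syz_sheaf f W"
  shows "\<sigma> \<in> ideal_syz_sheaf f (dual_line p) W \<longleftrightarrow> (\<forall>v\<in>cone (W \<inter> dual_line p). \<sigma> v = 0)"
proof
  assume I: "\<sigma> \<in> ideal_syz_sheaf f (dual_line p) W"
  show "\<forall>v\<in>cone (W \<inter> dual_line p). \<sigma> v = 0"
  proof
    fix v assume v: "v \<in> cone (W \<inter> dual_line p)"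
    then have "abs_proj2 v \<in> W" "v \<noteq> 0" by (auto simp: in_cone_iff)
    then obtain V n g e where V: "abs_proj2 v \<in> V" "\<forall>k<n. g k \<in> ideal_sheaf (dual_line p) V"
      "\<forall>v\<in>cone V. \<sigma> v = (\<Sum>k<(n::nat). g k v *s e k v)"
      using I unfolding ideal_syz_sheaf_def by blast
    have "v \<in> cone V" using V(1) \<open>v \<noteq> 0\<close> by (simp add: in_cone_iff)
    moreover from this have "v \<in> cone (V \<inter> dual_line p)" using v by (simp add: cone_Int)
    ultimately have "\<sigma> v = (\<Sum>k<n. g k v *s e k v)" "\<forall>k<n. g k v = 0"
      using V by (auto simp: ideal_sheaf_def)
    then show "\<sigma> v = 0" by simp
  qed
next
  assume van: "\<forall>v\<in>cone (W \<inter> dual_line p). \<sigma> v = 0"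
  have "\<exists>V (n::nat) g e. zariski_open V \<and> x \<in> V \<and> V \<subseteq> W \<and>
       (\<forall>k<n. g k \<in> ideal_sheaf (dual_line p) V \<and> e k \<in> syz_sheaf f V) \<and>
       (\<forall>v\<in>cone V. \<sigma> v = (\<Sum>k<n. g k v *s e k v))" if x: "x \<in> W" for x
  proof (cases "x \<in> dual_line p")
    case False
    \<comment> \<open>Away from the line the ideal is the unit ideal, and the product
      \<open>1 * \<sigma>\<close> has the required form.\<close>
    define V where "V = W \<inter> basic_open (dual_form p)"
    have V: "zariski_open V" "x \<in> V" "V \<subseteq> W"
      using False x W zariski_open_basic[OF dual_form_hpoly]
      by (auto simp: V_def zariski_open_Int basic_open_def dual_line_def)
    have emp: "cone (V \<inter> dual_line p) = {}"
      by (auto simp: V_def cone_Int cone_basic_open[OF dual_form_hpoly] cone_dual_line)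
    have "(\<lambda>v. if v \<in> cone V then 1 else 0) \<in> ideal_sheaf (dual_line p) V"
      using twist_const[OF V(1), of 1] emp by (auto simp: ideal_sheaf_def)
    then show ?thesis
      using V syz_sheaf_restr[OF \<sigma> V(1,3)]
      by (intro exI[of _ V] exI[of _ 1] exI[of _ "\<lambda>_ v. if v \<in> cone V then 1 else 0"]
          exI[of _ "\<lambda>_. restr V \<sigma>"]) (auto simp: restr_def)
  next
    case True
    have "\<exists>V g h k. zariski_open V \<and> x \<in> V \<and> V \<subseteq> W \<and> hpoly k g \<and> hpoly k h \<and>
       (\<forall>v\<in>cone V. h v \<noteq> 0 \<and> \<sigma> v $ i = g v / h v)" for i
    proof -
      have "rep_proj2 x \<in> cone (W \<inter> UNIV)" using x by simp
      from twist_local[OF syz_sheafD(1)[OF \<sigma>] this, of i] obtain V g h k l where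
        "zariski_open V" "rep_proj2 x \<in> cone V" "V \<subseteq> W" "hpoly k g" "hpoly l h" "int k - int l = 0"
        "\<And>v. v \<in> cone (V \<inter> UNIV) \<Longrightarrow> h v \<noteq> 0" "\<And>v. v \<in> cone (V \<inter> UNIV) \<Longrightarrow> \<sigma> v $ i = g v / h v" by metis
      then show ?thesis by (intro exI[of _ V] exI[of _ g] exI[of _ h] exI[of _ k]) auto
    qed
    then obtain V0 g h k where V0: "\<And>i. zariski_open (V0 i)" "\<And>i. x \<in> V0 i" "\<And>i. V0 i \<subseteq> W"
      "\<And>i. hpoly (k i) (g i)" "\<And>i. hpoly (k i) (h i)"
      "\<And>i v. v \<in> cone (V0 i) \<Longrightarrow> h i v \<noteq> 0 \<and> \<sigma> v $ i = g i v / h i v" by metis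
    have V123: "zariski_open (V0 1 \<inter> V0 2 \<inter> V0 3)" "x \<in> V0 1 \<inter> V0 2 \<inter> V0 3"
      using V0 by (auto intro!: zariski_open_Int)
    obtain r m j where m: "hpoly (Suc r) m" "m (rep_proj2 x) \<noteq> 0" "basic_open m \<subseteq> V0 1 \<inter> V0 2 \<inter> V0 3"
      "\<And>v. m v \<noteq> 0 \<Longrightarrow> v $ j \<noteq> 0" by (rule common_basic_open[OF V123]) blast
    define V where "V = basic_open m"
    have V: "zariski_open V" "x \<in> V" using zariski_open_basic[OF m(1)] m(2) by (auto simp: V_def basic_open_def)
    have Vi: "V \<subseteq> V0 i" for i using m(3) exhaust_3[of i] by (auto simp: V_def)
    have VW: "V \<subseteq> W" using Vi V0(3) by blast
    have cV: "v \<in> cone V \<longleftrightarrow> v \<noteq> 0 \<and> m v \<noteq> 0" for v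
      unfolding V_def by (rule cone_basic_open[OF m(1)])
    have h0: "h i v \<noteq> 0" and \<sigma>i: "\<sigma> v $ i = g i v / h i v" if "v \<in> cone V" for i v
      using V0(6)[of v i] that cone_mono[OF Vi[of i]] by auto
    \<comment> \<open>The numerator \<open>g i\<close> is known to vanish only at points of the line
      inside \<open>V\<close>. The factor \<open>m\<close> kills the rest of the line, so the linear
      form divides \<open>m * g i\<close> as a polynomial.\<close>
    have "\<exists>G. hpoly (r + k i) G \<and> (\<forall>v. m v * g i v = dual_form p v * G v)" for i
    proof -
      have "\<exists>G. hpoly (Suc r + k i - 1) G \<and> (\<forall>v. m v * g i v = (\<Sum>i\<in>UNIV. rep_proj2 p $ i * v $ i) * G v) \<and> 
          (Suc r + k i = 0 \<longrightarrow> (\<lambda>v. m v * g i v) = (\<lambda>_. 0))"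
      proof (rule hpoly_divide_linear[OF hpoly_mult[OF m(1) V0(4)] rep_proj2_nonzero])
        fix v :: "complex^3" assume "(\<Sum>i\<in>UNIV. rep_proj2 p $ i * v $ i) = 0"
        then have l: "dual_form p v = 0" by (simp add: dual_form_def)
        show "m v * g i v = 0"
        proof (cases "v \<in> cone V")
          case True
          then have "v \<in> cone (W \<inter> dual_line p)"
            using l cone_mono[OF VW] cone_nonzero by (auto simp: cone_Int cone_dual_line)
          then show ?thesis using van \<sigma>i[OF True, of i] h0[OF True, of i] by simp
        next
          case False
          then show ?thesis using cV hpoly_zero_eq_0[OF m(1)] by (cases "v = 0") auto
        qed
      qed
      then show ?thesis by (auto simp: dual_form_def)
    qed
    then obtain G where G: "\<And>i. hpoly (r + k i) (G i)" "\<And>i v. m v * g i v = dual_form p v * G i v" by metis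
    \<comment> \<open>The factorisation has to consist of sections of degree 0: the linear form is
      divided by the coordinate \<open>j\<close>, and \<open>e\<close> is multiplied by it.\<close>
    define e :: "complex^3 \<Rightarrow> complex^3"
      where "e v = (if v \<in> cone V then \<chi> i. (v $ j * G i v) / (m v * h i v) else 0)" for v
    define c where "c v = (if v \<in> cone V then dual_form p v / v $ j else 0)" for v
    have c: "c \<in> ideal_sheaf (dual_line p) V"
    proof -
      have "c \<in> twist UNIV 0 V"
        by (rule twist_quotient[OF V(1) dual_form_hpoly[of p] hpoly_coord[of j]])
          (auto simp: c_def cV m(4))
      then show ?thesis by (auto simp: ideal_sheaf_def c_def cone_Int cone_dual_line)
    qed
    have \<sigma>ce: "\<sigma> v = c v *s e v" if v: "v \<in> cone V" for v
    proof -
      have "\<sigma> v $ i = c v * e v $ i" for i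
      proof -
        have "g i v = dual_form p v * G i v / m v" using G(2)[of v i] v cV by (simp add: field_simps)
        then show ?thesis using v \<sigma>i[OF v, of i] h0[OF v, of i] cV[of v] m(4)[of v]
          by (simp add: c_def e_def)
      qed
      then show ?thesis by (simp add: vec_eq_iff)
    qed
    have e_twist: "(\<lambda>v. e v $ i) \<in> twist UNIV 0 V" for i
    proof (rule twist_quotient[OF V(1)])
      show "hpoly (Suc (r + k i)) (\<lambda>v. v $ j * G i v)" by (rule hpoly.coord[OF G(1)])
      show "hpoly (Suc r + k i) (\<lambda>v. m v * h i v)" by (rule hpoly_mult[OF m(1) V0(5)])
    qed (use cV h0 in \<open>auto simp: e_def\<close>)
    \<comment> \<open>The pairing of \<open>e\<close> with the gradient becomes zero after
      multiplication by the linear form. Hence it is zero off the line, and everywhere on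
      \<open>V\<close> by density.\<close>
    define \<psi> where "\<psi> v = (\<Sum>i\<in>UNIV. e v $ i * pderiv3 i f v)" for v
    have "\<psi> v = 0" if v: "v \<in> cone V" for v
    proof (rule dual_form_vanish_off[OF open_cone[OF V(1)] _ v, where p = p])
      have "continuous_on (cone V) (\<lambda>v. e v $ i * pderiv3 i f v)" for i
        using twist_continuous[OF e_twist V(1), of i] pderiv3_hpoly[OF f] hpoly_continuous
        by (intro continuous_on_mult) blast+
      then show "continuous_on (cone V) \<psi>" unfolding \<psi>_def
        by (intro continuous_on_sum)
    next
      fix v assume v: "v \<in> cone V" "dual_form p v \<noteq> 0"
      have "0 = (\<Sum>i\<in>UNIV. \<sigma> v $ i * pderiv3 i f v)" using syz_sheafD(2)[OF \<sigma>] by simp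
      also have "\<dots> = c v * \<psi> v" unfolding \<sigma>ce[OF v(1)] \<psi>_def
        by (simp add: sum_distrib_left mult.assoc)
      finally show "\<psi> v = 0" using v cV m(4) by (auto simp: c_def)
    qed
    then have "(\<Sum>i\<in>UNIV. e v $ i * pderiv3 i f v) = 0" for v
      by (cases "v \<in> cone V") (auto simp: \<psi>_def e_def)
    then have "e \<in> syz_sheaf f V" using e_twist by (simp add: syz_sheaf_def)
    then show ?thesis using V VW c \<sigma>ce
      by (intro exI[of _ V] exI[of _ 1] exI[of _ "\<lambda>_. c"] exI[of _ "\<lambda>_. e"]) auto
  qed
  then show "\<sigma> \<in> ideal_syz_sheaf f (dual_line p) W"
    using \<sigma> by (simp add: ideal_syz_sheaf_def)
qed

text \<open>\<open>e\<close> represents the degree \<open>k\<close> section \<open>s\<close> on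
  \<open>V\<close>, dehomogenised by the coordinate \<open>j\<close>. Equality is required on the
  line only, because \<open>e\<close> may live on the plane while \<open>s\<close> lives on the
  line.\<close>

definition chart ::
  "proj2 set \<Rightarrow> int \<Rightarrow> (complex^3 \<Rightarrow> complex^'n) \<Rightarrow> proj2 set \<Rightarrow> (complex^3 \<Rightarrow> complex^'n) \<Rightarrow> 3 \<Rightarrow> bool" where
  "chart L k s V e j \<longleftrightarrow> zariski_open V \<and> (\<forall>v\<in>cone V. v $ j \<noteq> 0) \<and>
     (\<forall>v\<in>cone (V \<inter> L). s v = (v $ j powi k) *s e v)"

lemma chart_twist:
  assumes "\<And>v. v \<notin> cone L \<Longrightarrow> s v = 0"
    and "\<And>v. v \<in> cone L \<Longrightarrow> \<exists>V e j. v \<in> cone V \<and> chart L k s V e j \<and> (\<lambda>v. e v $ i) \<in> twist L m V"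
  shows "(\<lambda>v. s v $ i) \<in> twist L (m + k) UNIV"
proof (rule twistI)
  fix v assume "v \<in> cone (UNIV \<inter> L)"
  then obtain V e j where V: "v \<in> cone V" "chart L k s V e j" "(\<lambda>v. e v $ i) \<in> twist L m V"
    using assms(2)[of v] by auto
  have "(\<lambda>v. if v \<in> cone V then v $ j powi k else 0) \<in> twist UNIV k V"
    using V(2) by (intro coord_power_int_twist) (auto simp: chart_def)
  from twist_mult[OF V(3) this] have "(\<lambda>v. e v $ i * (if v \<in> cone V then v $ j powi k else 0)) \<in> twist L (m + k) V"
    by simp
  moreover have "\<forall>v\<in>cone (V \<inter> L). s v $ i = e v $ i * (if v \<in> cone V then v $ j powi k else 0)"
    using V(2) by (auto simp: chart_def cone_Int)
  ultimately show "\<exists>V t. zariski_open V \<and> v \<in> cone V \<and> V \<subseteq> UNIV \<and> t \<in> twist L (m + k) V \<and>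
      (\<forall>v\<in>cone (V \<inter> L). s v $ i = t v)"
    using V(1,2) unfolding chart_def by blast
qed (use assms(1) in auto)

text \<open>Agreement of the charts is demanded over the line alone, which is all that local lifts
  to the plane can offer.\<close>

lemma chart_glue:
  fixes C :: "(proj2 set \<times> (complex^3 \<Rightarrow> complex^'n) \<times> 3) set"
  assumes dom: "\<And>V e j. (V, e, j) \<in> C \<Longrightarrow> zariski_open V \<and> (\<forall>v\<in>cone V. v $ j \<noteq> 0)"
    and cover: "\<And>v. v \<in> cone L \<Longrightarrow> \<exists>V e j. (V, e, j) \<in> C \<and> v \<in> cone V"
    and compat: "\<And>V e j V' e' j' v. (V, e, j) \<in> C \<Longrightarrow> (V', e', j') \<in> C \<Longrightarrow> v \<in> cone (V \<inter> V' \<inter> L) \<Longrightarrow>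
       (v $ j powi k) *s e v = (v $ j' powi k) *s e' v"
  shows "\<exists>s. (\<forall>v. v \<notin> cone L \<longrightarrow> s v = 0) \<and> (\<forall>V e j. (V, e, j) \<in> C \<longrightarrow> chart L k s V e j)"
proof -
  have "\<exists>x. (v \<notin> cone L \<longrightarrow> x = 0) \<and>
     (\<forall>V e j. (V, e, j) \<in> C \<and> v \<in> cone (V \<inter> L) \<longrightarrow> x = (v $ j powi k) *s e v)" for v
  proof (cases "v \<in> cone L")
    case True
    then obtain V e j where V: "(V, e, j) \<in> C" "v \<in> cone V" using cover by blast
    show ?thesis
    proof (intro exI[of _ "(v $ j powi k) *s e v"] conjI allI impI)
      fix V' e' j' assume "(V', e', j') \<in> C \<and> v \<in> cone (V' \<inter> L)"
      then show "(v $ j powi k) *s e v = (v $ j' powi k) *s e' v"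
        using V True by (intro compat[of V e j V' e' j']) (auto simp: cone_Int)
    qed (use True in simp)
  qed (rule exI[of _ 0], simp add: cone_Int)
  then have "\<forall>v. \<exists>x. (v \<notin> cone L \<longrightarrow> x = 0) \<and>
     (\<forall>V e j. (V, e, j) \<in> C \<and> v \<in> cone (V \<inter> L) \<longrightarrow> x = (v $ j powi k) *s e v)" ..
  from choice[OF this] obtain s where s: "\<forall>v. (v \<notin> cone L \<longrightarrow> s v = 0) \<and>
     (\<forall>V e j. (V, e, j) \<in> C \<and> v \<in> cone (V \<inter> L) \<longrightarrow> s v = (v $ j powi k) *s e v)" ..
  have "chart L k s V e j" if "(V, e, j) \<in> C" for V e j
    using s that dom[OF that] unfolding chart_def by simp
  then show ?thesis using s by blast
qed

text \<open>\<open>good\<close> makes the gradient map O^3 -> O(d-1) surjective near the line, so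
  that syzygies given only along the line lift locally to E. The alternative of an identically zero
  gradient covers the empty arrangement. The assumptions on \<open>\<Phi>\<close> are the clauses of
  \<open>restriction_splits\<close>.\<close>

locale line_splitting =
  fixes f :: "complex^3 \<Rightarrow> complex" and d :: nat and p :: proj2 and a b :: int
    and \<Phi> :: "proj2 set \<Rightarrow> (complex^3 \<Rightarrow> complex^3) \<Rightarrow> (complex^3 \<Rightarrow> complex^2)"
  assumes f: "hpoly d f"
    and good: "\<And>v. v \<in> cone (dual_line p) \<Longrightarrow> (\<exists>i. pderiv3 i f v \<noteq> 0) \<or> (\<forall>i. pderiv3 i f = (\<lambda>_. 0))"
    and split: "\<And>U \<rho>. zariski_open U \<Longrightarrow> \<rho> \<in> syz_sheaf f U \<Longrightarrow> \<Phi> U \<rho> \<in> split_sheaf (dual_line p) a b U"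
    and \<Phi>_add: "\<And>U \<rho> \<sigma>. zariski_open U \<Longrightarrow> \<rho> \<in> syz_sheaf f U \<Longrightarrow> \<sigma> \<in> syz_sheaf f U \<Longrightarrow>
       \<Phi> U (\<lambda>v. \<rho> v + \<sigma> v) = (\<lambda>v. \<Phi> U \<rho> v + \<Phi> U \<sigma> v)"
    and \<Phi>_scale: "\<And>U g \<rho>. zariski_open U \<Longrightarrow> g \<in> twist UNIV 0 U \<Longrightarrow> \<rho> \<in> syz_sheaf f U \<Longrightarrow>
       \<Phi> U (\<lambda>v. g v *s \<rho> v) = (\<lambda>v. g v *s \<Phi> U \<rho> v)"
    and \<Phi>_restr: "\<And>U V \<rho>. zariski_open U \<Longrightarrow> zariski_open V \<Longrightarrow> V \<subseteq> U \<Longrightarrow> \<rho> \<in> syz_sheaf f U \<Longrightarrow>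
       \<Phi> V (restr V \<rho>) = restr V (\<Phi> U \<rho>)"
    and \<Phi>_kernel: "\<And>U \<rho>. zariski_open U \<Longrightarrow> \<rho> \<in> syz_sheaf f U \<Longrightarrow>
       \<Phi> U \<rho> = (\<lambda>v. 0) \<longleftrightarrow> \<rho> \<in> ideal_syz_sheaf f (dual_line p) U"
    and \<Phi>_surj: "\<And>U s x. zariski_open U \<Longrightarrow> s \<in> split_sheaf (dual_line p) a b U \<Longrightarrow> x \<in> U \<Longrightarrow>
       \<exists>V \<rho>. zariski_open V \<and> x \<in> V \<and> V \<subseteq> U \<and> \<rho> \<in> syz_sheaf f V \<and> \<Phi> V \<rho> = restr V s"
begin

section \<open>The splitting isomorphism in every degree\<close>

abbreviation L where "L \<equiv> dual_line p"

definition ab :: "2 \<Rightarrow> int" where "ab i = (if i = 1 then a else b)"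

lemma split_sheaf_iff: "s \<in> split_sheaf L a b U \<longleftrightarrow> (\<forall>i. (\<lambda>v. s v $ i) \<in> twist L (- ab i) U)"
  by (auto simp: split_sheaf_def ab_def forall_2)

lemma \<Phi>_twist:
  "zariski_open U \<Longrightarrow> \<rho> \<in> syz_sheaf f U \<Longrightarrow> (\<lambda>v. \<Phi> U \<rho> v $ i) \<in> twist L (- ab i) U"
  using split split_sheaf_iff by blast

lemma \<Phi>_eq_0: "zariski_open U \<Longrightarrow> \<rho> \<in> syz_sheaf f U \<Longrightarrow> v \<notin> cone (U \<inter> L) \<Longrightarrow> \<Phi> U \<rho> v = 0"
  using twist_eq_0[OF \<Phi>_twist] by (simp add: vec_eq_iff)

lemma \<Phi>_eq_0_iff:
  assumes "zariski_open U" "\<rho> \<in> syz_sheaf f U"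
  shows "(\<forall>v\<in>cone (U \<inter> L). \<Phi> U \<rho> v = 0) \<longleftrightarrow> (\<forall>v\<in>cone (U \<inter> L). \<rho> v = 0)"
proof -
  have "(\<forall>v\<in>cone (U \<inter> L). \<Phi> U \<rho> v = 0) \<longleftrightarrow> \<Phi> U \<rho> = (\<lambda>v. 0)"
    using \<Phi>_eq_0[OF assms] by (auto simp: fun_eq_iff)
  then show ?thesis
    using \<Phi>_kernel[OF assms] ideal_syz_sheaf_iff[OF f assms] by simp
qed

text \<open>On the overlap both sides express the vanishing along the line of one degree 0 section:
  \<open>\<sigma> = c * e - e'\<close>, with \<open>c\<close> the quotient of the two coordinate
  powers, and its image \<open>\<Phi> W \<sigma>\<close>. Injectivity of \<open>\<Phi>\<close>
  modulo the line makes the two conditions equivalent. Every gluing argument below uses this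
  equivalence.\<close>

lemma compatible_iff:
  assumes V: "zariski_open V" "\<And>v. v \<in> cone V \<Longrightarrow> v $ j \<noteq> 0" "e \<in> syz_sheaf f V"
    and V': "zariski_open V'" "\<And>v. v \<in> cone V' \<Longrightarrow> v $ j' \<noteq> 0" "e' \<in> syz_sheaf f V'"
  shows "(\<forall>v\<in>cone (V \<inter> V' \<inter> L). (v $ j powi k) *s e v = (v $ j' powi k) *s e' v) \<longleftrightarrow>
    (\<forall>v\<in>cone (V \<inter> V' \<inter> L). (v $ j powi k) *s \<Phi> V e v = (v $ j' powi k) *s \<Phi> V' e' v)"
proof -
  define W where "W = V \<inter> V'"
  have W: "zariski_open W" "W \<subseteq> V" "W \<subseteq> V'" using V(1) V'(1) by (auto simp: W_def zariski_open_Int)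
  have nz: "v $ j \<noteq> 0" "v $ j' \<noteq> 0" if "v \<in> cone W" for v
    using V(2) V'(2) that by (auto simp: W_def cone_Int)
  define c where "c v = (if v \<in> cone W then v $ j powi k else 0) * (if v \<in> cone W then v $ j' powi (-k) else 0)" for v :: "complex^3"
  have c: "c \<in> twist UNIV 0 W"
    using twist_mult[OF coord_power_int_twist[OF W(1) nz(1), of k] coord_power_int_twist[OF W(1) nz(2), of "-k"]]
    by (simp add: c_def [abs_def])
  define m :: "complex^3 \<Rightarrow> complex" where "m v = (if v \<in> cone W then -1 else 0)" for v
  have m: "m \<in> twist UNIV 0 W" using twist_const[OF W(1)] by (simp add: m_def [abs_def])
  note e = syz_sheaf_restr[OF V(3) W(1,2)] and e' = syz_sheaf_restr[OF V'(3) W(1,3)]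
  define \<sigma> where "\<sigma> v = c v *s restr W e v + m v *s restr W e' v" for v
  have \<sigma>: "\<sigma> \<in> syz_sheaf f W"
    unfolding \<sigma>_def [abs_def] by (intro syz_sheaf_add syz_sheaf_scale c m e e')
  have "\<Phi> W \<sigma> = (\<lambda>v. \<Phi> W (\<lambda>v. c v *s restr W e v) v + \<Phi> W (\<lambda>v. m v *s restr W e' v) v)"
    unfolding \<sigma>_def [abs_def] by (intro \<Phi>_add W syz_sheaf_scale c m e e')
  also have "\<dots> = (\<lambda>v. c v *s restr W (\<Phi> V e) v + m v *s restr W (\<Phi> V' e') v)"
    by (simp only: \<Phi>_scale[OF W(1) c e] \<Phi>_scale[OF W(1) m e']
      \<Phi>_restr[OF V(1) W(1,2) V(3)] \<Phi>_restr[OF V'(1) W(1,3) V'(3)])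
  finally have \<Phi>\<sigma>: "\<Phi> W \<sigma> v = c v *s \<Phi> V e v - \<Phi> V' e' v" if "v \<in> cone (W \<inter> L)" for v
    using that by (simp add: restr_def m_def cone_Int)
  have \<sigma>v: "\<sigma> v = c v *s e v - e' v" if "v \<in> cone (W \<inter> L)" for v
    using that by (simp add: \<sigma>_def restr_def m_def cone_Int)
  have eq: "(v $ j powi k) *s x = (v $ j' powi k) *s y \<longleftrightarrow> c v *s x - y = 0"
    if "v \<in> cone (W \<inter> L)" for v and x y :: "complex^'m"
  proof -
    have v: "v \<in> cone W" using that by (simp add: cone_Int)
    have "c v = (v $ j powi k) / (v $ j' powi k)"
      using v by (simp add: c_def power_int_minus divide_inverse)
    moreover have nz': "v $ j' powi k \<noteq> 0" using nz[OF v] by simp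
    ultimately have "(v $ j powi k) * x $ i - (v $ j' powi k) * y $ i = (v $ j' powi k) * (c v * x $ i - y $ i)" for i
      by (simp add: field_simps)
    then have "(v $ j powi k) * x $ i = (v $ j' powi k) * y $ i \<longleftrightarrow> c v * x $ i - y $ i = 0" for i
      using nz' by (metis eq_iff_diff_eq_0 mult_eq_0_iff)
    then show ?thesis by (simp add: vec_eq_iff)
  qed
  have "(v $ j powi k) *s e v = (v $ j' powi k) *s e' v \<longleftrightarrow> \<sigma> v = 0"
    "(v $ j powi k) *s \<Phi> V e v = (v $ j' powi k) *s \<Phi> V' e' v \<longleftrightarrow> \<Phi> W \<sigma> v = 0"
    if "v \<in> cone (W \<inter> L)" for v
    using eq[OF that, of "e v" "e' v"] eq[OF that, of "\<Phi> V e v" "\<Phi> V' e' v"]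
    unfolding \<sigma>v[OF that] \<Phi>\<sigma>[OF that] by blast+
  then show ?thesis using \<Phi>_eq_0_iff[OF W(1) \<sigma>] unfolding W_def by blast
qed

text \<open>The graph of the isomorphism between E|_L(k) and O_L(k - a) + O_L(k - b) on global
  sections. \<open>\<Phi>\<close> itself is available only on degree 0 sections over open sets of
  the plane, so the twisted map is introduced as a relation whose totality and uniqueness are proved
  on both sides.\<close>

definition corresponds :: "int \<Rightarrow> (complex^3 \<Rightarrow> complex^3) \<Rightarrow> (complex^3 \<Rightarrow> complex^2) \<Rightarrow> bool" where
  "corresponds k \<rho> s \<longleftrightarrow> (\<forall>v. v \<notin> cone L \<longrightarrow> \<rho> v = 0 \<and> s v = 0) \<and>
     (\<forall>v\<in>cone L. \<exists>V e j. v \<in> cone V \<and> e \<in> syz_sheaf f V \<and> chart L k \<rho> V e j \<and> chart L k s V (\<Phi> V e) j)"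

lemma corresponds_chart:
  assumes "corresponds k \<rho> s" "v \<in> cone L"
  obtains V e j where "zariski_open V" "v \<in> cone V" "\<And>v. v \<in> cone V \<Longrightarrow> v $ j \<noteq> 0" "e \<in> syz_sheaf f V"
    "\<And>v. v \<in> cone (V \<inter> L) \<Longrightarrow> \<rho> v = (v $ j powi k) *s e v" 
    "\<And>v. v \<in> cone (V \<inter> L) \<Longrightarrow> s v = (v $ j powi k) *s \<Phi> V e v"
proof -
  have "\<exists>V e j. v \<in> cone V \<and> e \<in> syz_sheaf f V \<and> chart L k \<rho> V e j \<and> chart L k s V (\<Phi> V e) j"
    using bspec[OF conjunct2[OF assms(1)[unfolded corresponds_def]] assms(2)] .
  then obtain V e j where 1: "v \<in> cone V" "e \<in> syz_sheaf f V" "chart L k \<rho> V e j" "chart L k s V (\<Phi> V e) j"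
    by (elim exE conjE)
  show ?thesis by (rule that[of V j e]) (use 1 in \<open>simp_all add: chart_def\<close>)
qed

lemma corresponds_twist:
  assumes "corresponds k \<rho> s"
  shows "(\<lambda>v. \<rho> v $ i) \<in> twist L k UNIV" "(\<lambda>v. s v $ l) \<in> twist L (k - ab l) UNIV"
    "(\<Sum>i\<in>UNIV. \<rho> v $ i * pderiv3 i f v) = 0"
proof -
  have "(\<lambda>v. \<rho> v $ i) \<in> twist L (0 + k) UNIV"
  proof (rule chart_twist)
    fix v assume v: "v \<in> cone L"
    from bspec[OF conjunct2[OF assms[unfolded corresponds_def]] v]
    obtain V e j where V: "v \<in> cone V" "e \<in> syz_sheaf f V" "chart L k \<rho> V e j"
      by (elim exE conjE)
    have "chart L k \<rho> V (\<lambda>v. if v \<in> cone L then e v else 0) j"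
      using V(3) by (simp add: chart_def cone_Int)
    moreover have "(\<lambda>v. (if v \<in> cone L then e v else 0) $ i) = (\<lambda>v. if v \<in> cone L then e v $ i else 0)"
      by auto
    ultimately show "\<exists>V e j. v \<in> cone V \<and> chart L k \<rho> V e j \<and> (\<lambda>v. e v $ i) \<in> twist L 0 V"
      using V(1) twist_restrict_support[OF syz_sheafD(1)[OF V(2)], of L i]
      by (intro exI[of _ V] exI[of _ "\<lambda>v. if v \<in> cone L then e v else 0"] exI[of _ j]) simp
  qed (use assms in \<open>auto simp: corresponds_def\<close>)
  then show "(\<lambda>v. \<rho> v $ i) \<in> twist L k UNIV" by simp
  have "(\<lambda>v. s v $ l) \<in> twist L (- ab l + k) UNIV"
  proof (rule chart_twist)
    fix v assume v: "v \<in> cone L"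
    from bspec[OF conjunct2[OF assms[unfolded corresponds_def]] v]
    obtain V e j where V: "v \<in> cone V" "e \<in> syz_sheaf f V" "chart L k s V (\<Phi> V e) j"
      by (elim exE conjE)
    moreover have "zariski_open V" using V(3) by (simp add: chart_def)
    ultimately show "\<exists>V e j. v \<in> cone V \<and> chart L k s V e j \<and> (\<lambda>v. e v $ l) \<in> twist L (- ab l) V"
      using \<Phi>_twist by (intro exI[of _ V] exI[of _ "\<Phi> V e"] exI[of _ j]) simp
  qed (use assms in \<open>auto simp: corresponds_def\<close>)
  then show "(\<lambda>v. s v $ l) \<in> twist L (k - ab l) UNIV" by simp
  show "(\<Sum>i\<in>UNIV. \<rho> v $ i * pderiv3 i f v) = 0"
  proof (cases "v \<in> cone L")
    case True
    from corresponds_chart[OF assms this] obtain V e j where V: "v \<in> cone V" "e \<in> syz_sheaf f V"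
      "\<And>v. v \<in> cone (V \<inter> L) \<Longrightarrow> \<rho> v = (v $ j powi k) *s e v" by metis
    have "\<rho> v = (v $ j powi k) *s e v" using V True by (simp add: cone_Int)
    then show ?thesis
      using syz_sheafD(2)[OF V(2), of v] by (simp add: mult.assoc sum_distrib_left[symmetric])
  next
    case False
    then show ?thesis using assms by (simp add: corresponds_def)
  qed
qed

text \<open>Charts of the two pairs around a common point are compared on their overlap, where
  equality of the syzygies and equality of the images are equivalent by
  \<open>compatible_iff\<close>.\<close>

lemma corresponds_unique:
  assumes "corresponds k \<rho> s" "corresponds k \<rho>' s'"
  shows "\<rho> = \<rho>' \<longleftrightarrow> s = s'"
proof -
  have iff: "(\<forall>v\<in>cone (V \<inter> V' \<inter> L). \<rho> v = \<rho>' v) \<longleftrightarrow> (\<forall>v\<in>cone (V \<inter> V' \<inter> L). s v = s' v)"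
    if V: "zariski_open V" "\<And>v. v \<in> cone V \<Longrightarrow> v $ j \<noteq> 0" "e \<in> syz_sheaf f V"
    "\<And>v. v \<in> cone (V \<inter> L) \<Longrightarrow> \<rho> v = (v $ j powi k) *s e v" 
    "\<And>v. v \<in> cone (V \<inter> L) \<Longrightarrow> s v = (v $ j powi k) *s \<Phi> V e v" 
    and V': "zariski_open V'" "\<And>v. v \<in> cone V' \<Longrightarrow> v $ j' \<noteq> 0" "e' \<in> syz_sheaf f V'"
    "\<And>v. v \<in> cone (V' \<inter> L) \<Longrightarrow> \<rho>' v = (v $ j' powi k) *s e' v" 
    "\<And>v. v \<in> cone (V' \<inter> L) \<Longrightarrow> s' v = (v $ j' powi k) *s \<Phi> V' e' v" for V V' e e' j j'
    using compatible_iff[OF V(1-3) V'(1-3), of k] V(4,5) V'(4,5) by (simp add: cone_Int)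
  have off: "\<rho> v = 0" "s v = 0" "\<rho>' v = 0" "s' v = 0" if "v \<notin> cone L" for v
    using assms that by (auto simp: corresponds_def)
  show ?thesis
  proof
    assume eq: "\<rho> = \<rho>'"
    show "s = s'"
    proof
      fix v show "s v = s' v"
      proof (cases "v \<in> cone L")
        case True
        from corresponds_chart[OF assms(1) this] obtain V e j where V: "zariski_open V" "v \<in> cone V" 
          "\<And>v. v \<in> cone V \<Longrightarrow> v $ j \<noteq> 0" "e \<in> syz_sheaf f V"
          "\<And>v. v \<in> cone (V \<inter> L) \<Longrightarrow> \<rho> v = (v $ j powi k) *s e v" 
          "\<And>v. v \<in> cone (V \<inter> L) \<Longrightarrow> s v = (v $ j powi k) *s \<Phi> V e v" by metis
        from corresponds_chart[OF assms(2) True] obtain V' e' j' where V': "zariski_open V'" "v \<in> cone V'" 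
          "\<And>v. v \<in> cone V' \<Longrightarrow> v $ j' \<noteq> 0" "e' \<in> syz_sheaf f V'"
          "\<And>v. v \<in> cone (V' \<inter> L) \<Longrightarrow> \<rho>' v = (v $ j' powi k) *s e' v" 
          "\<And>v. v \<in> cone (V' \<inter> L) \<Longrightarrow> s' v = (v $ j' powi k) *s \<Phi> V' e' v" by metis
        have "\<forall>v\<in>cone (V \<inter> V' \<inter> L). s v = s' v"
          using iff[OF V(1,3,4,5,6) V'(1,3,4,5,6)] eq by simp
        then show ?thesis using True V(2) V'(2) by (simp add: cone_Int)
      qed (simp add: off)
    qed
  next
    assume eq: "s = s'"
    show "\<rho> = \<rho>'"
    proof
      fix v show "\<rho> v = \<rho>' v"
      proof (cases "v \<in> cone L")
        case True
        from corresponds_chart[OF assms(1) this] obtain V e j where V: "zariski_open V" "v \<in> cone V" 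
          "\<And>v. v \<in> cone V \<Longrightarrow> v $ j \<noteq> 0" "e \<in> syz_sheaf f V"
          "\<And>v. v \<in> cone (V \<inter> L) \<Longrightarrow> \<rho> v = (v $ j powi k) *s e v" 
          "\<And>v. v \<in> cone (V \<inter> L) \<Longrightarrow> s v = (v $ j powi k) *s \<Phi> V e v" by metis
        from corresponds_chart[OF assms(2) True] obtain V' e' j' where V': "zariski_open V'" "v \<in> cone V'" 
          "\<And>v. v \<in> cone V' \<Longrightarrow> v $ j' \<noteq> 0" "e' \<in> syz_sheaf f V'"
          "\<And>v. v \<in> cone (V' \<inter> L) \<Longrightarrow> \<rho>' v = (v $ j' powi k) *s e' v" 
          "\<And>v. v \<in> cone (V' \<inter> L) \<Longrightarrow> s' v = (v $ j' powi k) *s \<Phi> V' e' v" by metis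
        have "\<forall>v\<in>cone (V \<inter> V' \<inter> L). \<rho> v = \<rho>' v"
          using iff[OF V(1,3,4,5,6) V'(1,3,4,5,6)] eq by simp
        then show ?thesis using True V(2) V'(2) by (simp add: cone_Int)
      qed (simp add: off)
    qed
  qed
qed

lemma corresponds_eq_0:
  assumes "corresponds k \<rho> s"
  shows "\<rho> = (\<lambda>_. 0) \<longleftrightarrow> s = (\<lambda>_. 0)"
proof -
  have "\<rho> v = 0 \<longleftrightarrow> s v = 0" if "(\<forall>v. \<rho> v = 0) \<or> (\<forall>v. s v = 0)" for v
  proof (cases "v \<in> cone L")
    case True
    from corresponds_chart[OF assms this] obtain V e j where V: "zariski_open V" "v \<in> cone V" 
      "\<And>v. v \<in> cone V \<Longrightarrow> v $ j \<noteq> 0" "e \<in> syz_sheaf f V"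
      "\<And>v. v \<in> cone (V \<inter> L) \<Longrightarrow> \<rho> v = (v $ j powi k) *s e v" 
      "\<And>v. v \<in> cone (V \<inter> L) \<Longrightarrow> s v = (v $ j powi k) *s \<Phi> V e v" by metis
    have nz: "v $ j powi k \<noteq> 0" if "v \<in> cone V" for v using V(3)[OF that] by simp
    have "\<rho> v = 0 \<longleftrightarrow> e v = 0" "s v = 0 \<longleftrightarrow> \<Phi> V e v = 0" if "v \<in> cone (V \<inter> L)" for v
      unfolding V(5)[OF that] V(6)[OF that] vector_mul_eq_0 using nz that by (auto simp: cone_Int)
    then have "(\<forall>v\<in>cone (V \<inter> L). \<rho> v = 0) \<longleftrightarrow> (\<forall>v\<in>cone (V \<inter> L). s v = 0)"
      using \<Phi>_eq_0_iff[OF V(1,4)] by simp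
    then show ?thesis using that True V(2) by (auto simp: cone_Int)
  qed (use assms in \<open>auto simp: corresponds_def\<close>)
  then show ?thesis by (auto simp: fun_eq_iff)
qed

lemma corresponds_linear:
  assumes "corresponds k \<rho> s" "corresponds k \<rho>' s'"
  shows "corresponds k (\<lambda>v. \<rho> v + c *s \<rho>' v) (\<lambda>v. s v + c *s s' v)"
  unfolding corresponds_def
proof (intro conjI allI impI ballI)
  fix v assume "v \<in> cone L"
  note True = this
  from corresponds_chart[OF assms(1) this] obtain V e j where V: "zariski_open V" "v \<in> cone V" 
    "\<And>v. v \<in> cone V \<Longrightarrow> v $ j \<noteq> 0" "e \<in> syz_sheaf f V"
    "\<And>v. v \<in> cone (V \<inter> L) \<Longrightarrow> \<rho> v = (v $ j powi k) *s e v" 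
    "\<And>v. v \<in> cone (V \<inter> L) \<Longrightarrow> s v = (v $ j powi k) *s \<Phi> V e v" by metis
  from corresponds_chart[OF assms(2) True] obtain V' e' j' where V': "zariski_open V'" "v \<in> cone V'" 
    "\<And>v. v \<in> cone V' \<Longrightarrow> v $ j' \<noteq> 0" "e' \<in> syz_sheaf f V'"
    "\<And>v. v \<in> cone (V' \<inter> L) \<Longrightarrow> \<rho>' v = (v $ j' powi k) *s e' v" 
    "\<And>v. v \<in> cone (V' \<inter> L) \<Longrightarrow> s' v = (v $ j' powi k) *s \<Phi> V' e' v" by metis
  define W where "W = V \<inter> V'"
  have W: "zariski_open W" "W \<subseteq> V" "W \<subseteq> V'" using V(1) V'(1) by (auto simp: W_def zariski_open_Int)
  have nz: "v $ j \<noteq> 0" "v $ j' \<noteq> 0" if "v \<in> cone W" for v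
    using V(3) V'(3) that by (auto simp: W_def cone_Int)
  \<comment> \<open>Rewrites the second chart, dehomogenised by coordinate \<open>j'\<close>, in
    terms of coordinate \<open>j\<close> of the first, so that the two can be added.\<close>
  define m where "m v = c * ((if v \<in> cone W then v $ j' powi k else 0) * (if v \<in> cone W then v $ j powi (-k) else 0))" for v :: "complex^3"
  have m: "m \<in> twist UNIV 0 W"
    using twist_cmult[OF twist_mult[OF coord_power_int_twist[OF W(1) nz(2), of k] coord_power_int_twist[OF W(1) nz(1), of "-k"]], of c]
    by (simp add: m_def [abs_def])
  note e = syz_sheaf_restr[OF V(4) W(1,2)] and e' = syz_sheaf_restr[OF V'(4) W(1,3)]
  define \<sigma> where "\<sigma> v = restr W e v + m v *s restr W e' v" for v
  have \<sigma>: "\<sigma> \<in> syz_sheaf f W"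
    unfolding \<sigma>_def [abs_def] by (intro syz_sheaf_add syz_sheaf_scale m e e')
  have "\<Phi> W \<sigma> = (\<lambda>v. \<Phi> W (restr W e) v + \<Phi> W (\<lambda>v. m v *s restr W e' v) v)"
    unfolding \<sigma>_def [abs_def] by (intro \<Phi>_add W syz_sheaf_scale m e e')
  also have "\<dots> = (\<lambda>v. restr W (\<Phi> V e) v + m v *s restr W (\<Phi> V' e') v)"
    by (simp only: \<Phi>_scale[OF W(1) m e']
      \<Phi>_restr[OF V(1) W(1,2) V(4)] \<Phi>_restr[OF V'(1) W(1,3) V'(4)])
  finally have \<Phi>\<sigma>: "\<Phi> W \<sigma> v = \<Phi> V e v + m v *s \<Phi> V' e' v" if "v \<in> cone (W \<inter> L)" for v
    using that by (simp add: restr_def cone_Int)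
  have \<sigma>v: "\<sigma> v = e v + m v *s e' v" if "v \<in> cone (W \<inter> L)" for v
    using that by (simp add: \<sigma>_def restr_def cone_Int)
  have eq: "(v $ j powi k) *s x + c *s (v $ j' powi k *s y) = (v $ j powi k) *s (x + m v *s y)"
    if "v \<in> cone (W \<inter> L)" for v and x y :: "complex^'m"
  proof -
    have v: "v \<in> cone W" using that by (simp add: cone_Int)
    have "(v $ j powi k) * m v = c * v $ j' powi k"
      using v nz[OF v] by (simp add: m_def power_int_minus field_simps)
    then show ?thesis by (simp add: vec_eq_iff distrib_left flip: mult.assoc)
  qed
  have in_VV: "v \<in> cone (V \<inter> L) \<and> v \<in> cone (V' \<inter> L)" if "v \<in> cone (W \<inter> L)" for v
    using that by (auto simp: W_def cone_Int)
  have "\<rho> v + c *s \<rho>' v = (v $ j powi k) *s \<sigma> v" "s v + c *s s' v = (v $ j powi k) *s \<Phi> W \<sigma> v"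
    if "v \<in> cone (W \<inter> L)" for v
  proof -
    note in1 = conjunct1[OF in_VV[OF that]] and in2 = conjunct2[OF in_VV[OF that]]
    show "\<rho> v + c *s \<rho>' v = (v $ j powi k) *s \<sigma> v"
      unfolding V(5)[OF in1] V'(5)[OF in2] \<sigma>v[OF that] by (rule eq[OF that])
    show "s v + c *s s' v = (v $ j powi k) *s \<Phi> W \<sigma> v"
      unfolding V(6)[OF in1] V'(6)[OF in2] \<Phi>\<sigma>[OF that] by (rule eq[OF that])
  qed
  then have "chart L k (\<lambda>v. \<rho> v + c *s \<rho>' v) W \<sigma> j" "chart L k (\<lambda>v. s v + c *s s' v) W (\<Phi> W \<sigma>) j"
    using W(1) nz(1) by (simp_all add: chart_def)
  moreover have "v \<in> cone W" using V(2) V'(2) by (simp add: W_def cone_Int)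
  ultimately show "\<exists>W e j. v \<in> cone W \<and> e \<in> syz_sheaf f W \<and> chart L k (\<lambda>v. \<rho> v + c *s \<rho>' v) W e j \<and>
       chart L k (\<lambda>v. s v + c *s s' v) W (\<Phi> W e) j" using \<sigma> by blast
qed (use assms in \<open>simp_all add: corresponds_def\<close>)

text \<open>The images under \<open>\<Phi>\<close> of different lifts agree along the line, since
  the lifts do; hence they glue.\<close>

lemma corresponds_left_total:
  assumes "\<And>v. v \<notin> cone L \<Longrightarrow> \<rho> v = 0"
    and "\<And>v. v \<in> cone L \<Longrightarrow> \<exists>V e j. v \<in> cone V \<and> e \<in> syz_sheaf f V \<and> chart L k \<rho> V e j"
  shows "\<exists>s. corresponds k \<rho> s"
proof -
  define C where "C = {(V, \<Phi> V e, j) | V e j. e \<in> syz_sheaf f V \<and> chart L k \<rho> V e j}"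
  have "\<exists>s. (\<forall>v. v \<notin> cone L \<longrightarrow> s v = 0) \<and> (\<forall>V e j. (V, e, j) \<in> C \<longrightarrow> chart L k s V e j)"
  proof (rule chart_glue[of C L k])
    fix V E j V' E' j' v
    assume "(V, E, j) \<in> C" "(V', E', j') \<in> C" and v: "v \<in> cone (V \<inter> V' \<inter> L)"
    then obtain e e' where e: "E = \<Phi> V e" "e \<in> syz_sheaf f V" "chart L k \<rho> V e j"
       "E' = \<Phi> V' e'" "e' \<in> syz_sheaf f V'" "chart L k \<rho> V' e' j'" unfolding C_def by blast
    have c: "zariski_open V" "\<And>v. v \<in> cone V \<Longrightarrow> v $ j \<noteq> 0" "zariski_open V'" "\<And>v. v \<in> cone V' \<Longrightarrow> v $ j' \<noteq> 0"
      using e by (auto simp: chart_def)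
    have "\<forall>v\<in>cone (V \<inter> V' \<inter> L). (v $ j powi k) *s e v = (v $ j' powi k) *s e' v"
      using e(3,6) unfolding chart_def cone_Int by (metis IntE IntI)
    then show "(v $ j powi k) *s E v = (v $ j' powi k) *s E' v"
      using compatible_iff[OF c(1,2) e(2) c(3,4) e(5), of k] v e(1,4) by simp
  next
    fix v assume "v \<in> cone L"
    from assms(2)[OF this] obtain V e j where V: "v \<in> cone V" "e \<in> syz_sheaf f V" "chart L k \<rho> V e j"
      by (elim exE conjE)
    then have "(V, \<Phi> V e, j) \<in> C" unfolding C_def by blast
    with V(1) show "\<exists>V E j. (V, E, j) \<in> C \<and> v \<in> cone V" by blast
  qed (auto simp: C_def chart_def)
  then obtain s where s: "\<And>v. v \<notin> cone L \<Longrightarrow> s v = 0" "\<And>V E j. (V, E, j) \<in> C \<Longrightarrow> chart L k s V E j"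
    by blast
  have "corresponds k \<rho> s" unfolding corresponds_def
  proof (intro conjI allI impI ballI)
    fix v assume "v \<in> cone L"
    from assms(2)[OF this] obtain V e j where V: "v \<in> cone V" "e \<in> syz_sheaf f V" "chart L k \<rho> V e j"
      by (elim exE conjE)
    then have "(V, \<Phi> V e, j) \<in> C" unfolding C_def by blast
    from s(2)[OF this] V show "\<exists>V e j. v \<in> cone V \<and> e \<in> syz_sheaf f V \<and> chart L k \<rho> V e j \<and> chart L k s V (\<Phi> V e) j"
      by (intro exI[of _ V] exI[of _ e] exI[of _ j] conjI)
  qed (use assms(1) s(1) in auto)
  then show ?thesis by blast
qed

text \<open>Surjectivity of \<open>\<Phi>\<close> is local, and the local preimages need not agree
  on the plane. Along the line they do, by injectivity of \<open>\<Phi>\<close> there, so they glue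
  to a syzygy on the line although no global section of E has been found.\<close>

lemma corresponds_right_total:
  assumes s: "\<And>i. (\<lambda>v. s v $ i) \<in> twist L (k - ab i) UNIV"
  shows "\<exists>\<rho>. corresponds k \<rho> s"
proof -
  have off: "s v = 0" if "v \<notin> cone L" for v
    using twist_eq_0[OF s] that by (simp add: vec_eq_iff)
  have ex: "\<exists>V e j. v \<in> cone V \<and> e \<in> syz_sheaf f V \<and> chart L k s V (\<Phi> V e) j" if v: "v \<in> cone L" for v
  proof -
    have "v \<noteq> 0" using v by (rule cone_nonzero)
    then obtain j where j: "v $ j \<noteq> 0" by (auto simp: vec_eq_iff)
    define U where "U = basic_open (\<lambda>v. v $ j)"
    have U: "zariski_open U" unfolding U_def by (rule zariski_open_basic[OF hpoly_coord])
    have cU: "v \<in> cone U \<longleftrightarrow> v \<noteq> 0 \<and> v $ j \<noteq> 0" for v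
      unfolding U_def by (rule cone_basic_open[OF hpoly_coord])
    \<comment> \<open>Division by the \<open>k\<close>-th power of the coordinate brings the section
      to the degree for which surjectivity of \<open>\<Phi>\<close> is assumed.\<close>
    define t where "t v = (if v \<in> cone U then v $ j powi (- k) else 0) *s s v" for v
    have "(\<lambda>v. t v $ i) \<in> twist L (- ab i) U" for i
    proof -
      have "restr U (\<lambda>v. s v $ i) \<in> twist L (k - ab i) U"
        using twist_restr[OF s U] by simp
      moreover have "(\<lambda>v. if v \<in> cone U then v $ j powi (- k) else 0) \<in> twist UNIV (- k) U"
        by (rule coord_power_int_twist[OF U]) (simp add: cU)
      ultimately have "(\<lambda>v. restr U (\<lambda>v. s v $ i) v * (if v \<in> cone U then v $ j powi (- k) else 0)) \<in> twist L (k - ab i + - k) U"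
        by (rule twist_mult) simp
      moreover have "(\<lambda>v. restr U (\<lambda>v. s v $ i) v * (if v \<in> cone U then v $ j powi (- k) else 0)) = (\<lambda>v. t v $ i)"
        by (auto simp: t_def restr_def)
      ultimately show ?thesis by simp
    qed
    then have "t \<in> split_sheaf L a b U" by (simp add: split_sheaf_iff)
    moreover have "abs_proj2 v \<in> U" using cU[of v] j \<open>v \<noteq> 0\<close> by (simp add: in_cone_iff)
    ultimately obtain V e where V: "zariski_open V" "abs_proj2 v \<in> V" "V \<subseteq> U" "e \<in> syz_sheaf f V" "\<Phi> V e = restr V t"
      using \<Phi>_surj[OF U] by blast
    have "chart L k s V (\<Phi> V e) j"
      unfolding chart_def V(5)
      using V(1) cone_mono[OF V(3)] cU
      by (auto simp: cone_Int restr_def t_def vector_smult_assoc power_int_minus)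
    then show ?thesis using V \<open>v \<noteq> 0\<close> by (intro exI[of _ V] exI[of _ e] exI[of _ j]) (simp add: in_cone_iff)
  qed
  define C where "C = {(V, e, j) | V e j. e \<in> syz_sheaf f V \<and> chart L k s V (\<Phi> V e) j}"
  have "\<exists>s. (\<forall>v. v \<notin> cone L \<longrightarrow> s v = 0) \<and> (\<forall>V e j. (V, e, j) \<in> C \<longrightarrow> chart L k s V e j)"
  proof (rule chart_glue[of C L k])
    fix V e j V' e' j' v
    assume "(V, e, j) \<in> C" "(V', e', j') \<in> C" and v: "v \<in> cone (V \<inter> V' \<inter> L)"
    then have e: "e \<in> syz_sheaf f V" "chart L k s V (\<Phi> V e) j"
       "e' \<in> syz_sheaf f V'" "chart L k s V' (\<Phi> V' e') j'" unfolding C_def by blast+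
    have c: "zariski_open V" "\<And>v. v \<in> cone V \<Longrightarrow> v $ j \<noteq> 0" "zariski_open V'" "\<And>v. v \<in> cone V' \<Longrightarrow> v $ j' \<noteq> 0"
      using e by (auto simp: chart_def)
    have "\<forall>v\<in>cone (V \<inter> V' \<inter> L). (v $ j powi k) *s \<Phi> V e v = (v $ j' powi k) *s \<Phi> V' e' v"
      using e(2,4) unfolding chart_def cone_Int by (metis IntE IntI)
    then show "(v $ j powi k) *s e v = (v $ j' powi k) *s e' v"
      using compatible_iff[OF c(1,2) e(1) c(3,4) e(3), of k] v by simp
  next
    fix v assume "v \<in> cone L"
    from ex[OF this] obtain V e j where V: "v \<in> cone V" "e \<in> syz_sheaf f V" "chart L k s V (\<Phi> V e) j"
      by (elim exE conjE)
    then have "(V, e, j) \<in> C" unfolding C_def by blast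
    with V(1) show "\<exists>V E j. (V, E, j) \<in> C \<and> v \<in> cone V" by blast
  qed (auto simp: C_def chart_def)
  then obtain \<rho> where \<rho>: "\<And>v. v \<notin> cone L \<Longrightarrow> \<rho> v = 0" "\<And>V E j. (V, E, j) \<in> C \<Longrightarrow> chart L k \<rho> V E j"
    by blast
  have "corresponds k \<rho> s" unfolding corresponds_def
  proof (intro conjI allI impI ballI)
    fix v assume "v \<in> cone L"
    from ex[OF this] obtain V e j where V: "v \<in> cone V" "e \<in> syz_sheaf f V" "chart L k s V (\<Phi> V e) j"
      by (elim exE conjE)
    then have "(V, e, j) \<in> C" unfolding C_def by blast
    from \<rho>(2)[OF this] V show "\<exists>V e j. v \<in> cone V \<and> e \<in> syz_sheaf f V \<and> chart L k \<rho> V e j \<and> chart L k s V (\<Phi> V e) j"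
      by (intro exI[of _ V] exI[of _ e] exI[of _ j] conjI)
  qed (use off \<rho>(1) in auto)
  then show ?thesis by blast
qed

text \<open>A syzygy along the line extends to a neighbourhood of each point: correct an arbitrary
  extension in a direction in which the derivative of f does not vanish.\<close>
lemma hpoly_lift:
  assumes r: "\<And>i. hpoly k (r i)"
    and syz: "\<And>v. v \<in> cone L \<Longrightarrow> (\<Sum>i\<in>UNIV. r i v * pderiv3 i f v) = 0"
    and \<rho>: "\<And>v. v \<in> cone L \<Longrightarrow> \<rho> v = (\<chi> i. r i v)"
    and v: "v \<in> cone L"
  shows "\<exists>V e j. v \<in> cone V \<and> e \<in> syz_sheaf f V \<and> chart L (int k) \<rho> V e j"
proof -
  have "v \<noteq> 0" using v by (rule cone_nonzero)
  then obtain j where j: "v $ j \<noteq> 0" by (auto simp: vec_eq_iff)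
  have pd: "hpoly (d - 1) (pderiv3 i f)" for i using pderiv3_hpoly[OF f] by blast
  from good[OF v] show ?thesis
  proof (elim disjE exE)
    fix c assume c: "pderiv3 c f v \<noteq> 0"
    define h where "h = (\<lambda>v. v $ j * pderiv3 c f v)"
    have h: "hpoly (Suc (d - 1)) h" unfolding h_def by (rule hpoly.coord[OF pd])
    define V where "V = basic_open h"
    have V: "zariski_open V" unfolding V_def by (rule zariski_open_basic[OF h])
    have cV: "v \<in> cone V \<longleftrightarrow> v \<noteq> 0 \<and> v $ j \<noteq> 0 \<and> pderiv3 c f v \<noteq> 0" for v
      unfolding V_def cone_basic_open[OF h] by (simp add: h_def)
    define g where "g v = (\<Sum>i\<in>UNIV. r i v * pderiv3 i f v)" for v
    have g: "hpoly (k + (d - 1)) g" unfolding g_def by (intro hpoly_sum hpoly_mult r pd)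
    \<comment> \<open>Component \<open>c\<close> is corrected by \<open>g / pderiv3 c f\<close>,
      with denominators cleared, so that the pairing with the gradient vanishes off the line too. On
      the line \<open>g = 0\<close> and the correction is invisible.\<close>
    define e :: "complex^3 \<Rightarrow> complex^3" where "e v = (if v \<in> cone V then
       \<chi> i. (r i v * pderiv3 c f v - (if i = c then 1 else 0) * g v) / (v $ j ^ k * pderiv3 c f v) else 0)" for v
    have "(\<lambda>v. e v $ i) \<in> twist UNIV 0 V" for i
    proof (rule twist_quotient[OF V])
      show "hpoly (k + (d - 1)) (\<lambda>v. r i v * pderiv3 c f v - (if i = c then 1 else 0) * g v)"
        by (intro hpoly_diff hpoly_mult r pd hpoly_cmult g)
      show "hpoly (1 * k + (d - 1)) (\<lambda>v. v $ j ^ k * pderiv3 c f v)"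
        by (intro hpoly_mult hpoly_power hpoly_coord pd)
    qed (auto simp: e_def cV)
    moreover have "(\<Sum>i\<in>UNIV. e v $ i * pderiv3 i f v) = 0" for v
    proof (cases "v \<in> cone V")
      case True
      have "(\<Sum>i\<in>UNIV. e v $ i * pderiv3 i f v) =
         (\<Sum>i\<in>UNIV. (r i v * pderiv3 i f v) * pderiv3 c f v - (if i = c then pderiv3 i f v * g v else 0)) / (v $ j ^ k * pderiv3 c f v)"
        unfolding sum_divide_distrib using True
        by (intro sum.cong) (auto simp: e_def diff_divide_distrib left_diff_distrib)
      also have "(\<Sum>i\<in>UNIV. (r i v * pderiv3 i f v) * pderiv3 c f v - (if i = c then pderiv3 i f v * g v else 0)) = 0"
        by (simp add: sum_subtractf g_def sum_distrib_left mult.commute)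
      finally show ?thesis by simp
    qed (simp add: e_def)
    ultimately have "e \<in> syz_sheaf f V" by (simp add: syz_sheaf_def)
    moreover have "chart L (int k) \<rho> V e j"
    proof -
      have "\<rho> v = (v $ j powi int k) *s e v" if "v \<in> cone (V \<inter> L)" for v
      proof -
        have v: "v \<in> cone V" "v \<in> cone L" using that by (auto simp: cone_Int)
        then have "g v = 0" using syz by (simp add: g_def)
        then show ?thesis using v by (auto simp: \<rho> e_def vec_eq_iff cV)
      qed
      then show ?thesis using V cV by (simp add: chart_def)
    qed
    moreover have "v \<in> cone V" using cV j c \<open>v \<noteq> 0\<close> by simp
    ultimately show ?thesis by blast
  next
    assume z: "\<forall>i. pderiv3 i f = (\<lambda>_. 0)"
    define V where "V = basic_open (\<lambda>v. v $ j)"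
    have V: "zariski_open V" unfolding V_def by (rule zariski_open_basic[OF hpoly_coord])
    have cV: "v \<in> cone V \<longleftrightarrow> v \<noteq> 0 \<and> v $ j \<noteq> 0" for v
      unfolding V_def by (rule cone_basic_open[OF hpoly_coord])
    define e :: "complex^3 \<Rightarrow> complex^3" where "e v = (if v \<in> cone V then
       \<chi> i. r i v / v $ j ^ k else 0)" for v
    have "(\<lambda>v. e v $ i) \<in> twist UNIV 0 V" for i
      by (rule twist_quotient[OF V r[of i] hpoly_power[OF hpoly_coord, of k j]]) (auto simp: e_def cV)
    then have "e \<in> syz_sheaf f V" by (simp add: syz_sheaf_def z)
    moreover have "chart L (int k) \<rho> V e j"
      using V by (auto simp: chart_def cV cone_Int \<rho> e_def vec_eq_iff)
    moreover have "v \<in> cone V" using cV j \<open>v \<noteq> 0\<close> by simp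
    ultimately show ?thesis by blast
  qed
qed

end

text \<open>Tells which polynomials in the affine parameter are sections of O(n) on the line. The
  bound is an integer: for negative \<open>n\<close> only 0 remains.\<close>

definition fits :: "complex poly \<Rightarrow> int \<Rightarrow> bool" where
  "fits p n \<longleftrightarrow> (p \<noteq> 0 \<longrightarrow> int (degree p) \<le> n)"

lemma fits_coeff: "fits p n \<longleftrightarrow> (\<forall>m. n < int m \<longrightarrow> coeff p m = 0)"
proof
  assume p: "fits p n"
  show "\<forall>m. n < int m \<longrightarrow> coeff p m = 0"
  proof (intro allI impI)
    fix m assume m: "n < int m"
    show "coeff p m = 0"
    proof (cases "p = 0")
      case False
      then have "degree p < m" using p m by (simp add: fits_def)
      then show ?thesis by (rule coeff_eq_0)
    qed simp
  qed
next
  assume "\<forall>m. n < int m \<longrightarrow> coeff p m = 0"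
  then show "fits p n" unfolding fits_def
    by (metis leading_coeff_neq_0 not_le)
qed

lemma fits_add: "fits p n \<Longrightarrow> fits p' n \<Longrightarrow> fits (p + p') n"
  by (simp add: fits_coeff)

lemma fits_smult: "fits p n \<Longrightarrow> fits (smult c p) n"
  by (simp add: fits_coeff)

lemma fits_int: "fits p (int k) \<longleftrightarrow> degree p \<le> k"
  by (auto simp: fits_def)

text \<open>The global sections of the \<open>k\<close>-th twist of E on the line through
  \<open>u\<close> and \<open>v\<close>, in the affine parameter. The point at infinity
  \<open>v\<close> does not occur explicitly: the degree bound together with homogenisation takes
  care of it.\<close>

definition line_syz ::
  "(complex^3 \<Rightarrow> complex) \<Rightarrow> complex^3 \<Rightarrow> complex^3 \<Rightarrow> nat \<Rightarrow> (complex poly^3) set" where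
  "line_syz f u v k = {R. (\<forall>i. degree (R $ i) \<le> k) \<and>
     (\<forall>t. (\<Sum>i\<in>UNIV. poly (R $ i) t * pderiv3 i f (u + t *s v)) = 0)}"

lemma line_syz_add:
  assumes "R \<in> line_syz f u v k" "R' \<in> line_syz f u v k"
  shows "R + [:c:] *s R' \<in> line_syz f u v k"
proof -
  have "degree ((R + [:c:] *s R') $ i) \<le> k" for i
    using assms by (auto simp: line_syz_def intro!: degree_add_le order_trans[OF degree_smult_le])
  moreover have "(\<Sum>i\<in>UNIV. poly ((R + [:c:] *s R') $ i) t * pderiv3 i f (u + t *s v)) = 0" for t
  proof -
    have "(\<Sum>i\<in>UNIV. poly ((R + [:c:] *s R') $ i) t * pderiv3 i f (u + t *s v)) =
       (\<Sum>i\<in>UNIV. poly (R $ i) t * pderiv3 i f (u + t *s v)) +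
       c * (\<Sum>i\<in>UNIV. poly (R' $ i) t * pderiv3 i f (u + t *s v))"
      by (simp add: algebra_simps sum.distrib sum_distrib_left)
    then show ?thesis using assms by (simp add: line_syz_def)
  qed
  ultimately show ?thesis by (simp add: line_syz_def)
qed

lemma line_syz_0: "0 \<in> line_syz f u v k"
  by (simp add: line_syz_def)

lemma line_syz_sum:
  assumes "\<And>l. l \<in> J \<Longrightarrow> x l \<in> line_syz f u v k"
  shows "(\<Sum>l\<in>J. [:c l:] *s x l) \<in> line_syz f u v k"
  using assms
proof (induction J rule: infinite_finite_induct)
  case (insert l J)
  then show ?case
    using line_syz_add[of "\<Sum>l\<in>J. [:c l:] *s x l" f u v k "x l" "c l"] by (simp add: add.commute)
qed (simp_all add: line_syz_0)

text \<open>\<open>\<omega>\<close> and \<open>\<tau>\<close> are linear forms on the whole space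
  that restrict to homogeneous coordinates on the line; through them binary forms extend to
  polynomials on the plane.\<close>

locale parametrized_line_splitting = line_splitting +
  fixes u v :: "complex^3" and \<omega> \<tau> :: "complex^3 \<Rightarrow> complex"
  assumes in_L: "\<And>w r. (w, r) \<noteq> (0, 0) \<Longrightarrow> w *s u + r *s v \<in> cone (dual_line p)"
    and coords: "\<And>x. x \<in> cone (dual_line p) \<Longrightarrow> x = \<omega> x *s u + \<tau> x *s v"
    and hpoly_coords: "hpoly 1 \<omega>" "hpoly 1 \<tau>"
    and coords_eval: "\<And>w r. \<omega> (w *s u + r *s v) = w" "\<And>w r. \<tau> (w *s u + r *s v) = r"
begin

definition bform :: "nat \<Rightarrow> complex poly \<Rightarrow> complex^3 \<Rightarrow> complex" where
  "bform n q x = (\<Sum>m\<le>n. coeff q m * (\<tau> x ^ m * \<omega> x ^ (n - m)))"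

lemma hpoly_bform: "hpoly n (bform n q)"
  unfolding bform_def [abs_def]
proof (rule hpoly_sum)
  fix m assume "m \<in> {..n}"
  then have "1 * m + 1 * (n - m) = n" by simp
  then show "hpoly n (\<lambda>x. coeff q m * (\<tau> x ^ m * \<omega> x ^ (n - m)))"
    using hpoly_cmult[OF hpoly_mult[OF hpoly_power[OF hpoly_coords(2), of m] hpoly_power[OF hpoly_coords(1), of "n - m"]]]
    by metis
qed

definition ext :: "int \<Rightarrow> complex poly \<Rightarrow> complex^3 \<Rightarrow> complex" where
  "ext n q x = (if x \<in> cone L \<and> 0 \<le> n then bform (nat n) q x else 0)"

lemma ext_twist: "ext n q \<in> twist L n UNIV"
proof (cases "0 \<le> n")
  case True
  then show ?thesis
    using twist_hpoly[OF hpoly_bform[of "nat n" q] zariski_open_UNIV, of L] by (simp add: ext_def [abs_def])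
next
  case False
  then show ?thesis using twist_zero[OF zariski_open_UNIV] by (simp add: ext_def [abs_def])
qed

lemma affine_in_L: "u + t *s v \<in> cone L"
  using in_L[of 1 t] by simp

lemma coords_affine: "\<omega> (u + t *s v) = 1" "\<tau> (u + t *s v) = t"
  using coords_eval[of 1 t] by simp_all

lemma bform_eval:
  assumes "degree q \<le> n"
  shows "bform n q (u + t *s v) = poly q t"
proof -
  have "poly q t = (\<Sum>m\<le>n. coeff q m * t ^ m)"
    unfolding poly_altdef using assms by (intro sum.mono_neutral_left) (auto simp: coeff_eq_0)
  then show ?thesis by (simp add: bform_def coords_affine)
qed

lemma ext_eval:
  assumes "fits q n"
  shows "ext n q (u + t *s v) = poly q t"
proof (cases "q = 0")
  case True
  then show ?thesis by (simp add: ext_def bform_def)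
next
  case False
  then have "int (degree q) \<le> n" using assms by (simp add: fits_def)
  then show ?thesis by (simp add: ext_def bform_eval affine_in_L)
qed

lemma ext_inj:
  assumes "fits q n" "fits q' n" "ext n q = ext n q'"
  shows "q = q'"
proof -
  have "poly q = poly q'"
    using ext_eval[OF assms(1)] ext_eval[OF assms(2)] assms(3) by (simp add: fun_eq_iff)
  then show ?thesis by (simp add: poly_eq_poly_eq_iff)
qed

lemma ext_add: "ext n (q + smult c q') x = ext n q x + c * ext n q' x"
  by (simp add: ext_def bform_def algebra_simps sum.distrib sum_distrib_left)

lemma ext_exhaust:
  assumes s: "s \<in> twist L n UNIV"
  shows "\<exists>q. fits q n \<and> s = ext n q"
proof -
  have off: "s x = 0" if "x \<notin> cone L" for x using twist_eq_0[OF s] that by simp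
  show ?thesis
  proof (cases "0 \<le> n")
    case True
    then have "s \<in> twist L (int (nat n)) UNIV" using s by simp
    then obtain q where q: "degree q \<le> nat n"
      "\<And>w r. (w, r) \<noteq> (0, 0) \<Longrightarrow> s (w *s u + r *s v) = (\<Sum>i\<le>nat n. coeff q i * r ^ i * w ^ (nat n - i))"
      using twist_binary_form[OF _ in_L, of s "nat n"] by metis
    have "s x = ext n q x" for x
    proof (cases "x \<in> cone L")
      case inL: True
      have x: "x = \<omega> x *s u + \<tau> x *s v" by (rule coords[OF inL])
      have "(\<omega> x, \<tau> x) \<noteq> (0, 0)"
      proof
        assume "(\<omega> x, \<tau> x) = (0, 0)"
        then have "x = 0" using x by simp
        then show False using inL cone_nonzero by blast
      qed
      from q(2)[OF this] show ?thesis
        using True inL x[symmetric] by (simp add: ext_def bform_def mult.assoc)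
    qed (simp add: off ext_def)
    moreover have "fits q n" using q(1) True by (simp add: fits_def le_nat_iff)
    ultimately show ?thesis by blast
  next
    case False
    obtain q where q: "q \<noteq> 0 \<longrightarrow> int (degree q) \<le> n" "\<forall>t. s (u + t *s v) = poly q t" "s v = 0"
      using twist_line_polynomial[OF s in_L] False by auto
    have "q = 0" using q(1) False by auto
    then have z: "s (u + t *s v) = 0" for t using q(2) by simp
    have "s x = 0" for x
    proof (cases "x \<in> cone L")
      case inL: True
      have x: "x = \<omega> x *s u + \<tau> x *s v" by (rule coords[OF inL])
      show ?thesis
      proof (cases "\<omega> x = 0")
        case True
        then have x': "x = \<tau> x *s v" using x by simp
        then have "\<tau> x \<noteq> 0" using cone_nonzero[OF inL] by (metis vector_smult_lzero)
        then show ?thesis using twist_homogeneous[OF s, of "\<tau> x" v] q(3) x' by simp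
      next
        case False
        have "x = \<omega> x *s (u + (\<tau> x / \<omega> x) *s v)"
          using x False by (simp add: vector_add_ldistrib vector_smult_assoc)
        then show ?thesis using twist_homogeneous[OF s False, of "u + (\<tau> x / \<omega> x) *s v"] z by simp
      qed
    qed (simp add: off)
    then have "s = ext n 0" by (auto simp: ext_def bform_def)
    then show ?thesis by (intro exI[of _ 0]) (simp add: fits_def)
  qed
qed

definition rext :: "nat \<Rightarrow> complex poly^3 \<Rightarrow> complex^3 \<Rightarrow> complex^3" where
  "rext k R x = (\<chi> i. ext (int k) (R $ i) x)"

text \<open>The degree is an integer, unlike in \<open>rext\<close>, because degree -1 is used in
  the proof that \<open>a\<close> is not negative.\<close>

definition sext :: "int \<Rightarrow> complex poly^2 \<Rightarrow> complex^3 \<Rightarrow> complex^2" where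
  "sext k P x = (\<chi> i. ext (k - ab i) (P $ i) x)"

text \<open>The definition of \<open>line_syz\<close> gives the relation at affine points.
  Homogeneity spreads it to all points with nonzero \<open>\<omega>\<close>, and continuity adds the
  point at infinity.\<close>

lemma line_syz_bform:
  assumes R: "R \<in> line_syz f u v k" and x: "x \<in> cone L"
  shows "(\<Sum>i\<in>UNIV. bform k (R $ i) x * pderiv3 i f x) = 0"
proof -
  define \<psi> where "\<psi> x = (\<Sum>i\<in>UNIV. bform k (R $ i) x * pderiv3 i f x)" for x
  have pd: "hpoly (d - 1) (pderiv3 i f)" for i using pderiv3_hpoly[OF f] by blast
  have hp: "hpoly (k + (d - 1)) \<psi>" unfolding \<psi>_def [abs_def]
    by (intro hpoly_sum hpoly_mult hpoly_bform pd)
  have 1: "\<psi> (u + t *s v) = 0" for t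
    using R by (simp add: \<psi>_def line_syz_def bform_eval)
  have 2: "\<psi> (w *s u + r *s v) = 0" if "w \<noteq> 0" for w r
  proof -
    have "w *s u + r *s v = w *s (u + (r / w) *s v)"
      using that by (simp add: vector_add_ldistrib vector_smult_assoc)
    then show ?thesis by (simp only: hpoly_homogeneous[OF hp] 1 mult_zero_right)
  qed
  have 3: "\<psi> (r *s v) = 0" for r
  proof -
    have "continuous_on UNIV (\<lambda>t. \<psi> (r *s v + t *s u))"
      by (rule continuous_on_compose2[OF hpoly_continuous[OF hp, of UNIV] continuous_on_line]) auto
    then have "((\<lambda>t. \<psi> (r *s v + t *s u)) \<longlongrightarrow> \<psi> (r *s v + 0 *s u)) (at 0)"
      unfolding continuous_on_def by (rule bspec) simp
    moreover have "((\<lambda>t. \<psi> (r *s v + t *s u)) \<longlongrightarrow> 0) (at 0)"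
      by (rule Lim_transform_eventually[OF tendsto_const])
        (use 2 in \<open>simp add: eventually_at_filter add.commute\<close>)
    ultimately have "\<psi> (r *s v + 0 *s u) = 0"
      using tendsto_unique trivial_limit_at by blast
    then show ?thesis by simp
  qed
  have "\<psi> (\<omega> x *s u + \<tau> x *s v) = 0" using 2 3 by (cases "\<omega> x = 0") auto
  then show ?thesis using coords[OF x] by (simp add: \<psi>_def)
qed

lemma corresponds_line_syz:
  assumes R: "R \<in> line_syz f u v k"
  shows "\<exists>!P. (\<forall>i. fits (P $ i) (int k - ab i)) \<and> corresponds (int k) (rext k R) (sext (int k) P)"
proof (rule ex_ex1I)
  have "\<exists>s. corresponds (int k) (rext k R) s"
  proof (rule corresponds_left_total)
    show "rext k R v = 0" if "v \<notin> cone L" for v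
      using that by (simp add: rext_def ext_def vec_eq_iff)
    show "\<exists>V e j. v \<in> cone V \<and> e \<in> syz_sheaf f V \<and> chart L (int k) (rext k R) V e j" if "v \<in> cone L" for v
      by (rule hpoly_lift[OF hpoly_bform line_syz_bform[OF R] _ that])
        (simp_all add: rext_def ext_def)
  qed
  then obtain s where s: "corresponds (int k) (rext k R) s" ..
  have "\<forall>i. \<exists>q. fits q (int k - ab i) \<and> (\<lambda>v. s v $ i) = ext (int k - ab i) q"
    using ext_exhaust[OF corresponds_twist(2)[OF s]] by blast
  then obtain P where P: "\<And>i. fits (P i) (int k - ab i)" "\<And>i. (\<lambda>v. s v $ i) = ext (int k - ab i) (P i)"
    by metis
  have "s = sext (int k) (\<chi> i. P i)"
    using P(2) by (simp add: sext_def fun_eq_iff vec_eq_iff)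
  then show "\<exists>P. (\<forall>i. fits (P $ i) (int k - ab i)) \<and> corresponds (int k) (rext k R) (sext (int k) P)"
    using s P(1) by (intro exI[of _ "\<chi> i. P i"]) simp
next
  fix P P' assume P: "(\<forall>i. fits (P $ i) (int k - ab i)) \<and> corresponds (int k) (rext k R) (sext (int k) P)"
    and P': "(\<forall>i. fits (P' $ i) (int k - ab i)) \<and> corresponds (int k) (rext k R) (sext (int k) P')"
  then have "sext (int k) P = sext (int k) P'" using corresponds_unique by blast
  then have "ext (int k - ab i) (P $ i) = ext (int k - ab i) (P' $ i)" for i
    by (simp add: sext_def fun_eq_iff vec_eq_iff)
  then have "P $ i = P' $ i" for i
    using P P' by (intro ext_inj[of _ "int k - ab i"]) simp_all
  then show "P = P'" by (simp add: vec_eq_iff)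
qed

text \<open>The coordinates of a syzygy in the splitting, as a function on polynomial vectors; well
  defined because \<open>corresponds\<close> is single valued and \<open>ext\<close>
  injective.\<close>

definition trivialize :: "nat \<Rightarrow> complex poly^3 \<Rightarrow> complex poly^2" where
  "trivialize k R = (THE P. (\<forall>i. fits (P $ i) (int k - ab i)) \<and> corresponds (int k) (rext k R) (sext (int k) P))"

lemma trivialize:
  assumes "R \<in> line_syz f u v k"
  shows "fits (trivialize k R $ i) (int k - ab i)"
    "corresponds (int k) (rext k R) (sext (int k) (trivialize k R))"
  using theI'[OF corresponds_line_syz[OF assms]] unfolding trivialize_def by blast+

lemma trivialize_unique:
  assumes "R \<in> line_syz f u v k" "\<And>i. fits (P $ i) (int k - ab i)"
    "corresponds (int k) (rext k R) (sext (int k) P)"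
  shows "trivialize k R = P"
  unfolding trivialize_def using assms by (intro the1_equality[OF corresponds_line_syz[OF assms(1)]]) simp

lemma trivialize_linear:
  assumes "R \<in> line_syz f u v k" "R' \<in> line_syz f u v k"
  shows "trivialize k (R + [:c:] *s R') = trivialize k R + [:c:] *s trivialize k R'"
proof (rule trivialize_unique[OF line_syz_add[OF assms]])
  show "fits ((trivialize k R + [:c:] *s trivialize k R') $ i) (int k - ab i)" for i
    using trivialize(1)[OF assms(1)] trivialize(1)[OF assms(2)] by (simp add: fits_add fits_smult)
  have "rext k (R + [:c:] *s R') = (\<lambda>v. rext k R v + c *s rext k R' v)"
    by (simp add: rext_def fun_eq_iff vec_eq_iff ext_add)
  moreover have "sext (int k) (trivialize k R + [:c:] *s trivialize k R') =
     (\<lambda>v. sext (int k) (trivialize k R) v + c *s sext (int k) (trivialize k R') v)"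
    by (simp add: sext_def fun_eq_iff vec_eq_iff ext_add)
  ultimately show "corresponds (int k) (rext k (R + [:c:] *s R')) (sext (int k) (trivialize k R + [:c:] *s trivialize k R'))"
    using corresponds_linear[OF trivialize(2)[OF assms(1)] trivialize(2)[OF assms(2)], of c] by simp
qed

lemma trivialize_eq_0:
  assumes R: "R \<in> line_syz f u v k" and "trivialize k R = 0"
  shows "R = 0"
proof -
  have "sext (int k) (trivialize k R) = (\<lambda>_. 0)"
    using assms(2) by (simp add: sext_def fun_eq_iff vec_eq_iff ext_def bform_def)
  then have "rext k R = (\<lambda>_. 0)"
    using corresponds_eq_0[OF trivialize(2)[OF R]] by blast
  then have "ext (int k) (R $ i) = ext (int k) 0" for i
    by (simp add: rext_def fun_eq_iff vec_eq_iff) (simp add: ext_def bform_def)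
  moreover have "fits (R $ i) (int k)" "fits 0 (int k)" for i
    using R by (simp_all add: line_syz_def fits_int)
  ultimately have "R $ i = 0" for i by (intro ext_inj[of _ "int k"]) simp_all
  then show ?thesis by (simp add: vec_eq_iff)
qed

lemma sext_twist: "(\<lambda>x. sext k P x $ i) \<in> twist L (k - ab i) UNIV"
  using ext_twist by (simp add: sext_def)

lemma trivialize_surj:
  assumes "\<And>i. fits (P $ i) (int k - ab i)"
  shows "\<exists>R\<in>line_syz f u v k. trivialize k R = P"
proof -
  obtain \<rho> where \<rho>: "corresponds (int k) \<rho> (sext (int k) P)"
    using corresponds_right_total[OF sext_twist] by blast
  have "\<forall>i. \<exists>q. fits q (int k) \<and> (\<lambda>v. \<rho> v $ i) = ext (int k) q"
    using ext_exhaust[OF corresponds_twist(1)[OF \<rho>]] by blast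
  then obtain Q where Q: "\<And>i. fits (Q i) (int k)" "\<And>i. (\<lambda>v. \<rho> v $ i) = ext (int k) (Q i)"
    by metis
  define R where "R = (\<chi> i. Q i)"
  have \<rho>R: "\<rho> = rext k R" using Q(2) by (simp add: rext_def R_def fun_eq_iff vec_eq_iff)
  have "R \<in> line_syz f u v k"
    unfolding line_syz_def
  proof (intro CollectI conjI allI)
    show "degree (R $ i) \<le> k" for i using Q(1)[of i] by (simp add: R_def fits_int)
    fix t
    have "0 = (\<Sum>i\<in>UNIV. \<rho> (u + t *s v) $ i * pderiv3 i f (u + t *s v))"
      using corresponds_twist(3)[OF \<rho>] by simp
    then show "(\<Sum>i\<in>UNIV. poly (R $ i) t * pderiv3 i f (u + t *s v)) = 0"
      by (simp add: \<rho>R rext_def R_def ext_eval[OF Q(1)])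
  qed
  moreover from this have "trivialize k R = P"
    using \<rho> assms unfolding \<rho>R by (intro trivialize_unique)
  ultimately show ?thesis by blast
qed

text \<open>E is a subsheaf of O^3, and O(-1) has no sections on the line. If \<open>a\<close> were
  negative, the constant 1 in the summand O(-1 - a) would come from a nonzero syzygy of degree
  -1.\<close>

lemma a_nonneg: "0 \<le> a"
proof (rule ccontr)
  assume a: "\<not> 0 \<le> a"
  define P :: "complex poly^2" where "P = (\<chi> i. if i = 1 then 1 else 0)"
  obtain \<rho> where \<rho>: "corresponds (-1) \<rho> (sext (-1) P)"
    using corresponds_right_total[OF sext_twist] by blast
  have "\<rho> x $ i = 0" for x i
    using ext_exhaust[OF corresponds_twist(1)[OF \<rho>, of i]] by (auto simp: ext_def fun_eq_iff)
  then have "\<rho> = (\<lambda>_. 0)" by (simp add: fun_eq_iff vec_eq_iff)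
  then have "sext (-1) P = (\<lambda>_. 0)" using corresponds_eq_0[OF \<rho>] by blast
  then have "sext (-1) P (u + 0 *s v) $ 1 = 0" by simp
  then have "ext (-1 - a) 1 (u + 0 *s v) = 0" by (simp add: sext_def P_def ab_def)
  moreover have "fits 1 (-1 - a)" using a by (simp add: fits_def)
  ultimately show False using ext_eval[of 1 "-1 - a" 0] by simp
qed

text \<open>Labels the monomial basis of the sections of O(k - a) + O(k - b).\<close>

definition index :: "nat \<Rightarrow> (2 \<times> nat) set" where
  "index k = {(i, m). int m \<le> int k - ab i}"

lemma finite_card_index:
  "finite (index k)" "card (index k) = nat (int k + 1 - a) + nat (int k + 1 - b)"
proof -
  have "(i, m) \<in> index k \<longleftrightarrow> (i, m) \<in> {1} \<times> {..<nat (int k + 1 - a)} \<union> {2} \<times> {..<nat (int k + 1 - b)}"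
    for i :: 2 and m
    using exhaust_2[of i] by (auto simp: index_def ab_def)
  then have "index k = {1} \<times> {..<nat (int k + 1 - a)} \<union> {2} \<times> {..<nat (int k + 1 - b)}"
    by (intro equalityI subrelI) simp_all
  note index = this
  show "finite (index k)" unfolding index by simp
  show "card (index k) = nat (int k + 1 - a) + nat (int k + 1 - b)"
    unfolding index by (subst card_Un_disjoint) (auto simp: card_cartesian_product)
qed

lemma trivialize_sum:
  assumes "\<And>l. l \<in> J \<Longrightarrow> x l \<in> line_syz f u v k"
  shows "trivialize k (\<Sum>l\<in>J. [:c l:] *s x l) = (\<Sum>l\<in>J. [:c l:] *s trivialize k (x l))"
proof -
  have 0: "trivialize k 0 = 0"
    using trivialize_linear[OF line_syz_0 line_syz_0, of k 1] by simp
  show ?thesis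
    using assms
  proof (induction J rule: infinite_finite_induct)
    case (insert l J)
    then show ?case
      using trivialize_linear[OF line_syz_sum[of J x f u v k c], of "x l" "c l"] by (simp add: add.commute)
  qed (simp_all add: 0)
qed

text \<open>Upper half of the formula for the number of syzygies of degree \<open>k\<close> on the
  line: \<open>trivialize\<close> embeds them into the space with basis
  \<open>index k\<close>.\<close>

lemma line_syz_dependent:
  fixes x :: "'j \<Rightarrow> complex poly^3"
  assumes J: "finite J" "nat (int k + 1 - a) + nat (int k + 1 - b) < card J"
    and x: "\<And>l. l \<in> J \<Longrightarrow> x l \<in> line_syz f u v k"
  shows "\<exists>c. (\<exists>l\<in>J. c l \<noteq> 0) \<and> (\<Sum>l\<in>J. [:c l:] *s x l) = 0"
proof -
  obtain c where c: "\<exists>l\<in>J. c l \<noteq> 0"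
    "\<forall>im\<in>index k. (\<Sum>l\<in>J. c l * coeff (trivialize k (x l) $ fst im) (snd im)) = 0"
    using homogeneous_system_nontrivial[of "index k" J "\<lambda>l im. coeff (trivialize k (x l) $ fst im) (snd im)"]
      finite_card_index J by auto
  have "coeff (trivialize k (\<Sum>l\<in>J. [:c l:] *s x l) $ i) m = 0" for i m
  proof (cases "(i, m) \<in> index k")
    case True
    then show ?thesis using c(2) by (auto simp: trivialize_sum[OF x] coeff_sum)
  next
    case False
    then show ?thesis
      using trivialize(1)[OF line_syz_sum[of J x f u v k c, OF x], of i] by (auto simp: fits_coeff index_def)
  qed
  then have "trivialize k (\<Sum>l\<in>J. [:c l:] *s x l) = 0" by (simp add: vec_eq_iff poly_eq_iff)
  then have "(\<Sum>l\<in>J. [:c l:] *s x l) = 0"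
    using trivialize_eq_0[OF line_syz_sum[of J x f u v k c, OF x]] by simp
  then show ?thesis using c(1) by blast
qed

text \<open>Lower half of the same formula: preimages of the monomial pairs inherit independence
  because \<open>trivialize\<close> is linear.\<close>

lemma line_syz_independent:
  "\<exists>x :: 2 \<times> nat \<Rightarrow> complex poly^3. (\<forall>l\<in>index k. x l \<in> line_syz f u v k) \<and>
    (\<forall>c. (\<Sum>l\<in>index k. [:c l:] *s x l) = 0 \<longrightarrow> (\<forall>l\<in>index k. c l = 0))"
proof -
  define P :: "2 \<times> nat \<Rightarrow> complex poly^2"
    where "P l = (\<chi> i. if i = fst l then monom 1 (snd l) else 0)" for l
  have "\<exists>R\<in>line_syz f u v k. trivialize k R = P l" if "l \<in> index k" for l
    using that by (intro trivialize_surj) (auto simp: P_def index_def fits_def degree_monom_eq)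
  then obtain x where x: "\<And>l. l \<in> index k \<Longrightarrow> x l \<in> line_syz f u v k" 
    "\<And>l. l \<in> index k \<Longrightarrow> trivialize k (x l) = P l" by metis
  have "c l = 0" if "(\<Sum>l\<in>index k. [:c l:] *s x l) = 0" "l \<in> index k" for c l
  proof -
    have "0 = trivialize k (\<Sum>l\<in>index k. [:c l:] *s x l)"
      using that(1) trivialize_sum[of "{}" x k c] by simp
    also have "\<dots> = (\<Sum>l\<in>index k. [:c l:] *s P l)"
      by (simp add: trivialize_sum[OF x(1)] x(2))
    finally have "0 = coeff ((\<Sum>l\<in>index k. [:c l:] *s P l) $ fst l) (snd l)" by (metis coeff_0 zero_index)
    also have "\<dots> = (\<Sum>m\<in>index k. if m = l then c l else 0)"
      unfolding sum_component coeff_sum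
      by (intro sum.cong) (auto simp: P_def prod_eq_iff)
    finally show ?thesis using that(2) finite_card_index by simp
  qed
  then show ?thesis using x(1) by blast
qed

end

section \<open>Polynomials along lines and genericity\<close>

lemma hpoly_line_poly:
  "hpoly r g \<Longrightarrow> \<exists>p. degree p \<le> r \<and> (\<forall>t. g (u + t *s v) = poly p t)"
proof (induction rule: hpoly.induct)
  case (const c)
  show ?case by (rule exI[of _ "[:c:]"]) simp
next
  case (zero r)
  show ?case by (rule exI[of _ 0]) simp
next
  case (add r g h)
  then obtain p p' where "degree p \<le> r" "\<forall>t. g (u + t *s v) = poly p t"
    "degree p' \<le> r" "\<forall>t. h (u + t *s v) = poly p' t" by blast
  then show ?case by (intro exI[of _ "p + p'"]) (simp add: degree_add_le)
next
  case (coord r g i)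
  then obtain p where p: "degree p \<le> r" "\<forall>t. g (u + t *s v) = poly p t" by blast
  have "degree ([:u $ i, v $ i:] * p) \<le> Suc r"
    using p(1) by (intro order_trans[OF degree_mult_le]) auto
  then show ?case using p(2) by (intro exI[of _ "[:u $ i, v $ i:] * p"]) (simp add: algebra_simps)
qed

text \<open>Irreducibility of affine space: on the line joining \<open>x\<close> and
  \<open>y\<close> both functions are nonzero univariate polynomials, hence so is their
  product.\<close>

lemma hpoly_mult_nonzero:
  assumes "hpoly r g" "hpoly s h" "g x \<noteq> 0" "h y \<noteq> 0"
  shows "\<exists>z. g z * h z \<noteq> 0"
proof -
  obtain p p' where p: "\<And>t. g (x + t *s (y - x)) = poly p t" "\<And>t. h (x + t *s (y - x)) = poly p' t"
    using hpoly_line_poly[OF assms(1)] hpoly_line_poly[OF assms(2)] by metis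
  have "poly p 0 \<noteq> 0" "poly p' 1 \<noteq> 0"
    using p(1)[of 0] p(2)[of 1] assms(3,4) by auto
  then have "p * p' \<noteq> 0" by auto
  then obtain t where "poly (p * p') t \<noteq> 0" using poly_all_0_iff_0 by blast
  then show ?thesis using p by (intro exI[of _ "x + t *s (y - x)"]) simp
qed

text \<open>A nonempty open set contains the complement of a hypersurface, so finitely many generic
  conditions can be combined by multiplying polynomials.\<close>

lemma generically_hpoly:
  assumes "generically P"
  obtains r g x where "hpoly r g" "g x \<noteq> 0" "\<And>v. v \<noteq> 0 \<Longrightarrow> g v \<noteq> 0 \<Longrightarrow> P (abs_proj2 v)"
proof -
  obtain U where U: "zariski_open U" "U \<noteq> {}" "\<forall>p\<in>U. P p"
    using assms unfolding generically_def by blast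
  then obtain p where "p \<in> U" by blast
  obtain r g where g: "hpoly r g" "g (rep_proj2 p) \<noteq> 0" "basic_open g \<subseteq> U"
    using zariski_open_basis[OF U(1) \<open>p \<in> U\<close>] by metis
  have "P (abs_proj2 v)" if "v \<noteq> 0" "g v \<noteq> 0" for v
  proof -
    have "v \<in> cone (basic_open g)" using cone_basic_open[OF g(1)] that by blast
    then show ?thesis using g(3) U(3) by (auto simp: in_cone_iff)
  qed
  then show ?thesis using that g by blast
qed

lemma hpoly_prod_nonzero:
  assumes "finite I" "\<And>i. i \<in> I \<Longrightarrow> \<exists>r. hpoly r (g i)" "\<And>i. i \<in> I \<Longrightarrow> \<exists>x. g i x \<noteq> 0"
  shows "\<exists>r. hpoly r (\<lambda>v. \<Prod>i\<in>I. g i v) \<and> (\<exists>x. (\<Prod>i\<in>I. g i x) \<noteq> 0)"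
  using assms
proof (induction I rule: finite_induct)
  case empty
  show ?case using hpoly.const[of 1] by auto
next
  case (insert i I)
  then obtain r x s y where r: "hpoly r (\<lambda>v. \<Prod>i\<in>I. g i v)" "(\<Prod>i\<in>I. g i x) \<noteq> 0" "hpoly s (g i)" "g i y \<noteq> 0"
    by (metis insertCI)
  have "\<exists>z. g i z * (\<Prod>i\<in>I. g i z) \<noteq> 0" by (rule hpoly_mult_nonzero[OF r(3,1,4,2)])
  then show ?case using hpoly_mult[OF r(3,1)] insert.hyps by auto
qed

lemma hpoly_nonzero_affine:
  assumes "hpoly r g" "g x \<noteq> 0"
  shows "\<exists>q. q $ 3 = 1 \<and> g q \<noteq> 0"
proof -
  obtain z where z: "g z * z $ 3 \<noteq> 0"
    using hpoly_mult_nonzero[OF assms(1) hpoly_coord[of 3] assms(2), of "axis 3 1"] by (auto simp: axis_def)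
  then show ?thesis using hpoly_homogeneous[OF assms(1), of "1 / z $ 3" z]
    by (intro exI[of _ "(1 / z $ 3) *s z"]) auto
qed

section \<open>Line arrangements\<close>

locale arrangement =
  fixes Z :: "proj2 set" and d :: nat
  assumes finZ: "finite Z" and cardZ: "card Z = d"
begin

abbreviation f where "f \<equiv> arr_poly Z"

lemma hpoly_f: "hpoly d f"
proof -
  have "hpoly (\<Sum>p\<in>Z. 1) (\<lambda>v. \<Prod>p\<in>Z. dual_form p v)"
    by (rule hpoly_prod) (rule dual_form_hpoly)
  then show ?thesis using cardZ by (simp add: arr_poly_def [abs_def])
qed

lemma hpoly_grad: "hpoly (d - 1) (pderiv3 i f)"
  using pderiv3_hpoly[OF hpoly_f] by blast

lemma grad_eq: "pderiv3 i f v = (\<Sum>p\<in>Z. rep_proj2 p $ i * (\<Prod>p'\<in>Z - {p}. dual_form p' v))"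
proof -
  have "((\<lambda>t. \<Prod>p\<in>Z. dual_form p (v + t *s axis i 1)) has_field_derivative
      (\<Sum>p\<in>Z. rep_proj2 p $ i * (\<Prod>p'\<in>Z - {p}. dual_form p' (v + 0 *s axis i 1)))) (at 0)"
  proof (rule has_field_derivative_prod)
    fix p assume "p \<in> Z"
    have eq: "dual_form p (v + t *s axis i 1) = dual_form p v + t * rep_proj2 p $ i" for t
    proof -
      have "dual_form p (v + t *s axis i 1) = dual_form p v + (\<Sum>k\<in>UNIV. rep_proj2 p $ k * (t * axis i 1 $ k))"
        by (simp add: dual_form_def distrib_left sum.distrib)
      also have "(\<Sum>k\<in>UNIV. rep_proj2 p $ k * (t * axis i 1 $ k)) = (\<Sum>k\<in>UNIV. if k = i then t * rep_proj2 p $ i else 0)"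
        by (intro sum.cong) (auto simp: axis_def)
      finally show ?thesis by simp
    qed
    show "((\<lambda>t. dual_form p (v + t *s axis i 1)) has_field_derivative rep_proj2 p $ i) (at 0)"
      unfolding eq by (auto intro!: derivative_eq_intros)
  qed
  then show ?thesis unfolding pderiv3_def arr_poly_def [abs_def] by (simp add: DERIV_imp_deriv)
qed

lemma dot_grad: "(\<Sum>i\<in>UNIV. w $ i * pderiv3 i f v) = (\<Sum>p\<in>Z. dual_form p w * (\<Prod>p'\<in>Z - {p}. dual_form p' v))"
  unfolding grad_eq dual_form_def
  by (simp add: sum_distrib_left sum_distrib_right sum.swap[of _ UNIV] mult_ac)

lemma euler: "(\<Sum>i\<in>UNIV. v $ i * pderiv3 i f v) = of_nat d * f v"
proof -
  have "dual_form p v * (\<Prod>p'\<in>Z - {p}. dual_form p' v) = f v" if "p \<in> Z" for p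
    using prod.remove[OF finZ that, of "\<lambda>p. dual_form p v"] by (simp add: arr_poly_def)
  then show ?thesis unfolding dot_grad using cardZ by simp
qed

text \<open>All other summands of the product rule contain the factor
  \<open>dual_form p v\<close>.\<close>

lemma dot_grad_on_line:
  assumes "p \<in> Z" "dual_form p v = 0"
  shows "(\<Sum>i\<in>UNIV. w $ i * pderiv3 i f v) = dual_form p w * (\<Prod>p'\<in>Z - {p}. dual_form p' v)"
proof -
  have "(\<Sum>p\<in>Z - {p}. dual_form p w * (\<Prod>p'\<in>Z - {p}. dual_form p' v)) = 0"
    using assms finZ by (intro sum.neutral) (auto intro!: bexI[of _ p])
  then show ?thesis unfolding dot_grad
    using sum.remove[OF finZ assms(1), of "\<lambda>p. dual_form p w * (\<Prod>p'\<in>Z - {p}. dual_form p' v)"] by simp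
qed

lemma f_nonzero: "\<exists>v. f v \<noteq> 0"
proof -
  have "\<exists>v. dual_form p v \<noteq> 0" for p
  proof -
    obtain k where k: "rep_proj2 p $ k \<noteq> 0" using rep_proj2_nonzero[of p] by (metis vec_eq_iff zero_index)
    have "dual_form p (axis k 1) = (\<Sum>i\<in>UNIV. if i = k then rep_proj2 p $ k else 0)"
      unfolding dual_form_def by (intro sum.cong) (auto simp: axis_def)
    then show ?thesis using k by (intro exI[of _ "axis k 1"]) simp
  qed
  then show ?thesis
    using hpoly_prod_nonzero[OF finZ, of dual_form] dual_form_hpoly unfolding arr_poly_def by blast
qed

text \<open>The line dual to q passes through no multiple point of the arrangement and is none of its lines.\<close>
definition good_point :: "complex^3 \<Rightarrow> bool" where
  "good_point q \<longleftrightarrow> q $ 3 = 1 \<and>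
     (\<forall>p\<in>Z. \<forall>p'\<in>Z. p \<noteq> p' \<longrightarrow> (\<forall>x. (\<Sum>i\<in>UNIV. q $ i * x $ i) = 0 \<and> dual_form p x = 0 \<and> dual_form p' x = 0 \<longrightarrow> x = 0)) \<and>
     (\<forall>p\<in>Z. \<exists>y. dual_form p y = 0 \<and> (\<Sum>i\<in>UNIV. q $ i * y $ i) \<noteq> 0)"

text \<open>Each pair of lines of the arrangement meets in one point, and \<open>q\<close> must not
  be orthogonal to it. For each single line one chosen nonzero vector on it must not be orthogonal
  to \<open>q\<close>. The product of these finitely many nonzero linear forms in \<open>q\<close>
  is the required polynomial.\<close>

lemma good_point_generic:
  "\<exists>r g. hpoly r g \<and> (\<exists>x. g x \<noteq> 0) \<and> (\<forall>q. q $ 3 = 1 \<and> g q \<noteq> 0 \<longrightarrow> good_point q)"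
proof -
  \<comment> \<open>The cross product: the intersection point of the lines dual to \<open>z\<close>
    and \<open>z'\<close>, zero only for proportional vectors.\<close>
  define cr :: "complex^3 \<Rightarrow> complex^3 \<Rightarrow> complex^3" where
    "cr z z' = vector [z$2 * z'$3 - z$3 * z'$2, z$3 * z'$1 - z$1 * z'$3, z$1 * z'$2 - z$2 * z'$1]" for z z'
  define lin where "lin y q = (\<Sum>i\<in>UNIV. y $ i * q $ i)" for y q :: "complex^3"
  have lin_nz: "\<exists>q. lin y q \<noteq> 0" if y: "y \<noteq> 0" for y
  proof -
    obtain k where k: "y $ k \<noteq> 0" using y by (metis vec_eq_iff zero_index)
    have "lin y (axis k 1) = (\<Sum>i\<in>UNIV. if i = k then y $ k else 0)"
      unfolding lin_def by (intro sum.cong) (auto simp: axis_def)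
    then show ?thesis using k by (intro exI[of _ "axis k 1"]) simp
  qed
  have lin_hp: "hpoly 1 (lin y)" for y unfolding lin_def [abs_def] by (rule hpoly_linear)
  have cr_nz: "cr (rep_proj2 p) (rep_proj2 p') \<noteq> 0" if "p \<noteq> p'" for p p'
  proof
    let ?z = "rep_proj2 p" and ?z' = "rep_proj2 p'"
    assume "cr ?z ?z' = 0"
    then have c: "?z$2 * ?z'$3 = ?z$3 * ?z'$2" "?z$3 * ?z'$1 = ?z$1 * ?z'$3" "?z$1 * ?z'$2 = ?z$2 * ?z'$1"
      by (simp_all add: cr_def vec_eq_iff forall_3)
    obtain k where k: "?z' $ k \<noteq> 0" using rep_proj2_nonzero[of p'] by (metis vec_eq_iff zero_index)
    have "?z $ i * ?z' $ k = ?z $ k * ?z' $ i" for i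
      using exhaust_3[of i] exhaust_3[of k] c by (elim disjE) (simp_all add: mult.commute)
    note proportional = this
    define c where "c = ?z $ k / ?z' $ k"
    have ck: "?z $ k = c * ?z' $ k" using k by (simp add: c_def)
    have "?z $ i = c * ?z' $ i" for i
    proof -
      have "?z $ i * ?z' $ k = (c * ?z' $ i) * ?z' $ k"
        unfolding proportional[of i] ck by (simp only: mult_ac)
      then show ?thesis using k by simp
    qed
    then have eq: "?z = c *s ?z'" by (simp add: vec_eq_iff)
    have "c \<noteq> 0"
    proof
      assume "c = 0"
      then have "?z = 0" using eq by simp
      then show False using rep_proj2_nonzero by blast
    qed
    then have "abs_proj2 (c *s ?z') = abs_proj2 ?z'"
      by (intro abs_proj2_scale rep_proj2_nonzero)
    then have "abs_proj2 ?z = abs_proj2 ?z'" by (simp only: eq)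
    then show False using that by simp
  qed
  have "\<exists>y. y \<noteq> 0 \<and> dual_form p y = 0" for p
  proof -
    let ?z = "rep_proj2 p"
    show ?thesis
    proof (cases "?z $ 1 = 0 \<and> ?z $ 2 = 0")
      case True
      then show ?thesis by (intro exI[of _ "vector [1, 0, 0]"])
          (simp add: dual_form_def sum_3 vec_eq_iff forall_3)
    next
      case False
      then show ?thesis by (intro exI[of _ "vector [?z $ 2, - ?z $ 1, 0]"])
          (auto simp: dual_form_def sum_3 vec_eq_iff forall_3)
    qed
  qed
  then obtain y where y: "\<And>p. y p \<noteq> 0" "\<And>p. dual_form p (y p) = 0" by metis
  define I where "I = {(p, p'). p \<in> Z \<and> p' \<in> Z \<and> p \<noteq> p'}"
  have "I \<subseteq> Z \<times> Z" by (auto simp: I_def)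
  then have finI: "finite I" using finZ finite_subset by blast
  obtain r1 x1 where 1: "hpoly r1 (\<lambda>q. \<Prod>i\<in>I. lin (cr (rep_proj2 (fst i)) (rep_proj2 (snd i))) q)"
     "(\<Prod>i\<in>I. lin (cr (rep_proj2 (fst i)) (rep_proj2 (snd i))) x1) \<noteq> 0"
    using hpoly_prod_nonzero[OF finI, of "\<lambda>i. lin (cr (rep_proj2 (fst i)) (rep_proj2 (snd i)))"]
      lin_hp lin_nz cr_nz by (force simp: I_def)
  obtain r2 x2 where 2: "hpoly r2 (\<lambda>q. \<Prod>p\<in>Z. lin (y p) q)" "(\<Prod>p\<in>Z. lin (y p) x2) \<noteq> 0"
    using hpoly_prod_nonzero[OF finZ, of "\<lambda>p. lin (y p)"] lin_hp lin_nz y(1) by blast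
  define g where "g q = (\<Prod>i\<in>I. lin (cr (rep_proj2 (fst i)) (rep_proj2 (snd i))) q) * (\<Prod>p\<in>Z. lin (y p) q)" for q
  have "good_point q" if q: "q $ 3 = 1" "g q \<noteq> 0" for q
    unfolding good_point_def
  proof (intro conjI ballI impI allI q(1))
    fix p p' x assume p: "p \<in> Z" "p' \<in> Z" "p \<noteq> p'"
      and x: "(\<Sum>i\<in>UNIV. q $ i * x $ i) = 0 \<and> dual_form p x = 0 \<and> dual_form p' x = 0"
    let ?z = "rep_proj2 p" and ?z' = "rep_proj2 p'"
    have "(p, p') \<in> I" using p by (simp add: I_def)
    then have D: "lin (cr ?z ?z') q \<noteq> 0" using q(2) finI by (force simp: g_def)
    define D where "D = lin (cr ?z ?z') q"
    have e: "q$1 * x$1 + q$2 * x$2 + q$3 * x$3 = 0" "?z$1 * x$1 + ?z$2 * x$2 + ?z$3 * x$3 = 0"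
       "?z'$1 * x$1 + ?z'$2 * x$2 + ?z'$3 * x$3 = 0" using x by (auto simp: dual_form_def sum_3)
    have Deq: "D = (?z$2 * ?z'$3 - ?z$3 * ?z'$2) * q$1 + (?z$3 * ?z'$1 - ?z$1 * ?z'$3) * q$2 + (?z$1 * ?z'$2 - ?z$2 * ?z'$1) * q$3"
      by (simp add: D_def lin_def cr_def sum_3)
    \<comment> \<open>Cramer's rule: \<open>D\<close> is the determinant of the three linear
      equations satisfied by \<open>x\<close>.\<close>
    have "D * x$1 = 0" "D * x$2 = 0" "D * x$3 = 0"
      unfolding Deq using e by algebra+
    then show "x = 0" using D by (simp add: D_def vec_eq_iff forall_3)
  next
    fix p assume "p \<in> Z"
    then have "lin (y p) q \<noteq> 0" using q(2) finZ by (auto simp: g_def)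
    then show "\<exists>y. dual_form p y = 0 \<and> (\<Sum>i\<in>UNIV. q $ i * y $ i) \<noteq> 0"
      using y(2) by (intro exI[of _ "y p"]) (simp add: lin_def mult.commute)
  qed
  moreover have "hpoly (r1 + r2) g" unfolding g_def [abs_def] by (rule hpoly_mult[OF 1(1) 2(1)])
  moreover have "\<exists>x. g x \<noteq> 0" unfolding g_def by (rule hpoly_mult_nonzero[OF 1(1) 2(1) 1(2) 2(2)])
  ultimately show ?thesis by blast
qed

end

definition base_pt :: "complex^3 \<Rightarrow> complex^3" where
  "base_pt q = vector [-1, 0, q $ 1]"

text \<open>Equals \<open>(0, 1, - q $ 2)\<close> plus \<open>\<kappa>\<close> times
  \<open>base_pt q\<close>. Varying \<open>\<kappa>\<close> moves the point of infinite parameter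
  along the line; for \<open>\<kappa> = 0\<close> and \<open>q $ 3 = 1\<close> the parametrisation
  is (-1, t, q$1 - t * q$2).\<close>

definition dir_pt :: "complex^3 \<Rightarrow> complex \<Rightarrow> complex^3" where
  "dir_pt q \<kappa> = vector [- \<kappa>, 1, \<kappa> * q $ 1 - q $ 2]"

lemma line_pt_components:
  "(w *s base_pt q + r *s dir_pt q \<kappa>) $ 1 = - w - \<kappa> * r"
  "(w *s base_pt q + r *s dir_pt q \<kappa>) $ 2 = r"
  "(w *s base_pt q + r *s dir_pt q \<kappa>) $ 3 = w * q $ 1 + r * (\<kappa> * q $ 1 - q $ 2)"
  by (simp_all add: base_pt_def dir_pt_def)

locale good_line = arrangement +
  fixes a b :: int and q :: "complex^3"
  assumes ab: "a \<le> b" and good_q: "good_point q"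
    and splits: "restriction_splits (arr_poly Z) (dual_line (abs_proj2 q)) a b"
begin

lemma q3: "q $ 3 = 1" using good_q by (simp add: good_point_def)

lemma q_nonzero: "q \<noteq> 0" using q3 by auto

lemma in_line: "x \<in> cone (dual_line (abs_proj2 q)) \<longleftrightarrow> x \<noteq> 0 \<and> q $ 1 * x $ 1 + q $ 2 * x $ 2 + x $ 3 = 0"
proof -
  obtain c where c: "c \<noteq> 0" "rep_proj2 (abs_proj2 q) = c *s q" by (rule rep_abs_proj2[OF q_nonzero])
  have "dual_form (abs_proj2 q) x = c * (q $ 1 * x $ 1 + q $ 2 * x $ 2 + x $ 3)"
    by (simp add: dual_form_def c(2) sum_3 q3 algebra_simps)
  then show ?thesis using c(1) by (simp add: cone_dual_line)
qed

text \<open>Where \<open>f\<close> is nonzero this is Euler's relation. At a point of the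
  arrangement exactly one linear factor vanishes, since the line avoids multiple points, and the
  derivative in a direction transversal to that factor is a product of nonzero numbers.\<close>

lemma grad_nonzero_on_line:
  assumes x: "x \<in> cone (dual_line (abs_proj2 q))"
  shows "(\<exists>i. pderiv3 i f x \<noteq> 0) \<or> (\<forall>i. pderiv3 i f = (\<lambda>_. 0))"
proof (cases "d = 0")
  case True
  then have "Z = {}" using finZ cardZ by auto
  then have "pderiv3 i f = (\<lambda>_. 0)" for i
    by (intro ext, subst grad_eq) simp
  then show ?thesis by blast
next
  case False
  show ?thesis
  proof (cases "f x = 0")
    case True
    then obtain p where p: "p \<in> Z" "dual_form p x = 0" using finZ by (auto simp: arr_poly_def)
    have nz: "dual_form p' x \<noteq> 0" if "p' \<in> Z - {p}" for p'
    proof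
      assume "dual_form p' x = 0"
      then have "x = 0" using good_q p that x unfolding good_point_def
        by (auto simp: in_line sum_3 q3)
      then show False using x cone_nonzero by blast
    qed
    obtain k where k: "rep_proj2 p $ k \<noteq> 0" using rep_proj2_nonzero[of p] by (metis vec_eq_iff zero_index)
    have dk: "dual_form p (axis k 1) = rep_proj2 p $ k"
    proof -
      have "dual_form p (axis k 1) = (\<Sum>i\<in>UNIV. if i = k then rep_proj2 p $ k else 0)"
        unfolding dual_form_def by (intro sum.cong) (auto simp: axis_def)
      then show ?thesis by simp
    qed
    have "(\<Sum>i\<in>UNIV. axis k 1 $ i * pderiv3 i f x) \<noteq> 0"
      unfolding dot_grad_on_line[OF p] dk using k nz finZ by simp
    then have "\<exists>i. pderiv3 i f x \<noteq> 0" by (metis (no_types, lifting) mult_zero_right sum.neutral)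
    then show ?thesis ..
  next
    case False
    then have "(\<Sum>i\<in>UNIV. x $ i * pderiv3 i f x) \<noteq> 0" unfolding euler using \<open>d \<noteq> 0\<close> by simp
    then have "\<exists>i. pderiv3 i f x \<noteq> 0" by (metis (no_types, lifting) mult_zero_right sum.neutral)
    then show ?thesis ..
  qed
qed

abbreviation u where "u \<equiv> base_pt q"
abbreviation v where "v \<equiv> dir_pt q"

lemma ex_parametrized:
  "\<exists>\<Phi>. parametrized_line_splitting f d (abs_proj2 q) a b \<Phi> u (v \<kappa>) (\<lambda>x. - x $ 1 - \<kappa> * x $ 2) (\<lambda>x. x $ 2)"
proof -
  obtain \<Phi> where "\<forall>U. zariski_open U \<longrightarrow>
           (\<forall>\<rho>\<in>syz_sheaf f U. \<Phi> U \<rho> \<in> split_sheaf (dual_line (abs_proj2 q)) a b U) \<and>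
           (\<forall>\<rho>\<in>syz_sheaf f U. \<forall>\<sigma>\<in>syz_sheaf f U.
              \<Phi> U (\<lambda>v. \<rho> v + \<sigma> v) = (\<lambda>v. \<Phi> U \<rho> v + \<Phi> U \<sigma> v)) \<and>
           (\<forall>g\<in>twist UNIV 0 U. \<forall>\<rho>\<in>syz_sheaf f U.
              \<Phi> U (\<lambda>v. g v *s \<rho> v) = (\<lambda>v. g v *s \<Phi> U \<rho> v)) \<and>
           (\<forall>V \<rho>. zariski_open V \<and> V \<subseteq> U \<and> \<rho> \<in> syz_sheaf f U \<longrightarrow>
              \<Phi> V (restr V \<rho>) = restr V (\<Phi> U \<rho>)) \<and>
           (\<forall>\<rho>\<in>syz_sheaf f U. \<Phi> U \<rho> = (\<lambda>v. 0) \<longleftrightarrow> \<rho> \<in> ideal_syz_sheaf f (dual_line (abs_proj2 q)) U) \<and>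
           (\<forall>s\<in>split_sheaf (dual_line (abs_proj2 q)) a b U. \<forall>p\<in>U. \<exists>V \<rho>. zariski_open V \<and> p \<in> V \<and> V \<subseteq> U \<and>
              \<rho> \<in> syz_sheaf f V \<and> \<Phi> V \<rho> = restr V s)"
    using splits unfolding restriction_splits_def by (rule exE)
  note \<Phi> = mp[OF spec[OF this]]
  have "parametrized_line_splitting f d (abs_proj2 q) a b \<Phi> u (v \<kappa>) (\<lambda>x. - x $ 1 - \<kappa> * x $ 2) (\<lambda>x. x $ 2)"
  proof (unfold_locales, goal_cases)
    case 1 show ?case by (rule hpoly_f)
  next
    case 2 then show ?case by (rule grad_nonzero_on_line)
  next
    case 3 show ?case by (rule bspec[OF conjunct1[OF \<Phi>[OF 3(1)]] 3(2)])
  next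
    case 4 show ?case by (rule bspec[OF bspec[OF conjunct1[OF conjunct2[OF \<Phi>[OF 4(1)]]] 4(2)] 4(3)])
  next
    case 5 show ?case by (rule bspec[OF bspec[OF conjunct1[OF conjunct2[OF conjunct2[OF \<Phi>[OF 5(1)]]]] 5(2)] 5(3)])
  next
    case 6 then show ?case using conjunct1[OF conjunct2[OF conjunct2[OF conjunct2[OF \<Phi>[OF 6(1)]]]]] by simp
  next
    case 7 show ?case by (rule bspec[OF conjunct1[OF conjunct2[OF conjunct2[OF conjunct2[OF conjunct2[OF \<Phi>[OF 7(1)]]]]]] 7(2)])
  next
    case 8 show ?case by (rule bspec[OF bspec[OF conjunct2[OF conjunct2[OF conjunct2[OF conjunct2[OF conjunct2[OF \<Phi>[OF 8(1)]]]]]] 8(2)] 8(3)])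
  next
    case (9 w r)
    have "w *s u + r *s v \<kappa> \<noteq> 0"
    proof
      assume z: "w *s u + r *s v \<kappa> = 0"
      have "r = 0" using line_pt_components(2)[of w q r \<kappa>] unfolding z by simp
      moreover have "w = 0" using line_pt_components(1)[of w q r \<kappa>] \<open>r = 0\<close> unfolding z by simp
      ultimately show False using 9 by simp
    qed
    then show ?case unfolding in_line by (simp add: base_pt_def dir_pt_def algebra_simps)
  next
    case (10 x)
    then have e: "q $ 1 * x $ 1 + q $ 2 * x $ 2 + x $ 3 = 0" by (simp add: in_line)
    have "x $ 3 = (q $ 1 * x $ 1 + q $ 2 * x $ 2 + x $ 3) - q $ 1 * x $ 1 - q $ 2 * x $ 2" by simp
    also have "\<dots> = - q $ 1 * x $ 1 - q $ 2 * x $ 2" unfolding e by simp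
    finally have x3: "x $ 3 = - q $ 1 * x $ 1 - q $ 2 * x $ 2" .
    show ?case by (simp add: vec_eq_iff forall_3 base_pt_def dir_pt_def x3 algebra_simps)
  next
    case 11
    show ?case using hpoly_diff[OF hpoly_minus[OF hpoly_coord] hpoly_cmult[OF hpoly_coord]] by simp
  next
    case 12 show ?case by (rule hpoly_coord)
  next
    case (13 w r) show ?case by (simp add: base_pt_def dir_pt_def)
  next
    case (14 w r) show ?case by (simp add: base_pt_def dir_pt_def)
  qed
  then show ?thesis by (intro exI[of _ \<Phi>])
qed

lemma a_nonneg: "0 \<le> a"
  using ex_parametrized[of 0] parametrized_line_splitting.a_nonneg by blast

lemma line_syz_dependent:
  fixes x :: "'j \<Rightarrow> complex poly^3"
  assumes "finite J" "nat (int k + 1 - a) + nat (int k + 1 - b) < card J"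
    and "\<And>l. l \<in> J \<Longrightarrow> x l \<in> line_syz f u (v \<kappa>) k"
  shows "\<exists>c. (\<exists>l\<in>J. c l \<noteq> 0) \<and> (\<Sum>l\<in>J. [:c l:] *s x l) = 0"
proof -
  obtain \<Phi> where "parametrized_line_splitting f d (abs_proj2 q) a b \<Phi> u (v \<kappa>) (\<lambda>x. - x $ 1 - \<kappa> * x $ 2) (\<lambda>x. x $ 2)"
    using ex_parametrized by blast
  then show ?thesis using parametrized_line_splitting.line_syz_dependent assms by blast
qed

lemma line_syz_independent:
  "\<exists>(J :: (2 \<times> nat) set) x. finite J \<and> card J = nat (int k + 1 - a) + nat (int k + 1 - b) \<and>
    (\<forall>l\<in>J. x l \<in> line_syz f u (v \<kappa>) k) \<and>
    (\<forall>c. (\<Sum>l\<in>J. [:c l:] *s x l) = 0 \<longrightarrow> (\<forall>l\<in>J. c l = 0))"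
proof -
  obtain \<Phi> where P: "parametrized_line_splitting f d (abs_proj2 q) a b \<Phi> u (v \<kappa>) (\<lambda>x. - x $ 1 - \<kappa> * x $ 2) (\<lambda>x. x $ 2)"
    using ex_parametrized by blast
  show ?thesis
    using parametrized_line_splitting.line_syz_independent[OF P, of k]
      parametrized_line_splitting.finite_card_index[OF P, of k] by blast
qed

end

section \<open>The splitting type on a good line has sum d - 1\<close>

lemma linear_factors_dvd:
  fixes P :: "complex poly"
  assumes "finite S" "inj_on \<tau> S" "\<And>p. p \<in> S \<Longrightarrow> poly P (\<tau> p) = 0"
  shows "(\<Prod>p\<in>S. [:- \<tau> p, 1:]) dvd P"
  using assms
proof (induction S arbitrary: P rule: finite_induct)
  case (insert p S)
  have "[:- \<tau> p, 1:] dvd P" using insert.prems(2) by (simp add: poly_eq_0_iff_dvd)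
  then obtain Q where Q: "P = [:- \<tau> p, 1:] * Q" by (auto simp: dvd_def)
  have "(\<Prod>p\<in>S. [:- \<tau> p, 1:]) dvd Q"
  proof (rule insert.IH)
    show "inj_on \<tau> S" using insert.prems(1) by simp
    fix p' assume p': "p' \<in> S"
    then have "poly P (\<tau> p') = 0" using insert.prems(2) by simp
    moreover have "\<tau> p' \<noteq> \<tau> p" using insert.prems(1) insert.hyps p' by (auto simp: inj_on_def)
    ultimately show "poly Q (\<tau> p') = 0" unfolding Q by simp
  qed
  then show ?case unfolding Q prod.insert[OF insert.hyps] by (intro mult_dvd_mono) simp_all
qed simp

lemma dual_form_add_scale: "dual_form p (x + t *s y) = dual_form p x + t * dual_form p y"
  by (simp add: dual_form_def distrib_left sum.distrib sum_distrib_left mult_ac)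

lemma ex_dual_form_eq_1: "\<exists>e. dual_form p e = 1"
proof -
  obtain k where k: "rep_proj2 p $ k \<noteq> 0" using rep_proj2_nonzero[of p] by (metis vec_eq_iff zero_index)
  have "dual_form p (axis k (1 / rep_proj2 p $ k)) = (\<Sum>i\<in>UNIV. if i = k then 1 else 0)"
    unfolding dual_form_def using k by (intro sum.cong) (auto simp: axis_def)
  then show ?thesis by auto
qed

context good_line
begin

lemma line_pt_nonzero: "u + t *s v \<kappa> \<noteq> 0"
proof
  assume z: "u + t *s v \<kappa> = 0"
  have "t = 0" using line_pt_components(2)[of 1 q t \<kappa>] z by simp
  then show False using line_pt_components(1)[of 1 q t \<kappa>] z by simp
qed

lemma line_pt_in_line: "u + t *s v \<kappa> \<in> cone (dual_line (abs_proj2 q))"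
  unfolding in_line using line_pt_nonzero by (simp add: base_pt_def dir_pt_def algebra_simps)

lemma grad_poly:
  "\<exists>\<gamma>. \<forall>i. degree (\<gamma> i) \<le> d - 1 \<and> (\<forall>t. pderiv3 i f (u + t *s v \<kappa>) = poly (\<gamma> i) t) \<and> (d = 0 \<longrightarrow> \<gamma> i = 0)"
proof -
  have "\<exists>g. degree g \<le> d - 1 \<and> (\<forall>t. pderiv3 i f (u + t *s v \<kappa>) = poly g t) \<and> (d = 0 \<longrightarrow> g = 0)" for i
  proof (cases "d = 0")
    case True
    then have "Z = {}" using finZ cardZ by auto
    then have "pderiv3 i f x = 0" for x by (subst grad_eq) simp
    then show ?thesis by (intro exI[of _ 0]) simp
  next
    case False
    then show ?thesis using hpoly_line_poly[OF hpoly_grad, of i u "v \<kappa>"] by simp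
  qed
  then show ?thesis by metis
qed

lemma line_syz_iff:
  assumes "\<And>i t. pderiv3 i f (u + t *s v \<kappa>) = poly (\<gamma> i) t"
  shows "R \<in> line_syz f u (v \<kappa>) k \<longleftrightarrow> (\<forall>i. degree (R $ i) \<le> k) \<and> (\<Sum>i\<in>UNIV. R $ i * \<gamma> i) = 0"
proof -
  have "(\<forall>t. (\<Sum>i\<in>UNIV. poly (R $ i) t * pderiv3 i f (u + t *s v \<kappa>)) = 0) \<longleftrightarrow>
     (\<forall>t. poly (\<Sum>i\<in>UNIV. R $ i * \<gamma> i) t = 0)"
    by (simp add: assms poly_sum)
  also have "\<dots> \<longleftrightarrow> (\<Sum>i\<in>UNIV. R $ i * \<gamma> i) = 0" by (rule poly_all_0_iff_0)
  finally show ?thesis by (simp add: line_syz_def)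
qed

lemma line_syz_degree_ge:
  assumes "R \<in> line_syz f u (v \<kappa>) r" "R \<noteq> 0"
  shows "a \<le> int r"
proof (rule ccontr)
  assume "\<not> a \<le> int r"
  then have "nat (int r + 1 - a) + nat (int r + 1 - b) < card {0::nat}" using ab by simp
  from line_syz_dependent[OF _ this, of "\<lambda>_. R" \<kappa>] assms(1)
  obtain c where "c \<noteq> 0" "[:c:] *s R = 0" by auto
  then have "R $ i = 0" for i by (metis vector_smult_component mult_eq_0_iff pCons_eq_0_iff zero_index)
  then show False using assms(2) by (simp add: vec_eq_iff)
qed

text \<open>Pairing with the gradient maps a space of dimension \<open>3 * (k + 1)\<close> to
  polynomials of degree below \<open>k + d\<close>, so at least \<open>2 * k + 3 - d\<close>
  independent syzygies of degree \<open>k\<close> exist. For \<open>k\<close> beyond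
  \<open>a\<close> and \<open>b\<close> their number is \<open>2 * k + 2 - a - b\<close>.\<close>

lemma sum_le: "a + b \<le> int d - 1"
proof (rule ccontr)
  assume "\<not> a + b \<le> int d - 1"
  then have big: "int d \<le> a + b" by simp
  define k where "k = nat (a + b) + d"
  have k: "a \<le> int k" "b \<le> int k" "d \<le> k" using a_nonneg ab by (auto simp: k_def)
  define n where "n = 2 * k + 3 - d"
  obtain \<gamma> where \<gamma>: "\<And>i. degree (\<gamma> i) \<le> d - 1" "\<And>i t. pderiv3 i f (u + t *s v 0) = poly (\<gamma> i) t"
    "\<And>i. d = 0 \<Longrightarrow> \<gamma> i = 0" using grad_poly[of 0] by metis
  define J :: "(3 \<times> nat) set" where "J = UNIV \<times> {..k}"
  define c where "c j m = coeff (monom 1 (snd j) * \<gamma> (fst j)) m" for j m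
  have "card {..<k + d} + n \<le> card J" using k by (simp add: J_def n_def card_cartesian_product)
  then obtain x where x: "\<forall>l<n. \<forall>i\<in>{..<k + d}. (\<Sum>j\<in>J. x l j * c j i) = 0"
    "\<forall>a. (\<forall>j\<in>J. (\<Sum>l<n. a l * x l j) = 0) \<longrightarrow> (\<forall>l<n. a l = 0)"
    using kernel_independent_family[of "{..<k + d}" J n c] by (auto simp: J_def)
  define R :: "nat \<Rightarrow> complex poly^3" where "R l = (\<chi> i. \<Sum>m\<le>k. monom (x l (i, m)) m)" for l
  have coeffR: "coeff (R l $ i) m = (if m \<le> k then x l (i, m) else 0)" for l i m
    by (auto simp: R_def coeff_sum)
  have degR: "degree (R l $ i) \<le> k" for l i
    by (rule degree_le) (simp add: coeffR)
  have "R l \<in> line_syz f u (v 0) k" if l: "l < n" for l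
    unfolding line_syz_iff[OF \<gamma>(2)]
  proof (intro conjI allI degR poly_eqI)
    fix m
    show "coeff (\<Sum>i\<in>UNIV. R l $ i * \<gamma> i) m = coeff 0 m"
    proof (cases "m < k + d")
      case True
      have "coeff (\<Sum>i\<in>UNIV. R l $ i * \<gamma> i) m = (\<Sum>i\<in>UNIV. \<Sum>n\<le>k. x l (i, n) * c (i, n) m)"
      proof -
        have "R l $ i * \<gamma> i = (\<Sum>n\<le>k. smult (x l (i, n)) (monom 1 n * \<gamma> i))" for i
          by (simp add: R_def sum_distrib_right smult_monom flip: mult_smult_left)
        then show ?thesis by (simp add: coeff_sum c_def)
      qed
      also have "\<dots> = (\<Sum>j\<in>J. x l j * c j m)"
        unfolding J_def by (simp add: sum.cartesian_product)
      finally show ?thesis using x(1) l True by simp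
    next
      case False
      \<comment> \<open>For \<open>d = 0\<close> the truncated bound \<open>d - 1\<close> is too
        weak; there the gradient is zero instead.\<close>
      have "coeff (R l $ i * \<gamma> i) m = 0" for i
      proof (cases "d = 0")
        case True then show ?thesis using \<gamma>(3) by simp
      next
        case d: False
        have "degree (R l $ i * \<gamma> i) \<le> k + (d - 1)"
          using degree_mult_le[of "R l $ i" "\<gamma> i"] degR[of l i] \<gamma>(1)[of i] by linarith
        then show ?thesis using False d by (intro coeff_eq_0) linarith
      qed
      then show ?thesis by (simp add: coeff_sum)
    qed
  qed
  moreover have "nat (int k + 1 - a) + nat (int k + 1 - b) < card {..<n}"
    using big k by (simp add: n_def)
  ultimately obtain w where w: "\<exists>l\<in>{..<n}. w l \<noteq> 0" "(\<Sum>l<n. [:w l:] *s R l) = 0"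
    using line_syz_dependent[of "{..<n}" k R 0] by auto
  have "(\<Sum>l<n. w l * x l j) = 0" if "j \<in> J" for j
  proof -
    have "coeff ((\<Sum>l<n. [:w l:] *s R l) $ fst j) (snd j) = 0" unfolding w(2) by simp
    then show ?thesis using that by (auto simp: coeff_sum coeffR J_def)
  qed
  then show False using x(2) w(1) by blast
qed

text \<open>For the empty arrangement E is O^3, of rank 3, and cannot split into two line bundles;
  in this setting the inequality for \<open>a + b\<close> already excludes it.\<close>

lemma d_pos: "0 < d"
  using sum_le a_nonneg ab by linarith

text \<open>Each line of the arrangement differs from the line dual to \<open>q\<close>, so it
  excludes at most one value of \<open>\<kappa>\<close>.\<close>

lemma ex_transverse: "\<exists>\<kappa>. \<forall>p\<in>Z. dual_form p (v \<kappa>) \<noteq> 0"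
proof -
  define W where "W p = rep_proj2 p $ 2 - rep_proj2 p $ 3 * q $ 2" for p
  define r where "r p = rep_proj2 p $ 1 - rep_proj2 p $ 3 * q $ 1" for p
  have df: "dual_form p (v \<kappa>) = W p - \<kappa> * r p" for p \<kappa>
    by (simp add: dual_form_def sum_3 dir_pt_def W_def r_def algebra_simps)
  have nz: "W p \<noteq> 0 \<or> r p \<noteq> 0" if p: "p \<in> Z" for p
  proof (rule ccontr)
    assume "\<not> (W p \<noteq> 0 \<or> r p \<noteq> 0)"
    then have z: "rep_proj2 p $ i = rep_proj2 p $ 3 * q $ i" for i
      using exhaust_3[of i] by (auto simp: W_def r_def q3)
    obtain y where y: "dual_form p y = 0" "(\<Sum>i\<in>UNIV. q $ i * y $ i) \<noteq> 0"
      using good_q p unfolding good_point_def by blast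
    have "dual_form p y = (\<Sum>i\<in>UNIV. rep_proj2 p $ 3 * (q $ i * y $ i))"
      unfolding dual_form_def by (intro sum.cong refl) (subst z, simp only: mult.assoc)
    then have "rep_proj2 p $ 3 = 0" using y by (simp add: sum_distrib_left[symmetric])
    then have "rep_proj2 p $ i = 0" for i by (subst z) simp
    then have "rep_proj2 p = 0" by (simp add: vec_eq_iff)
    then show False by simp
  qed
  obtain \<kappa> where \<kappa>: "\<kappa> \<notin> (\<lambda>p. W p / r p) ` Z"
    using ex_new_if_finite[OF infinite_UNIV_char_0, of "(\<lambda>p. W p / r p) ` Z"] finZ by auto
  have "dual_form p (v \<kappa>) \<noteq> 0" if p: "p \<in> Z" for p
  proof
    assume "dual_form p (v \<kappa>) = 0"
    then have e: "W p = \<kappa> * r p" by (simp add: df)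
    then have "r p \<noteq> 0" using nz[OF p] by auto
    then have "\<kappa> = W p / r p" using e by simp
    then show False using \<kappa> p by blast
  qed
  then show ?thesis by blast
qed

text \<open>The parameter of the point where the line dual to \<open>p\<close> meets the given line;
  finite as soon as \<open>v \<kappa>\<close> is not on that dual line.\<close>

definition node :: "complex \<Rightarrow> proj2 \<Rightarrow> complex" where
  "node \<kappa> p = - dual_form p u / dual_form p (v \<kappa>)"

lemma node_eval:
  "dual_form p (v \<kappa>) \<noteq> 0 \<Longrightarrow> dual_form p (u + t *s v \<kappa>) = dual_form p (v \<kappa>) * (t - node \<kappa> p)"
  by (simp add: dual_form_add_scale node_def distrib_left)

lemma inj_node:
  assumes "\<forall>p\<in>Z. dual_form p (v \<kappa>) \<noteq> 0"
  shows "inj_on (node \<kappa>) Z"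
proof (rule inj_onI, rule ccontr)
  fix p p' assume p: "p \<in> Z" "p' \<in> Z" "node \<kappa> p = node \<kappa> p'" "p \<noteq> p'"
  define x where "x = u + node \<kappa> p *s v \<kappa>"
  have "dual_form p x = 0" "dual_form p' x = 0"
    using node_eval assms p unfolding x_def by auto
  moreover have "(\<Sum>i\<in>UNIV. q $ i * x $ i) = 0"
    using line_pt_in_line[of "node \<kappa> p" \<kappa>] by (simp add: in_line x_def sum_3 q3)
  ultimately have "x = 0" using good_q p unfolding good_point_def by blast
  then show False using line_pt_nonzero by (simp add: x_def)
qed

lemma f_on_line:
  assumes "\<forall>p\<in>Z. dual_form p (v \<kappa>) \<noteq> 0"
  shows "f (u + t *s v \<kappa>) = (\<Prod>p\<in>Z. dual_form p (v \<kappa>)) * poly (\<Prod>p\<in>Z. [:- node \<kappa> p, 1:]) t"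
  using assms by (simp add: arr_poly_def node_eval poly_prod prod.distrib)

text \<open>This is the vanishing of H^1 of E on the line in high degree, made explicit. Prescribed
  values at the \<open>d\<close> nodes are attained by interpolation with a vector \<open>R\<close>,
  since the gradient is nonzero there. What remains is divisible by the product of the node factors,
  that is, by \<open>f\<close> along the line, and such multiples are reached by the position vector
  through Euler's relation.\<close>

lemma grad_mult_surj:
  assumes \<kappa>: "\<forall>p\<in>Z. dual_form p (v \<kappa>) \<noteq> 0"
    and \<gamma>: "\<And>i. degree (\<gamma> i) \<le> d - 1" "\<And>i t. pderiv3 i f (u + t *s v \<kappa>) = poly (\<gamma> i) t"
    and T: "degree T < k + d" "d \<le> k"
  shows "\<exists>E :: complex poly^3. (\<forall>i. degree (E $ i) \<le> k) \<and> (\<Sum>i\<in>UNIV. E $ i * \<gamma> i) = T"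
proof -
  define \<tau> where "\<tau> = node \<kappa>"
  have inj: "inj_on \<tau> Z" unfolding \<tau>_def by (rule inj_node[OF \<kappa>])
  define X where "X t = u + t *s v \<kappa>" for t
  have dfX: "dual_form p (X t) = dual_form p (v \<kappa>) * (t - \<tau> p)" if "p \<in> Z" for p t
    unfolding X_def \<tau>_def using \<kappa> that by (simp add: node_eval)
  obtain e where e: "\<And>p. dual_form p (e p) = 1" using ex_dual_form_eq_1 by metis
  define M where "M S = (\<Prod>p\<in>S. [:- \<tau> p, 1:])" for S
  have degM: "degree (M S) = card S" for S
    unfolding M_def by (subst degree_prod_eq_sum_degree) auto
  have M0: "M S \<noteq> 0" if "finite S" for S unfolding M_def using that by (simp add: prod_zero_iff)
  \<comment> \<open>The vector \<open>M (Z - {p})\<close> times \<open>e p\<close>, paired with the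
    gradient, takes the value \<open>D p\<close> at the node of \<open>p\<close> and 0 at all other
    nodes; hence the coefficient \<open>c p\<close> below.\<close>
  define D where "D p = poly (M (Z - {p})) (\<tau> p) * (\<Prod>p'\<in>Z - {p}. dual_form p' (X (\<tau> p)))" for p
  have D: "D p \<noteq> 0" if p: "p \<in> Z" for p
  proof -
    have "\<tau> p - \<tau> p' \<noteq> 0" if "p' \<in> Z - {p}" for p' using inj p that by (auto simp: inj_on_def)
    then show ?thesis using finZ \<kappa> p by (auto simp: D_def M_def poly_prod dfX)
  qed
  define c where "c p = poly T (\<tau> p) / D p" for p
  define R :: "complex poly^3" where "R = (\<chi> i. \<Sum>p\<in>Z. smult (c p * e p $ i) (M (Z - {p})))"
  have degR: "degree (R $ i) \<le> d - 1" for i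
    unfolding R_def using finZ cardZ
    by (auto intro!: degree_sum_le order_trans[OF degree_smult_le] simp: degM)
  have at_node: "poly (\<Sum>i\<in>UNIV. R $ i * \<gamma> i) (\<tau> p) = poly T (\<tau> p)" if p: "p \<in> Z" for p
  proof -
    have "poly (M (Z - {p'})) (\<tau> p) = 0" if "p' \<noteq> p" for p'
      using p that finZ by (auto simp: M_def poly_prod intro!: bexI[of _ p])
    then have "poly (R $ i) (\<tau> p) = (\<Sum>p'\<in>Z. if p' = p then c p * e p $ i * poly (M (Z - {p})) (\<tau> p) else 0)" for i
      unfolding R_def by (auto simp: poly_sum intro!: sum.cong)
    then have Rp: "poly (R $ i) (\<tau> p) = ((c p * poly (M (Z - {p})) (\<tau> p)) *s e p) $ i" for i
      using p finZ by simp
    have "poly (\<Sum>i\<in>UNIV. R $ i * \<gamma> i) (\<tau> p) = (\<Sum>i\<in>UNIV. ((c p * poly (M (Z - {p})) (\<tau> p)) *s e p) $ i * pderiv3 i f (X (\<tau> p)))"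
      by (simp only: poly_sum poly_mult Rp X_def \<gamma>(2))
    also have "\<dots> = c p * D p"
      by (subst dot_grad_on_line[OF p]) (use dfX[OF p] e in \<open>simp_all add: dual_form_scale D_def\<close>)
    finally show ?thesis using D[OF p] by (simp add: c_def)
  qed
  have "M Z dvd T - (\<Sum>i\<in>UNIV. R $ i * \<gamma> i)"
    unfolding M_def by (rule linear_factors_dvd[OF finZ inj]) (simp add: at_node)
  then obtain G where G: "T - (\<Sum>i\<in>UNIV. R $ i * \<gamma> i) = M Z * G" by (auto simp: dvd_def)
  have dpos: "0 < d" by (rule d_pos)
  have degRg: "degree (\<Sum>i\<in>UNIV. R $ i * \<gamma> i) \<le> k + d - 1"
  proof (rule degree_sum_le)
    fix i :: 3
    show "degree (R $ i * \<gamma> i) \<le> k + d - 1"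
      using degree_mult_le[of "R $ i" "\<gamma> i"] degR[of i] \<gamma>(1)[of i] T(2) dpos by linarith
  qed simp
  \<comment> \<open>The strict bound matters because \<open>G\<close> is going to be multiplied by
    the linear polynomials of the position vector.\<close>
  have degG: "G = 0 \<or> degree G < k"
  proof (cases "G = 0")
    case False
    have "degree (M Z * G) = d + degree G"
      using False M0[OF finZ] by (simp add: degree_mult_eq degM cardZ)
    moreover have "degree (M Z * G) \<le> k + d - 1"
      unfolding G[symmetric] using T(1) degRg dpos by (intro degree_diff_le) auto
    ultimately show ?thesis using dpos by linarith
  qed simp
  define C where "C = of_nat d * (\<Prod>p\<in>Z. dual_form p (v \<kappa>))"
  have C: "C \<noteq> 0" using dpos \<kappa> finZ by (simp add: C_def)
  define E :: "complex poly^3" where "E = (\<chi> i. R $ i + smult (1 / C) (G * [:u $ i, v \<kappa> $ i:]))"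
  have "degree (E $ i) \<le> k" for i
  proof -
    have "degree (G * [:u $ i, v \<kappa> $ i:]) \<le> k"
    proof (cases "G = 0")
      case False
      have "degree (G * [:u $ i, v \<kappa> $ i:]) \<le> degree G + 1"
        by (rule order_trans[OF degree_mult_le]) auto
      then show ?thesis using degG False by linarith
    qed simp
    moreover have "degree (R $ i) \<le> k" using degR[of i] T(2) by linarith
    ultimately show ?thesis
      by (auto simp: E_def intro!: degree_add_le order_trans[OF degree_smult_le])
  qed
  moreover have "(\<Sum>i\<in>UNIV. E $ i * \<gamma> i) = T"
  proof -
    have "poly (\<Sum>i\<in>UNIV. [:u $ i, v \<kappa> $ i:] * \<gamma> i) t = poly (smult C (M Z)) t" for t
    proof -
      have "poly (\<Sum>i\<in>UNIV. [:u $ i, v \<kappa> $ i:] * \<gamma> i) t = (\<Sum>i\<in>UNIV. X t $ i * pderiv3 i f (X t))"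
        by (simp add: poly_sum X_def \<gamma>(2) algebra_simps)
      also have "\<dots> = of_nat d * f (X t)" by (rule euler)
      also have "\<dots> = poly (smult C (M Z)) t"
        unfolding X_def f_on_line[OF \<kappa>] by (simp add: C_def M_def \<tau>_def)
      finally show ?thesis .
    qed
    then have XM: "(\<Sum>i\<in>UNIV. [:u $ i, v \<kappa> $ i:] * \<gamma> i) = smult C (M Z)"
      by (simp add: poly_eq_poly_eq_iff[symmetric] fun_eq_iff)
    have "(\<Sum>i\<in>UNIV. E $ i * \<gamma> i) = (\<Sum>i\<in>UNIV. R $ i * \<gamma> i) + smult (1 / C) (G * (\<Sum>i\<in>UNIV. [:u $ i, v \<kappa> $ i:] * \<gamma> i))"
      by (simp add: E_def sum_3 distrib_left distrib_right smult_add_right mult.assoc del: mult_pCons_left mult_pCons_right)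
    also have "\<dots> = (\<Sum>i\<in>UNIV. R $ i * \<gamma> i) + M Z * G" unfolding XM using C by (simp add: mult.commute)
    also have "\<dots> = T" using G by (simp add: algebra_simps)
    finally show ?thesis .
  qed
  ultimately show ?thesis by blast
qed

text \<open>If \<open>a + b\<close> were smaller, the syzygies of degree \<open>k\<close> together
  with preimages of all monomials below degree \<open>k + d\<close> would number more than
  \<open>3 * (k + 1)\<close>, the dimension of the space that contains them. Yet they are
  independent.\<close>

lemma sum_ge: "int d - 1 \<le> a + b"
proof (rule ccontr)
  assume "\<not> int d - 1 \<le> a + b"
  then have small: "a + b \<le> int d - 2" by simp
  define k where "k = nat (a + b) + d"
  have k: "a \<le> int k" "b \<le> int k" "d \<le> k" using a_nonneg ab by (auto simp: k_def)
  obtain \<kappa> where \<kappa>: "\<forall>p\<in>Z. dual_form p (v \<kappa>) \<noteq> 0" using ex_transverse by blast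
  obtain \<gamma> where \<gamma>: "\<And>i. degree (\<gamma> i) \<le> d - 1" "\<And>i t. pderiv3 i f (u + t *s v \<kappa>) = poly (\<gamma> i) t"
    using grad_poly[of \<kappa>] by metis
  have "\<exists>E :: complex poly^3. (\<forall>i. degree (E $ i) \<le> k) \<and> (\<Sum>i\<in>UNIV. E $ i * \<gamma> i) = monom 1 m" if "m < k + d" for m
    by (rule grad_mult_surj[OF \<kappa> \<gamma>]) (use that k in \<open>simp_all add: degree_monom_eq\<close>)
  then obtain E :: "nat \<Rightarrow> complex poly^3" where E: "\<And>m i. m < k + d \<Longrightarrow> degree (E m $ i) \<le> k"
    "\<And>m. m < k + d \<Longrightarrow> (\<Sum>i\<in>UNIV. E m $ i * \<gamma> i) = monom 1 m" by metis
  obtain J :: "(2 \<times> nat) set" and x where J: "finite J" "card J = nat (int k + 1 - a) + nat (int k + 1 - b)"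
    "\<And>l. l \<in> J \<Longrightarrow> x l \<in> line_syz f u (v \<kappa>) k"
    "\<And>c. (\<Sum>l\<in>J. [:c l:] *s x l) = 0 \<Longrightarrow> \<forall>l\<in>J. c l = 0"
    using line_syz_independent[of k \<kappa>] by blast
  define y where "y l = (case l of Inl l \<Rightarrow> x l | Inr m \<Rightarrow> E m)" for l
  define I :: "(3 \<times> nat) set" where "I = UNIV \<times> {..k}"
  have "card I < card (J <+> {..<k + d})"
    using J(1,2) small k by (simp add: I_def card_cartesian_product card_Plus)
  then obtain w where w: "\<exists>l\<in>J <+> {..<k + d}. w l \<noteq> 0"
     "\<forall>im\<in>I. (\<Sum>l\<in>J <+> {..<k + d}. w l * coeff (y l $ fst im) (snd im)) = 0"
    using homogeneous_system_nontrivial[of I "J <+> {..<k + d}" "\<lambda>l im. coeff (y l $ fst im) (snd im)"] J(1)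
    by (auto simp: I_def)
  have degy: "degree (y l $ i) \<le> k" if "l \<in> J <+> {..<k + d}" for l i
    using that J(3) E(1) by (auto simp: y_def line_syz_def)
  have "coeff (\<Sum>l\<in>J <+> {..<k + d}. smult (w l) (y l $ i)) m = 0" for i m
  proof (cases "m \<le> k")
    case True
    then have "(i, m) \<in> I" by (simp add: I_def)
    then show ?thesis using w(2) by (auto simp: coeff_sum)
  next
    case False
    then have "coeff (y l $ i) m = 0" if "l \<in> J <+> {..<k + d}" for l
      using degy[OF that, of i] by (intro coeff_eq_0) linarith
    then show ?thesis by (simp add: coeff_sum)
  qed
  then have zero: "(\<Sum>l\<in>J <+> {..<k + d}. smult (w l) (y l $ i)) = 0" for i by (simp add: poly_eq_iff)
  have xg: "(\<Sum>i\<in>UNIV. x l $ i * \<gamma> i) = 0" if "l \<in> J" for l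
    using J(3)[OF that] unfolding line_syz_iff[OF \<gamma>(2)] by blast
  \<comment> \<open>Pairing the relation with the gradient kills the syzygies and turns each
    \<open>E m\<close> into a monomial. So the coefficients of the \<open>E m\<close> vanish first,
    and then those of the independent syzygies.\<close>
  have "0 = (\<Sum>i\<in>UNIV. (\<Sum>l\<in>J <+> {..<k + d}. smult (w l) (y l $ i)) * \<gamma> i)" using zero by simp
  also have "\<dots> = (\<Sum>l\<in>J <+> {..<k + d}. smult (w l) (\<Sum>i\<in>UNIV. y l $ i * \<gamma> i))"
    by (simp add: sum_3 sum.distrib sum_distrib_right smult_add_right)
  also have "\<dots> = (\<Sum>m<k + d. smult (w (Inr m)) (monom 1 m))"
    using J(1) xg E(2) by (simp add: sum.Plus y_def)
  finally have mon: "(\<Sum>m<k + d. monom (w (Inr m)) m) = 0" by (simp add: smult_monom)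
  have wr: "w (Inr m) = 0" if "m < k + d" for m
  proof -
    have "coeff (\<Sum>m<k + d. monom (w (Inr m)) m) m = 0" using mon by simp
    then show ?thesis using that by (simp add: coeff_sum)
  qed
  have "(\<Sum>l\<in>J. [:w (Inl l):] *s x l) = 0"
    using zero J(1) wr by (simp add: vec_eq_iff sum.Plus y_def)
  from J(4)[OF this] have "\<forall>l\<in>J. w (Inl l) = 0" .
  then show False using w(1) wr by auto
qed

lemma sum_eq: "a + b = int d - 1"
  using sum_le sum_ge by linarith

end

section \<open>Global sections of O(j) on the plane\<close>

lemma lagrange_basis:
  obtains \<beta> :: "nat \<Rightarrow> complex poly" where "\<And>m. m \<le> n \<Longrightarrow> degree (\<beta> m) \<le> n"
    "\<And>m m'. m \<le> n \<Longrightarrow> m' \<le> n \<Longrightarrow> poly (\<beta> m) (of_nat m') = (if m = m' then 1 else 0)"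
proof -
  define \<beta> :: "nat \<Rightarrow> complex poly"
    where "\<beta> m = (\<Prod>k\<in>{..n} - {m}. smult (1 / (of_nat m - of_nat k)) [:- of_nat k, 1:])" for m
  have "degree (\<beta> m) \<le> n" if "m \<le> n" for m
  proof -
    have "degree (\<beta> m) \<le> (\<Sum>k\<in>{..n} - {m}. degree (smult (1 / (of_nat m - of_nat k)) [:- of_nat k, 1 :: complex:]))"
      unfolding \<beta>_def by (rule order_trans[OF degree_prod_sum_le]) (simp_all only: o_def finite_Diff finite_atMost order_refl)
    also have "\<dots> \<le> (\<Sum>k\<in>{..n} - {m}. 1)"
      by (intro sum_mono order_trans[OF degree_smult_le]) simp
    also have "\<dots> = n" using that by simp
    finally show ?thesis .
  qed
  moreover have "poly (\<beta> m) (of_nat m') = (if m = m' then 1 else 0)" if "m \<le> n" "m' \<le> n" for m m'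
  proof (cases "m = m'")
    case True
    then show ?thesis by (auto simp: \<beta>_def poly_prod intro!: prod.neutral simp flip: diff_divide_distrib)
  next
    case False
    have "(\<Prod>k\<in>{..n} - {m}. poly (smult (1 / (of_nat m - of_nat k)) [:- of_nat k, 1:]) (of_nat m' :: complex)) = 0"
      by (rule prod_zero) (use False that in \<open>auto intro!: bexI[of _ m']\<close>)
    then show ?thesis using False by (simp add: \<beta>_def poly_prod)
  qed
  ultimately show ?thesis using that by blast
qed

lemma lagrange_interpolation:
  fixes p :: "complex poly"
  assumes \<beta>: "\<And>m. m \<le> n \<Longrightarrow> degree (\<beta> m) \<le> n"
    "\<And>m m'. m \<le> n \<Longrightarrow> m' \<le> n \<Longrightarrow> poly (\<beta> m) (of_nat m') = (if m = m' then 1 else 0)"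
    and p: "degree p \<le> n"
  shows "p = (\<Sum>m\<le>n. smult (poly p (of_nat m)) (\<beta> m))"
proof (rule poly_eqI_degree[of "of_nat ` {..n}"])
  have card: "card (of_nat ` {..n} :: complex set) = n + 1"
    by (subst card_image) (auto simp: inj_on_def)
  show "card (of_nat ` {..n} :: complex set) > degree p" using card p by simp
  have "degree (\<Sum>m\<le>n. smult (poly p (of_nat m)) (\<beta> m)) \<le> n"
    using \<beta>(1) by (intro degree_sum_le) (auto intro: order_trans[OF degree_smult_le])
  then show "card (of_nat ` {..n} :: complex set) > degree (\<Sum>m\<le>n. smult (poly p (of_nat m)) (\<beta> m))"
    using card by simp
  fix x :: complex assume "x \<in> of_nat ` {..n}"
  then obtain m' where m': "m' \<le> n" "x = of_nat m'" by auto
  have "poly (\<Sum>m\<le>n. smult (poly p (of_nat m)) (\<beta> m)) x = (\<Sum>m\<le>n. if m = m' then poly p (of_nat m') else 0)"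
    unfolding poly_sum m'(2) using \<beta>(2) m'(1) by (intro sum.cong) auto
  then show "poly p x = poly (\<Sum>m\<le>n. smult (poly p (of_nat m)) (\<beta> m)) x"
    using m' by simp
qed

lemma poly_sum_upto: "degree (p::complex poly) \<le> n \<Longrightarrow> poly p x = (\<Sum>m\<le>n. coeff p m * x ^ m)"
  unfolding poly_altdef by (intro sum.mono_neutral_left) (auto simp: coeff_eq_0)

text \<open>Lagrange interpolation in \<open>x\<close> at the nodes 0, ..., n writes the function
  through its restrictions to finitely many lines, and these are polynomials in
  \<open>y\<close>.\<close>

lemma separately_polynomial:
  fixes \<phi> :: "complex \<Rightarrow> complex \<Rightarrow> complex"
  assumes "\<And>y. \<exists>p. degree p \<le> n \<and> (\<forall>x. \<phi> x y = poly p x)"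
    and "\<And>x. \<exists>p. degree p \<le> n \<and> (\<forall>y. \<phi> x y = poly p y)"
  shows "\<exists>c. \<forall>x y. \<phi> x y = (\<Sum>i\<le>n. \<Sum>k\<le>n. c i k * x ^ i * y ^ k)"
proof -
  obtain \<beta> :: "nat \<Rightarrow> complex poly" where \<beta>: "\<And>m. m \<le> n \<Longrightarrow> degree (\<beta> m) \<le> n"
    "\<And>m m'. m \<le> n \<Longrightarrow> m' \<le> n \<Longrightarrow> poly (\<beta> m) (of_nat m') = (if m = m' then 1 else 0)"
    by (rule lagrange_basis[of n]) blast
  obtain P where P: "\<And>x. degree (P x) \<le> n" "\<And>x y. \<phi> x y = poly (P x) y" using assms(2) by metis
  have "\<phi> x y = (\<Sum>i\<le>n. \<Sum>k\<le>n. (\<Sum>m\<le>n. coeff (\<beta> m) i * coeff (P (of_nat m)) k) * x ^ i * y ^ k)" for x y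
  proof -
    obtain p where p: "degree p \<le> n" "\<forall>x. \<phi> x y = poly p x" using assms(1) by blast
    have "\<phi> x y = (\<Sum>m\<le>n. poly p (of_nat m) * poly (\<beta> m) x)"
      using p(2) arg_cong[OF lagrange_interpolation[OF \<beta> p(1)], of "\<lambda>p. poly p x"]
      by (simp only: poly_sum poly_smult)
    also have "\<dots> = (\<Sum>m\<le>n. (\<Sum>i\<le>n. coeff (\<beta> m) i * x ^ i) * (\<Sum>k\<le>n. coeff (P (of_nat m)) k * y ^ k))"
    proof (intro sum.cong refl)
      fix m assume "m \<in> {..n}"
      show "poly p (of_nat m) * poly (\<beta> m) x = (\<Sum>i\<le>n. coeff (\<beta> m) i * x ^ i) * (\<Sum>k\<le>n. coeff (P (of_nat m)) k * y ^ k)"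
      proof -
        have "poly p (of_nat m) = poly (P (of_nat m)) y" using p(2) P(2) by metis
        then show ?thesis
          unfolding poly_sum_upto[OF P(1), symmetric] using \<open>m \<in> {..n}\<close>
          by (subst poly_sum_upto[OF \<beta>(1), symmetric]) simp_all
      qed
    qed
    also have "\<dots> = (\<Sum>m\<le>n. \<Sum>i\<le>n. \<Sum>k\<le>n. coeff (\<beta> m) i * coeff (P (of_nat m)) k * x ^ i * y ^ k)"
      by (simp add: sum_product mult_ac)
    also have "\<dots> = (\<Sum>i\<le>n. \<Sum>m\<le>n. \<Sum>k\<le>n. coeff (\<beta> m) i * coeff (P (of_nat m)) k * x ^ i * y ^ k)"
      by (rule sum.swap)
    also have "\<dots> = (\<Sum>i\<le>n. \<Sum>k\<le>n. \<Sum>m\<le>n. coeff (\<beta> m) i * coeff (P (of_nat m)) k * x ^ i * y ^ k)"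
      by (intro sum.cong refl sum.swap)
    finally show ?thesis by (simp add: sum_distrib_right)
  qed
  then show ?thesis
    by (intro exI[of _ "\<lambda>i k. \<Sum>m\<le>n. coeff (\<beta> m) i * coeff (P (of_nat m)) k"] allI)
qed

lemma poly_fun_zero:
  fixes e :: "nat \<Rightarrow> complex"
  assumes "\<And>x. (\<Sum>i\<le>n. e i * x ^ i) = 0" "i \<le> n"
  shows "e i = 0"
proof -
  have "poly (\<Sum>i\<le>n. monom (e i) i) x = 0" for x using assms(1) by (simp add: poly_sum poly_monom)
  then have "(\<Sum>i\<le>n. monom (e i) i) = 0" using poly_all_0_iff_0 by blast
  then have "coeff (\<Sum>i\<le>n. monom (e i) i) i = 0" by simp
  then show ?thesis using assms(2) by (simp add: coeff_sum)
qed

text \<open>The coefficient of \<open>r ^ m\<close> in \<open>\<phi> (r * x) r\<close> is the sum of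
  \<open>c i k * x ^ i\<close> over \<open>i + k = m\<close>. If it vanishes for all
  \<open>x\<close>, each \<open>c i k\<close> on that antidiagonal does.\<close>

lemma total_degree_bound:
  fixes \<phi> :: "complex \<Rightarrow> complex \<Rightarrow> complex"
  assumes \<phi>: "\<And>x y. \<phi> x y = (\<Sum>i\<le>n. \<Sum>k\<le>n. c i k * x ^ i * y ^ k)"
    and lines: "\<And>x. \<exists>p. degree p \<le> N \<and> (\<forall>r. \<phi> (r * x) r = poly p r)"
    and ik: "i \<le> n" "k \<le> n" "N < i + k"
  shows "c i k = 0"
proof -
  define m where "m = i + k"
  have "(\<Sum>i\<le>n. (\<Sum>k\<le>n. if i + k = m then c i k else 0) * x ^ i) = 0" for x
  proof -
    obtain p where p: "degree p \<le> N" "\<forall>r. \<phi> (r * x) r = poly p r" using lines by blast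
    define Q where "Q = (\<Sum>i\<le>n. \<Sum>k\<le>n. monom (c i k * x ^ i) (i + k))"
    have "poly Q r = poly p r" for r
      using p(2) \<phi>[of "r * x" r] by (simp add: Q_def poly_sum poly_monom power_mult_distrib power_add mult_ac)
    then have "Q = p" by (simp add: poly_eq_poly_eq_iff[symmetric] fun_eq_iff)
    then have "coeff Q m = 0" using p(1) ik(3) by (auto simp: m_def intro: coeff_eq_0)
    moreover have "coeff Q m = (\<Sum>i\<le>n. \<Sum>k\<le>n. if i + k = m then c i k * x ^ i else 0)"
      by (simp add: Q_def coeff_sum coeff_monom)
    ultimately show ?thesis
      by (simp add: sum_distrib_right if_distrib[of "\<lambda>z. z * x ^ _"] cong: if_cong)
  qed
  then have "(\<Sum>k\<le>n. if i + k = m then c i k else 0) = 0"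
    by (intro poly_fun_zero[where e = "\<lambda>i. \<Sum>k\<le>n. if i + k = m then c i k else 0" and n = n] ik(1))
  also have "(\<Sum>k\<le>n. if i + k = m then c i k else 0) = (\<Sum>k'\<le>n. if k' = k then c i k else 0)"
    by (intro sum.cong) (auto simp: m_def)
  finally show ?thesis using ik(2) by simp
qed

lemma hpoly_homogenization:
  assumes "hpoly 1 X" "hpoly 1 Y" "hpoly 1 W"
  shows "hpoly N (\<lambda>v. \<Sum>i\<le>n. \<Sum>k\<le>n. if i + k \<le> N then c i k * (X v ^ i * (Y v ^ k * W v ^ (N - i - k))) else 0)"
proof (intro hpoly_sum)
  fix i k
  show "hpoly N (\<lambda>v. if i + k \<le> N then c i k * (X v ^ i * (Y v ^ k * W v ^ (N - i - k))) else 0)"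
  proof (cases "i + k \<le> N")
    case True
    have "hpoly (1 * i + (1 * k + 1 * (N - i - k))) (\<lambda>v. c i k * (X v ^ i * (Y v ^ k * W v ^ (N - i - k))))"
      by (intro hpoly_cmult hpoly_mult hpoly_power assms)
    then show ?thesis using True by simp
  qed (simp add: hpoly.zero)
qed

lemma homogenization_eval:
  fixes w :: complex
  assumes w: "w \<noteq> 0"
    and \<phi>: "\<And>x y. \<phi> x y = (\<Sum>i\<le>n. \<Sum>k\<le>n. c i k * x ^ i * y ^ k)"
    and c: "\<And>i k. i \<le> n \<Longrightarrow> k \<le> n \<Longrightarrow> N < i + k \<Longrightarrow> c i k = 0"
  shows "(\<Sum>i\<le>n. \<Sum>k\<le>n. if i + k \<le> N then c i k * (x ^ i * (y ^ k * w ^ (N - i - k))) else 0) = w ^ N * \<phi> (x / w) (y / w)"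
  unfolding \<phi> sum_distrib_left
proof (intro sum.cong refl)
  fix i k assume ik: "i \<in> {..n}" "k \<in> {..n}"
  show "(if i + k \<le> N then c i k * (x ^ i * (y ^ k * w ^ (N - i - k))) else 0) = w ^ N * (c i k * (x / w) ^ i * (y / w) ^ k)"
  proof (cases "i + k \<le> N")
    case True
    then have "w ^ N = w ^ (N - i - k) * (w ^ i * w ^ k)" by (simp flip: power_add)
    then show ?thesis using True w by (simp add: power_divide)
  qed (use c ik in auto)
qed

lemma vector_independent_in_cone:
  assumes "(w, r) \<noteq> (0, 0)" "\<And>w r. w *s u + r *s v = 0 \<Longrightarrow> w = 0 \<and> r = 0"
  shows "w *s u + r *s v \<in> cone UNIV"
  using assms by (auto simp: cone_UNIV)

lemma plane_section_on_line:
  assumes s: "s \<in> twist UNIV (int j) UNIV"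
    and indep: "\<And>w r. w *s u + r *s v = 0 \<Longrightarrow> w = 0 \<and> r = 0"
  shows "\<exists>p. degree p \<le> j \<and> (\<forall>t. s (u + t *s v) = poly p t)"
  using twist_binary_form[OF s vector_independent_in_cone[OF _ indep]] by metis

text \<open>Sections are known to be polynomial on every line of the plane. Lines in the two
  coordinate directions make the section polynomial in each affine coordinate, and lines through the
  affine origin bound the total degree by \<open>j\<close>. Degree 0 is left out since sections are
  set to 0 at the origin, unlike nonzero constants.\<close>

lemma twist_plane_hpoly:
  assumes s: "s \<in> twist UNIV (int j) UNIV" and j: "0 < j"
  shows "hpoly j s"
proof -
  define \<phi> where "\<phi> x y = s (vector [x, y, 1])" for x y
  have "\<exists>p. degree p \<le> j \<and> (\<forall>x. \<phi> x y = poly p x)" for y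
  proof -
    have "vector [0, y, 1] + x *s vector [1, 0, 0] = (vector [x, y, 1] :: complex^3)" for x
      by (simp add: vec_eq_iff forall_3)
    moreover have "\<exists>p. degree p \<le> j \<and> (\<forall>t. s (vector [0, y, 1] + t *s vector [1, 0, 0]) = poly p t)"
      by (rule plane_section_on_line[OF s]) (simp add: vec_eq_iff forall_3)
    ultimately show ?thesis by (simp add: \<phi>_def)
  qed
  moreover have "\<exists>p. degree p \<le> j \<and> (\<forall>y. \<phi> x y = poly p y)" for x
  proof -
    have "vector [x, 0, 1] + y *s vector [0, 1, 0] = (vector [x, y, 1] :: complex^3)" for y
      by (simp add: vec_eq_iff forall_3)
    moreover have "\<exists>p. degree p \<le> j \<and> (\<forall>t. s (vector [x, 0, 1] + t *s vector [0, 1, 0]) = poly p t)"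
      by (rule plane_section_on_line[OF s]) (simp add: vec_eq_iff forall_3)
    ultimately show ?thesis by (simp add: \<phi>_def)
  qed
  ultimately obtain c where c: "\<And>x y. \<phi> x y = (\<Sum>i\<le>j. \<Sum>k\<le>j. c i k * x ^ i * y ^ k)"
    using separately_polynomial[of j \<phi>] by blast
  have "\<exists>p. degree p \<le> j \<and> (\<forall>r. \<phi> (r * x) r = poly p r)" for x
  proof -
    have "vector [0, 0, 1] + r *s vector [x, 1, 0] = (vector [r * x, r, 1] :: complex^3)" for r
      by (simp add: vec_eq_iff forall_3)
    moreover have "\<exists>p. degree p \<le> j \<and> (\<forall>t. s (vector [0, 0, 1] + t *s vector [x, 1, 0]) = poly p t)"
      by (rule plane_section_on_line[OF s]) (simp add: vec_eq_iff forall_3)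
    ultimately show ?thesis by (simp add: \<phi>_def)
  qed
  note c0 = total_degree_bound[OF c this]
  define h where "h v = (\<Sum>i\<le>j. \<Sum>k\<le>j. if i + k \<le> j then c i k * (v $ 1 ^ i * (v $ 2 ^ k * v $ 3 ^ (j - i - k))) else 0)" for v :: "complex^3"
  have h: "hpoly j h" unfolding h_def [abs_def] by (intro hpoly_homogenization hpoly_coord)
  have off: "s v = h v" if "v $ 3 \<noteq> 0" for v
  proof -
    have "v = v $ 3 *s vector [v $ 1 / v $ 3, v $ 2 / v $ 3, 1]"
      using that by (simp add: vec_eq_iff forall_3)
    then have "s v = v $ 3 ^ j * \<phi> (v $ 1 / v $ 3) (v $ 2 / v $ 3)"
      using twist_homogeneous[OF s that] unfolding \<phi>_def by (metis power_int_of_nat)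
    also have "\<dots> = h v" unfolding h_def by (rule homogenization_eval[OF that c c0, symmetric])
    finally show ?thesis .
  qed
  have "s v = h v" for v
  proof (cases "v = 0")
    case True
    then show ?thesis using twist_eq_0[OF s, of v] hpoly_zero_eq_0[OF h j] by (simp add: cone_UNIV)
  next
    case False
    have "s v - h v = 0"
    proof (rule vanish_off_hyperplane[of "cone UNIV" "\<lambda>v. s v - h v" v "axis 3 1"])
      show "continuous_on (cone UNIV) (\<lambda>v. s v - h v)"
        by (intro continuous_on_diff twist_continuous[OF s zariski_open_UNIV] hpoly_continuous[OF h])
      show "s v - h v = 0" if "(\<Sum>i\<in>UNIV. axis 3 1 $ i * v $ i) \<noteq> 0" for v
        using off[of v] that by (simp add: sum_3 axis_def)
    qed (use False open_cone[OF zariski_open_UNIV] in \<open>auto simp: cone_UNIV axis_eq_0_iff\<close>)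
    then show ?thesis by simp
  qed
  then have "s = h" by blast
  then show ?thesis using h by simp
qed

lemma hpoly_twist_plane:
  assumes "hpoly j s" "0 < j"
  shows "s \<in> twist UNIV (int j) UNIV"
proof -
  have "(\<lambda>v. if v \<in> cone (UNIV \<inter> UNIV) then s v else 0) = s"
    using hpoly_zero_eq_0[OF assms] by (auto simp: cone_UNIV fun_eq_iff)
  then show ?thesis using twist_hpoly[OF assms(1) zariski_open_UNIV, of UNIV] by simp
qed

lemma sections_through_iff:
  assumes "0 < j"
  shows "s \<in> sections_through j Z \<longleftrightarrow> hpoly j s \<and> (\<forall>p\<in>Z. s (rep_proj2 p) = 0)"
  using twist_plane_hpoly[OF _ assms] hpoly_twist_plane[OF _ assms] by (auto simp: sections_through_def)

section \<open>Multiplicity\<close>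

lemma poly_eq_off_zero:
  fixes p q :: "complex poly"
  assumes "\<And>t. t \<noteq> 0 \<Longrightarrow> poly p t = poly q t"
  shows "p = q"
proof -
  have "poly ((p - q) * [:0, 1:]) t = 0" for t using assms[of t] by (cases "t = 0") auto
  then have "(p - q) * [:0, 1:] = 0" using poly_all_0_iff_0 by blast
  then show ?thesis by simp
qed

text \<open>Exchanging the two points of the line reverses the coefficients: homogeneity gives this
  for nonzero \<open>t\<close>, and both sides are polynomials in \<open>t\<close>.\<close>

lemma hpoly_line_reverse:
  assumes g: "hpoly r g" and p: "degree p \<le> r" "\<And>t. g (x + t *s y) = poly p t"
  shows "g (y + t *s x) = (\<Sum>i\<le>r. coeff p i * t ^ (r - i))"
proof -
  define Q where "Q = (\<Sum>i\<le>r. monom (coeff p i) (r - i))"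
  obtain p' where p': "\<And>t. g (y + t *s x) = poly p' t" using hpoly_line_poly[OF g] by metis
  have "poly p' t = poly Q t" if t: "t \<noteq> 0" for t
  proof -
    have eq: "y + t *s x = t *s (x + (1 / t) *s y)"
      using t by (simp add: vector_add_ldistrib vector_smult_assoc add.commute)
    have "poly p' t = g (t *s (x + (1 / t) *s y))"
      using p'[of t] unfolding eq by (rule sym)
    also have "\<dots> = t ^ r * poly p (1 / t)"
      by (simp only: hpoly_homogeneous[OF g] p(2))
    also have "\<dots> = (\<Sum>i\<le>r. coeff p i * t ^ (r - i))"
      unfolding poly_sum_upto[OF p(1)] sum_distrib_left
    proof (intro sum.cong refl)
      fix i assume "i \<in> {..r}"
      then have "t ^ r = t ^ (r - i) * t ^ i" by (simp flip: power_add)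
      then show "t ^ r * (coeff p i * (1 / t) ^ i) = coeff p i * t ^ (r - i)"
        using t by (simp add: power_divide)
    qed
    finally show ?thesis by (simp add: Q_def poly_sum poly_monom)
  qed
  then have "p' = Q" by (rule poly_eq_off_zero)
  then show ?thesis using p' by (simp add: Q_def poly_sum poly_monom)
qed

lemma hpoly_line_top_coeff:
  assumes "hpoly r g" "degree p \<le> r" "\<And>t. g (x + t *s y) = poly p t"
  shows "coeff p r = g y"
proof -
  have "g (y + 0 *s x) = (\<Sum>i\<le>r. coeff p i * 0 ^ (r - i))" by (rule hpoly_line_reverse[OF assms])
  also have "\<dots> = (\<Sum>i\<le>r. if i = r then coeff p r else 0)"
    by (intro sum.cong) (auto simp: power_0_left)
  finally show ?thesis by simp
qed

text \<open>Vanishing of the partial derivatives forces vanishing of the Taylor coefficients along a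
  line, by induction through \<open>pderiv p\<close>, a combination of the restrictions of the first
  partial derivatives.\<close>

lemma vanishing_line_coeff:
  assumes "hpoly r g" "\<And>is. length is < m \<Longrightarrow> foldr pderiv3 is g x = 0"
    and p: "\<And>t. g (x + t *s y) = poly p t"
  shows "i < m \<Longrightarrow> coeff p i = 0"
  using assms
proof (induction i arbitrary: m g r p)
  case 0
  have "g x = 0" using "0.prems"(3)[of "[]"] 0 by simp
  then show ?case using "0.prems"(4)[of 0] by (simp add: poly_0_coeff_0)
next
  case (Suc i)
  note g = pderiv3_hpoly[OF Suc.prems(2)]
  have "\<exists>P. \<forall>t. pderiv3 k g (x + t *s y) = poly P t" for k
    using g hpoly_line_poly[of "r - 1" "pderiv3 k g"] by blast
  then obtain P where P: "\<And>k t. pderiv3 k g (x + t *s y) = poly (P k) t" by metis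
  have "poly (pderiv p) t = poly (\<Sum>k\<in>UNIV. smult (y $ k) (P k)) t" for t
  proof -
    have "((\<lambda>t. g (x + t *s y)) has_field_derivative (\<Sum>k\<in>UNIV. y $ k * pderiv3 k g (x + t *s y))) (at t)"
      using g by blast
    moreover have "((\<lambda>t. g (x + t *s y)) has_field_derivative poly (pderiv p) t) (at t)"
      using poly_DERIV[of p t] by (simp add: Suc.prems(4))
    ultimately have "poly (pderiv p) t = (\<Sum>k\<in>UNIV. y $ k * pderiv3 k g (x + t *s y))"
      by (rule DERIV_unique[symmetric])
    then show ?thesis by (simp add: P poly_sum)
  qed
  then have eq: "pderiv p = (\<Sum>k\<in>UNIV. smult (y $ k) (P k))"
    by (simp add: poly_eq_poly_eq_iff[symmetric] fun_eq_iff)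
  have "coeff (P k) i = 0" for k
  proof (rule Suc.IH[of "m - 1" "r - 1" "pderiv3 k g"])
    show "i < m - 1" using Suc.prems(1) by simp
    show "hpoly (r - 1) (pderiv3 k g)" using g by blast
    fix "is" :: "3 list" assume "length is < m - 1"
    \<comment> \<open>\<open>foldr\<close> applies the last entry of the list first, so the
      innermost derivative is appended at the end.\<close>
    then have "length (is @ [k]) < m" by simp
    from Suc.prems(3)[OF this] show "foldr pderiv3 is (pderiv3 k g) x = 0" by simp
  qed (rule P)
  then have "coeff (pderiv p) i = 0" unfolding eq by (simp add: coeff_sum)
  then have "of_nat (Suc i) * coeff p (Suc i) = 0" by (simp only: coeff_pderiv)
  then show ?case using of_nat_neq_0 by (metis mult_eq_0_iff)
qed

text \<open>On the line from \<open>q\<close> to \<open>y\<close> a form of degree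
  \<open>Suc k\<close> vanishing to order \<open>k\<close> at \<open>q\<close> keeps only its two
  top coefficients. In the reversed parametrisation, starting at \<open>y\<close>, these are the
  constant and the linear one.\<close>

lemma multiplicity_linear:
  assumes s: "hpoly (Suc k) s" and q: "q \<noteq> 0" and van: "vanishes_to_order k (abs_proj2 q) s"
  shows "s (y + t *s q) = s y + t * (s (y + q) - s y)"
proof -
  obtain c where c: "c \<noteq> 0" "rep_proj2 (abs_proj2 q) = c *s q" by (rule rep_abs_proj2[OF q])
  obtain p where p: "degree p \<le> Suc k" "\<And>t. s (c *s q + t *s y) = poly p t"
    using hpoly_line_poly[OF s] by metis
  have "coeff p i = 0" if "i < k" for i
  proof (rule vanishing_line_coeff[OF s _ p(2) that])
    show "foldr pderiv3 is s (c *s q) = 0" if "length is < k" for "is"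
      using van that by (simp add: vanishes_to_order_def c(2))
  qed
  then have eq: "s (y + t *s (c *s q)) = coeff p (Suc k) + coeff p k * t" for t
    using hpoly_line_reverse[OF s p] by (simp add: sum.atMost_Suc lessThan_Suc_atMost[symmetric])
  have *: "s (y + t *s q) = coeff p (Suc k) + coeff p k * (t / c)" for t
    using eq[of "t / c"] c(1) by (simp add: vector_smult_assoc)
  show ?thesis using *[of t] *[of 1] *[of 0] by (simp add: algebra_simps)
qed

section \<open>The expected dimension of the linear system through the points\<close>

lemma sum_fun_apply: "(\<Sum>x\<in>A. F x) v = (\<Sum>x\<in>A. F x v)" for F :: "'a \<Rightarrow> 'b \<Rightarrow> 'c::comm_monoid_add"
  by (induction A rule: infinite_finite_induct) (auto simp: plus_fun_def zero_fun_def)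

lemma card_monomials: "card (SIGMA i:{..j}. {..j - i}) = (j + 2) choose 2"
proof -
  have "card (SIGMA i:{..j}. {..j - i}) = (\<Sum>i\<le>j. Suc (j - i))" by (simp add: card_SigmaI)
  also have "\<dots> = (\<Sum>i\<le>j. Suc i)"
    by (rule sum.reindex_bij_witness[of _ "\<lambda>i. j - i" "\<lambda>i. j - i"]) auto
  also have "\<dots> = (j + 2) choose 2"
    by (induction j) (auto simp: numeral_2_eq_2)
  finally show ?thesis .
qed

text \<open>Each point imposes one linear condition on the coefficients of the
  \<open>(j + 2) choose 2\<close> monomials. The bound is stated as a sum to avoid truncated
  subtraction.\<close>

lemma dim_sections_through_ge:
  assumes Z: "finite Z" "card Z \<le> (j + 2) choose 2" and j: "0 < j"
  shows "(j + 2) choose 2 \<le> fun_space.dim (sections_through j Z) + card Z"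
proof -
  define I where "I = (SIGMA i:{..j}. {..j - i})"
  define mon where "mon \<iota> v = v$1 ^ fst \<iota> * v$2 ^ snd \<iota> * v$3 ^ (j - fst \<iota> - snd \<iota>)" for \<iota> :: "nat \<times> nat" and v :: "complex^3"
  have finI: "finite I" by (simp add: I_def)
  have hm: "hpoly j (mon \<iota>)" if "\<iota> \<in> I" for \<iota>
  proof -
    have "hpoly (1 * fst \<iota> + 1 * snd \<iota> + 1 * (j - fst \<iota> - snd \<iota>)) (mon \<iota>)"
      unfolding mon_def [abs_def] by (intro hpoly_mult hpoly_power hpoly_coord)
    moreover have "1 * fst \<iota> + 1 * snd \<iota> + 1 * (j - fst \<iota> - snd \<iota>) = j" using that by (auto simp: I_def)
    ultimately show ?thesis by simp
  qed
  have mon_indep: "e \<iota> = 0" if e: "\<And>v. (\<Sum>\<iota>\<in>I. e \<iota> * mon \<iota> v) = 0" and \<iota>: "\<iota> \<in> I" for e \<iota>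
  proof -
    have "(\<Sum>i\<le>j. (\<Sum>k\<le>j. (if (i, k) \<in> I then e (i, k) else 0) * y ^ k) * x ^ i) = 0" for x y
    proof -
      have "(\<Sum>\<iota>\<in>I. e \<iota> * mon \<iota> (vector [x, y, 1])) = (\<Sum>\<iota>\<in>{..j} \<times> {..j}. (if \<iota> \<in> I then e \<iota> else 0) * y ^ snd \<iota> * x ^ fst \<iota>)"
        by (rule sum.mono_neutral_cong_left) (auto simp: I_def mon_def)
      also have "\<dots> = (\<Sum>i\<le>j. (\<Sum>k\<le>j. (if (i, k) \<in> I then e (i, k) else 0) * y ^ k) * x ^ i)"
        unfolding sum_distrib_right sum.cartesian_product by (intro sum.cong) auto
      finally show ?thesis using e by simp
    qed
    then have "(\<Sum>k\<le>j. (if (fst \<iota>, k) \<in> I then e (fst \<iota>, k) else 0) * y ^ k) = 0" for y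
      using \<iota> by (intro poly_fun_zero[where i = "fst \<iota>" and n = j and e = "\<lambda>i. \<Sum>k\<le>j. (if (i, k) \<in> I then e (i, k) else 0) * y ^ k"])
        (auto simp: I_def)
    then have "(if (fst \<iota>, snd \<iota>) \<in> I then e (fst \<iota>, snd \<iota>) else 0) = 0"
      by (rule poly_fun_zero[where n = j]) (use \<iota> in \<open>auto simp: I_def\<close>)
    then show ?thesis using \<iota> by simp
  qed
  define n where "n = ((j + 2) choose 2) - card Z"
  have cI: "card I = (j + 2) choose 2" unfolding I_def by (rule card_monomials)
  have "card Z + n \<le> card I" using cI Z(2) by (simp add: n_def)
  then obtain x where x: "\<forall>l<n. \<forall>p\<in>Z. (\<Sum>\<iota>\<in>I. x l \<iota> * mon \<iota> (rep_proj2 p)) = 0"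
    "\<forall>a. (\<forall>\<iota>\<in>I. (\<Sum>l<n. a l * x l \<iota>) = 0) \<longrightarrow> (\<forall>l<n. a l = 0)"
    using kernel_independent_family[OF Z(1) finI, of n "\<lambda>\<iota> p. mon \<iota> (rep_proj2 p)"] by blast
  define g where "g l v = (\<Sum>\<iota>\<in>I. x l \<iota> * mon \<iota> v)" for l v
  have gV: "g l \<in> sections_through j Z" if "l < n" for l
    unfolding sections_through_iff[OF j]
  proof
    show "hpoly j (g l)" unfolding g_def [abs_def] by (intro hpoly_sum hpoly_cmult hm)
    show "\<forall>p\<in>Z. g l (rep_proj2 p) = 0" using x(1) that by (simp add: g_def)
  qed
  have g_indep: "a l = 0" if a: "\<And>v. (\<Sum>l<n. a l * g l v) = 0" and l: "l < n" for a l
  proof -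
    have "(\<Sum>\<iota>\<in>I. (\<Sum>l<n. a l * x l \<iota>) * mon \<iota> v) = 0" for v
    proof -
      have "(\<Sum>\<iota>\<in>I. (\<Sum>l<n. a l * x l \<iota>) * mon \<iota> v) = (\<Sum>l<n. a l * g l v)"
        unfolding g_def sum_distrib_left sum_distrib_right by (subst sum.swap) (simp add: mult.assoc)
      then show ?thesis using a by simp
    qed
    then have "\<forall>\<iota>\<in>I. (\<Sum>l<n. a l * x l \<iota>) = 0"
      by (intro ballI mon_indep[where e = "\<lambda>\<iota>. \<Sum>l<n. a l * x l \<iota>"])
    then show ?thesis using x(2) l by blast
  qed
  have inj: "inj_on g {..<n}"
  proof (rule inj_onI, rule ccontr)
    fix l l' assume l: "l \<in> {..<n}" "l' \<in> {..<n}" "g l = g l'" "l \<noteq> l'"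
    define a :: "nat \<Rightarrow> complex" where "a m = (if m = l then 1 else 0) - (if m = l' then 1 else 0)" for m
    have z: "(\<Sum>m<n. a m * g m v) = 0" for v
    proof -
      have "(\<Sum>m<n. a m * g m v) = (\<Sum>m<n. (if m = l then g l v else 0) - (if m = l' then g l' v else 0))"
        by (intro sum.cong) (auto simp: a_def)
      also have "\<dots> = g l v - g l' v" using l(1,2) unfolding sum_subtractf by simp
      also have "\<dots> = 0" unfolding l(3) by simp
      finally show ?thesis .
    qed
    have "a l = 0" by (rule g_indep[OF z]) (use l(1) in simp)
    then show False using l(4) by (simp add: a_def)
  qed
  have indep: "fun_space.independent (g ` {..<n})"
  proof (rule fun_space.independent_if_scalars_zero)
    fix e h assume "(\<Sum>h\<in>g ` {..<n}. (\<lambda>v. e h * h v)) = 0" and h: "h \<in> g ` {..<n}"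
    then have "(\<Sum>l<n. e (g l) * g l v) = 0" for v
      by (simp add: sum.reindex[OF inj] fun_eq_iff sum_fun_apply)
    then have "l < n \<Longrightarrow> e (g l) = 0" for l by (intro g_indep[of "\<lambda>l. e (g l)"])
    then show "e h = 0" using h by auto
  qed simp
  \<comment> \<open>The finite spanning set makes the chosen basis finite. This matters since
    \<open>card\<close> of an infinite basis would be 0 and give no lower bound.\<close>
  have sub: "sections_through j Z \<subseteq> fun_space.span (mon ` I)"
  proof
    fix s assume "s \<in> sections_through j Z"
    then have "hom_poly j s" using sections_through_iff[OF j] hom_poly_iff_hpoly by blast
    then obtain c where c: "s = (\<lambda>v. \<Sum>i\<le>j. \<Sum>k\<le>j - i. c i k * v$1 ^ i * v$2 ^ k * v$3 ^ (j - i - k))"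
      unfolding hom_poly_def by blast
    have "s = (\<Sum>\<iota>\<in>I. (\<lambda>v. c (fst \<iota>) (snd \<iota>) * mon \<iota> v))"
      unfolding c by (simp add: fun_eq_iff sum_fun_apply I_def sum.Sigma mon_def mult.assoc case_prod_beta)
    also have "\<dots> \<in> fun_space.span (mon ` I)"
      by (intro fun_space.span_sum fun_space.span_scale fun_space.span_base) auto
    finally show "s \<in> fun_space.span (mon ` I)" .
  qed
  obtain B where B: "B \<subseteq> sections_through j Z" "fun_space.independent B"
    "sections_through j Z \<subseteq> fun_space.span B" "card B = fun_space.dim (sections_through j Z)"
    by (rule fun_space.basis_exists)
  have "finite B"
    using fun_space.independent_span_bound[of "mon ` I" B] B(1,2) sub finI by blast
  moreover have "g ` {..<n} \<subseteq> fun_space.span B" using gV B(3) by blast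
  ultimately have "card (g ` {..<n}) \<le> card B"
    using fun_space.independent_span_bound[OF _ indep] by blast
  then have "n \<le> fun_space.dim (sections_through j Z)" using B(4) by (simp add: card_image[OF inj])
  then show ?thesis by (simp add: n_def)
qed

section \<open>Unexpected curves and splitting types\<close>

context good_line
begin

text \<open>The point of the line z = 0 that, joined with \<open>q\<close>, spans the line dual to
  \<open>u + t *s v \<kappa>\<close>; the pencil of lines through \<open>q\<close> thus has the same
  parameter as the dual line of \<open>q\<close>.\<close>

definition pencil_pt :: "complex \<Rightarrow> complex \<Rightarrow> complex^3" where
  "pencil_pt \<kappa> t = vector [t, 1 + \<kappa> * t, 0]"

lemma dual_form_u_v:
  "dual_form p u = - rep_proj2 p $ 1 + rep_proj2 p $ 3 * q $ 1"
  "dual_form p (v \<kappa>) = rep_proj2 p $ 2 - rep_proj2 p $ 3 * q $ 2 - \<kappa> * (rep_proj2 p $ 1 - rep_proj2 p $ 3 * q $ 1)"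
  by (simp_all add: dual_form_def sum_3 base_pt_def dir_pt_def algebra_simps)

text \<open>At the node of \<open>p\<close> the point of the dual line of \<open>q\<close> also lies
  on the line dual to \<open>p\<close>; dually, \<open>p\<close>, \<open>q\<close> and the pencil
  point are collinear. The coefficient of \<open>q\<close> is read off from the third
  coordinate.\<close>

lemma rep_eq_pencil:
  assumes "dual_form p (v \<kappa>) \<noteq> 0"
  shows "rep_proj2 p = rep_proj2 p $ 3 *s q + dual_form p (v \<kappa>) *s pencil_pt \<kappa> (node \<kappa> p)"
proof -
  define \<eta> where "\<eta> = dual_form p (v \<kappa>)"
  define r where "r = rep_proj2 p $ 1 - rep_proj2 p $ 3 * q $ 1"
  have n: "\<eta> * node \<kappa> p = r" using assms by (simp add: node_def \<eta>_def dual_form_u_v(1) r_def)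
  have \<eta>: "\<eta> = rep_proj2 p $ 2 - rep_proj2 p $ 3 * q $ 2 - \<kappa> * r" by (simp add: \<eta>_def dual_form_u_v r_def)
  have "\<eta> * (1 + \<kappa> * node \<kappa> p) = \<eta> + \<kappa> * (\<eta> * node \<kappa> p)" by (simp add: algebra_simps)
  also have "\<dots> = \<eta> + \<kappa> * r" by (simp only: n)
  also have "\<dots> = rep_proj2 p $ 2 - rep_proj2 p $ 3 * q $ 2" by (simp add: \<eta>)
  finally have 2: "\<eta> * (1 + \<kappa> * node \<kappa> p) = rep_proj2 p $ 2 - rep_proj2 p $ 3 * q $ 2" .
  have c1: "(rep_proj2 p $ 3 *s q + \<eta> *s pencil_pt \<kappa> (node \<kappa> p)) $ 1 = rep_proj2 p $ 1"
    by (simp add: pencil_pt_def n) (simp add: r_def)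
  have "(rep_proj2 p $ 3 *s q + \<eta> *s pencil_pt \<kappa> (node \<kappa> p)) $ 2
      = rep_proj2 p $ 3 * q $ 2 + \<eta> * (1 + \<kappa> * node \<kappa> p)"
    by (simp only: pencil_pt_def vector_add_component vector_smult_component vector_3)
  then have c2: "(rep_proj2 p $ 3 *s q + \<eta> *s pencil_pt \<kappa> (node \<kappa> p)) $ 2 = rep_proj2 p $ 2"
    unfolding 2 by (rule trans) simp
  have c3: "(rep_proj2 p $ 3 *s q + \<eta> *s pencil_pt \<kappa> (node \<kappa> p)) $ 3 = rep_proj2 p $ 3"
    by (simp add: pencil_pt_def q3)
  have "rep_proj2 p = rep_proj2 p $ 3 *s q + \<eta> *s pencil_pt \<kappa> (node \<kappa> p)"
    by (simp only: vec_eq_iff forall_3 c1 c2 c3)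
  then show ?thesis unfolding \<eta>_def[symmetric] .
qed

text \<open>A vector \<open>R0\<close> of degree \<open>k\<close> along the line is prescribed by
  its pairings: with the pencil point it gives the value \<open>B\<close> of the curve, with
  \<open>q\<close> the slope \<open>A\<close>. At the node of \<open>p\<close> its pairing with
  \<open>p\<close> is \<open>s (rep_proj2 p)\<close> divided by \<open>\<eta> ^ k\<close>, hence 0.
  So \<open>R0\<close> is tangent to every line of the arrangement where that line meets the given
  one, which makes \<open>R0\<close> applied to \<open>f\<close> a multiple of \<open>f\<close>
  along the line. Subtracting a multiple of the position vector turns it into a syzygy.\<close>

lemma curve_syzygy:
  assumes k: "0 < k" and s: "hpoly (Suc k) s" and Zs: "\<forall>p\<in>Z. s (rep_proj2 p) = 0"
    and van: "vanishes_to_order k (abs_proj2 q) s"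
    and \<kappa>: "\<forall>p\<in>Z. dual_form p (v \<kappa>) \<noteq> 0"
  shows "\<exists>R\<in>line_syz f u (v \<kappa>) k. \<forall>t.
    (\<Sum>i\<in>UNIV. q $ i * poly (R $ i) t) = s (pencil_pt \<kappa> t + q) - s (pencil_pt \<kappa> t) \<and>
    (\<Sum>i\<in>UNIV. pencil_pt \<kappa> t $ i * poly (R $ i) t) = s (pencil_pt \<kappa> t)"
proof -
  define y0 y1 :: "complex^3" where "y0 = vector [0, 1, 0]" and "y1 = vector [1, \<kappa>, 0]"
  have Y: "pencil_pt \<kappa> t = y0 + t *s y1" for t
    by (simp add: pencil_pt_def y0_def y1_def vec_eq_iff forall_3 algebra_simps)
  have mult: "s (y + t *s q) = s y + t * (s (y + q) - s y)" for y t
    by (rule multiplicity_linear[OF s q_nonzero van])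
  obtain B where B: "degree B \<le> Suc k" "\<And>t. s (y0 + t *s y1) = poly B t"
    using hpoly_line_poly[OF s] by metis
  obtain B' where B': "degree B' \<le> Suc k" "\<And>t. s ((y0 + q) + t *s y1) = poly B' t"
    using hpoly_line_poly[OF s] by metis
  \<comment> \<open>Both polynomials have the same top coefficient \<open>s y1\<close>, so the
    difference has degree at most \<open>k\<close>.\<close>
  define A where "A = B' - B"
  have "coeff A (Suc k) = 0"
    using hpoly_line_top_coeff[OF s B] hpoly_line_top_coeff[OF s B'] by (simp add: A_def)
  moreover have "degree A \<le> Suc k" unfolding A_def by (rule degree_diff_le[OF B'(1) B(1)])
  ultimately have degA: "degree A \<le> k"
    by (metis le_Suc_eq leading_coeff_0_iff degree_0 le0)
  have A: "poly A t = s (pencil_pt \<kappa> t + q) - s (pencil_pt \<kappa> t)" for t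
    using B(2)[of t] B'(2)[of t] by (simp add: A_def Y add_ac)
  have BY: "poly B t = s (pencil_pt \<kappa> t)" for t using B(2) by (simp add: Y)
  define b0 where "b0 = coeff B 0"
  \<comment> \<open>The entries solve \<open>t * r1 + (1 + \<kappa> * t) * b0 = B\<close> and
    \<open>q $ 1 * r1 + q $ 2 * b0 + r3 = A\<close>; \<open>poly_shift 1 B\<close> is
    \<open>(B - b0) / t\<close>.\<close>
  define r1 where "r1 = poly_shift 1 B - [:\<kappa> * b0:]"
  define r3 where "r3 = A - smult (q $ 1) r1 - smult (q $ 2) [:b0:]"
  define R0 :: "complex poly^3" where "R0 = vector [r1, [:b0:], r3]"
  have "pCons b0 (poly_shift 1 B) = B"
    by (rule poly_eqI) (simp add: coeff_pCons b0_def coeff_poly_shift split: nat.split)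
  then have Bs: "poly B t = b0 + t * poly (poly_shift 1 B) t" for t by (metis poly_pCons)
  have deg1: "degree r1 \<le> k"
  proof -
    have "degree (poly_shift 1 B) \<le> k"
      by (rule degree_le) (use B(1) in \<open>auto simp: coeff_poly_shift intro: coeff_eq_0\<close>)
    then show ?thesis unfolding r1_def by (intro degree_diff_le) auto
  qed
  have deg3: "degree r3 \<le> k" unfolding r3_def
    using degA deg1 by (intro degree_diff_le order_trans[OF degree_smult_le]) auto
  have degR0: "degree (R0 $ i) \<le> k" for i
    using exhaust_3[of i] deg1 deg3 by (auto simp: R0_def)
  have R0q: "(\<Sum>i\<in>UNIV. q $ i * poly (R0 $ i) t) = poly A t" for t
    by (simp add: sum_3 R0_def r3_def q3)
  have R0y: "(\<Sum>i\<in>UNIV. pencil_pt \<kappa> t $ i * poly (R0 $ i) t) = poly B t" for t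
    unfolding Bs by (simp add: sum_3 R0_def r1_def pencil_pt_def algebra_simps)
  define X where "X t = u + t *s v \<kappa>" for t
  have dX: "dual_form p (X t) = poly [:dual_form p u, dual_form p (v \<kappa>):] t" for p t
    by (simp add: X_def dual_form_add_scale)
  have "\<exists>g. (\<Sum>i\<in>UNIV. smult (rep_proj2 p $ i) (R0 $ i)) = [:dual_form p u, dual_form p (v \<kappa>):] * g \<and> degree g < k"
    if p: "p \<in> Z" for p
  proof -
    define \<eta> where "\<eta> = dual_form p (v \<kappa>)"
    define \<tau> where "\<tau> = node \<kappa> p"
    define P where "P = (\<Sum>i\<in>UNIV. smult (rep_proj2 p $ i) (R0 $ i))"
    have \<eta>: "\<eta> \<noteq> 0" using \<kappa> p by (simp add: \<eta>_def)
    have rep: "rep_proj2 p = rep_proj2 p $ 3 *s q + \<eta> *s pencil_pt \<kappa> \<tau>"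
      unfolding \<eta>_def \<tau>_def using rep_eq_pencil \<kappa> p by blast
    have "poly P \<tau> = (\<Sum>i\<in>UNIV. rep_proj2 p $ i * poly (R0 $ i) \<tau>)" by (simp add: P_def poly_sum)
    also have "\<dots> = (\<Sum>i\<in>UNIV. (rep_proj2 p $ 3 *s q + \<eta> *s pencil_pt \<kappa> \<tau>) $ i * poly (R0 $ i) \<tau>)"
      by (simp only: rep[symmetric])
    also have "\<dots> = rep_proj2 p $ 3 * poly A \<tau> + \<eta> * poly B \<tau>"
      unfolding R0q[symmetric] R0y[symmetric] by (simp add: sum_3 algebra_simps)
    also have "\<eta> ^ k * \<dots> = s (rep_proj2 p)"
    proof -
      define \<zeta> where "\<zeta> = rep_proj2 p $ 3"
      have "\<zeta> *s q + \<eta> *s pencil_pt \<kappa> \<tau> = \<eta> *s (pencil_pt \<kappa> \<tau> + (\<zeta> / \<eta>) *s q)"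
        using \<eta> by (simp add: vector_add_ldistrib vector_smult_assoc add.commute)
      then have "rep_proj2 p = \<eta> *s (pencil_pt \<kappa> \<tau> + (\<zeta> / \<eta>) *s q)"
        using rep unfolding \<zeta>_def by (rule trans[rotated])
      then have "s (rep_proj2 p) = s (\<eta> *s (pencil_pt \<kappa> \<tau> + (\<zeta> / \<eta>) *s q))" by (rule arg_cong)
      also have "\<dots> = \<eta> ^ Suc k * s (pencil_pt \<kappa> \<tau> + (\<zeta> / \<eta>) *s q)"
        by (rule hpoly_homogeneous[OF s])
      also have "\<dots> = \<eta> ^ Suc k * (poly B \<tau> + (\<zeta> / \<eta>) * poly A \<tau>)"
        by (simp only: mult[of "pencil_pt \<kappa> \<tau>" "\<zeta> / \<eta>"] BY A)
      also have "\<dots> = \<eta> ^ k * (\<zeta> * poly A \<tau> + \<eta> * poly B \<tau>)"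
      proof -
        have "\<eta> ^ Suc k * (poly B \<tau> + c * poly A \<tau>) = \<eta> ^ k * (\<eta> * c * poly A \<tau> + \<eta> * poly B \<tau>)" for c
          by (simp add: algebra_simps)
        moreover have "\<eta> * (\<zeta> / \<eta>) = \<zeta>" using \<eta> by simp
        ultimately show ?thesis by metis
      qed
      finally show ?thesis by (simp only: \<zeta>_def)
    qed
    finally have "\<eta> ^ k * poly P \<tau> = 0" using Zs p by simp
    then have P\<tau>: "poly P \<tau> = 0" using \<eta> by simp
    then obtain g' where g': "P = [:- \<tau>, 1:] * g'" by (auto simp: poly_eq_0_iff_dvd dvd_def)
    have lin: "[:dual_form p u, \<eta>:] = smult \<eta> [:- \<tau>, 1:]"
      using \<eta> by (simp add: \<tau>_def node_def \<eta>_def)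
    have degP: "degree P \<le> k" unfolding P_def
      by (intro degree_sum_le order_trans[OF degree_smult_le] degR0) simp
    have "degree g' < k"
    proof (cases "g' = 0")
      case False
      then have "degree P = Suc (degree g')" unfolding g' by (subst degree_mult_eq) auto
      then show ?thesis using degP by simp
    qed (use k in simp)
    then have "degree (smult (1 / \<eta>) g') < k" using le_less_trans[OF degree_smult_le] by blast
    moreover have "P = [:dual_form p u, \<eta>:] * smult (1 / \<eta>) g'"
      unfolding lin g' mult_smult_left mult_smult_right smult_smult using \<eta> by simp
    ultimately show ?thesis unfolding P_def \<eta>_def by blast
  qed
  then obtain g where g: "\<And>p. p \<in> Z \<Longrightarrow> (\<Sum>i\<in>UNIV. smult (rep_proj2 p $ i) (R0 $ i)) = [:dual_form p u, dual_form p (v \<kappa>):] * g p"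
    "\<And>p. p \<in> Z \<Longrightarrow> degree (g p) < k" by metis
  define G where "G = (\<Sum>p\<in>Z. g p)"
  have "degree (g p) \<le> k - 1" if "p \<in> Z" for p using g(2)[OF that] by simp
  then have degG: "degree G \<le> k - 1" unfolding G_def by (rule degree_sum_le[OF finZ])
  \<comment> \<open>Along the line, \<open>R0\<close> multiplies \<open>f\<close> by the sum
    \<open>G\<close> of the \<open>g p\<close>, and the position vector multiplies it by
    \<open>d\<close>. Hence the multiple \<open>G / d\<close> is subtracted.\<close>
  define R :: "complex poly^3" where "R = (\<chi> i. R0 $ i - smult (1 / of_nat d) (G * [:u $ i, v \<kappa> $ i:]))"
  have Rt: "poly (R $ i) t = poly (R0 $ i) t - poly G t / of_nat d * X t $ i" for i t
    by (simp add: R_def X_def algebra_simps)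
  have "R \<in> line_syz f u (v \<kappa>) k"
    unfolding line_syz_def
  proof (intro CollectI conjI allI)
    fix i
    have "degree (G * [:u $ i, v \<kappa> $ i:]) \<le> (k - 1) + 1"
      using degG by (intro order_trans[OF degree_mult_le] add_mono) auto
    then show "degree (R $ i) \<le> k" using k degR0[of i]
      by (auto simp: R_def intro!: degree_diff_le order_trans[OF degree_smult_le])
  next
    fix t
    define w :: "complex^3" where "w = (\<chi> i. poly (R $ i) t)"
    have w: "dual_form p w = dual_form p (X t) * (poly (g p) t - poly G t / of_nat d)" if "p \<in> Z" for p
    proof -
      have "dual_form p w = (\<Sum>i\<in>UNIV. rep_proj2 p $ i * poly (R0 $ i) t) - poly G t / of_nat d * dual_form p (X t)"
        by (simp add: w_def Rt dual_form_def sum_3 algebra_simps)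
      also have "(\<Sum>i\<in>UNIV. rep_proj2 p $ i * poly (R0 $ i) t) = poly (\<Sum>i\<in>UNIV. smult (rep_proj2 p $ i) (R0 $ i)) t"
        by (simp add: poly_sum)
      also have "\<dots> = dual_form p (X t) * poly (g p) t"
        unfolding g(1)[OF that] dX by (rule poly_mult)
      finally show ?thesis by (simp add: algebra_simps)
    qed
    have "(\<Sum>i\<in>UNIV. poly (R $ i) t * pderiv3 i f (X t)) = (\<Sum>i\<in>UNIV. w $ i * pderiv3 i f (X t))"
      by (simp add: w_def)
    also have "\<dots> = (\<Sum>p\<in>Z. dual_form p w * (\<Prod>p'\<in>Z - {p}. dual_form p' (X t)))" by (rule dot_grad)
    also have "\<dots> = (\<Sum>p\<in>Z. f (X t) * (poly (g p) t - poly G t / of_nat d))"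
    proof (intro sum.cong refl)
      fix p assume p: "p \<in> Z"
      have "f (X t) = dual_form p (X t) * (\<Prod>p'\<in>Z - {p}. dual_form p' (X t))"
        unfolding arr_poly_def by (rule prod.remove[OF finZ p])
      then show "dual_form p w * (\<Prod>p'\<in>Z - {p}. dual_form p' (X t)) = f (X t) * (poly (g p) t - poly G t / of_nat d)"
        by (simp add: w[OF p] mult_ac)
    qed
    also have "\<dots> = f (X t) * ((\<Sum>p\<in>Z. poly (g p) t) - of_nat d * (poly G t / of_nat d))"
      by (simp add: sum_distrib_left[symmetric] sum_subtractf cardZ)
    also have "\<dots> = 0" using d_pos by (simp add: G_def poly_sum)
    finally show "(\<Sum>i\<in>UNIV. poly (R $ i) t * pderiv3 i f (u + t *s v \<kappa>)) = 0" by (simp add: X_def)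
  qed
  moreover have "(\<Sum>i\<in>UNIV. q $ i * poly (R $ i) t) = s (pencil_pt \<kappa> t + q) - s (pencil_pt \<kappa> t)" for t
  proof -
    \<comment> \<open>The position vector is orthogonal to \<open>q\<close> and to the pencil point,
      so the correction changes neither of the two pairings.\<close>
    have "(\<Sum>i\<in>UNIV. q $ i * X t $ i) = 0"
      by (simp add: X_def sum_3 base_pt_def dir_pt_def q3 algebra_simps)
    then have "(\<Sum>i\<in>UNIV. q $ i * (poly G t / of_nat d * X t $ i)) = 0"
      by (simp add: sum_distrib_left[symmetric] mult.left_commute[of _ "poly G t / of_nat d"] del: times_divide_eq_left times_divide_eq_right)
    then show ?thesis using R0q[of t] by (simp add: Rt right_diff_distrib sum_subtractf A)
  qed
  moreover have "(\<Sum>i\<in>UNIV. pencil_pt \<kappa> t $ i * poly (R $ i) t) = s (pencil_pt \<kappa> t)" for t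
  proof -
    have "(\<Sum>i\<in>UNIV. pencil_pt \<kappa> t $ i * X t $ i) = 0"
      by (simp add: X_def sum_3 base_pt_def dir_pt_def pencil_pt_def algebra_simps)
    then have "(\<Sum>i\<in>UNIV. pencil_pt \<kappa> t $ i * (poly G t / of_nat d * X t $ i)) = 0"
      by (simp add: sum_distrib_left[symmetric] mult.left_commute[of _ "poly G t / of_nat d"] del: times_divide_eq_left times_divide_eq_right)
    then show ?thesis using R0y[of t] by (simp add: Rt right_diff_distrib sum_subtractf BY)
  qed
  ultimately show ?thesis by blast
qed

text \<open>Every line through \<open>q\<close> except the one dual to \<open>v \<kappa>\<close>
  contains a pencil point, and on it the form is affine linear with zero value and slope. The
  exceptional line is covered by density.\<close>

lemma curve_eq_0:
  assumes s: "hpoly (Suc k) s"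
    and mult: "\<And>y t. s (y + t *s q) = s y + t * (s (y + q) - s y)"
    and 0: "\<And>t. s (pencil_pt \<kappa> t) = 0" "\<And>t. s (pencil_pt \<kappa> t + q) = 0"
  shows "s x = 0"
proof (rule vanish_off_hyperplane[OF open_UNIV hpoly_continuous[OF s] UNIV_I, of "v \<kappa>"])
  show "v \<kappa> \<noteq> 0" using line_pt_components(2)[of 0 q 1 \<kappa>] by auto
  fix x assume "(\<Sum>i\<in>UNIV. v \<kappa> $ i * x $ i) \<noteq> 0"
  then have nz: "x $ 2 - q $ 2 * x $ 3 - \<kappa> * (x $ 1 - q $ 1 * x $ 3) \<noteq> 0"
    by (simp add: sum_3 dir_pt_def algebra_simps)
  define r where "r = x $ 1 - q $ 1 * x $ 3"
  define \<eta> where "\<eta> = x $ 2 - q $ 2 * x $ 3 - \<kappa> * r"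
  have \<eta>: "\<eta> \<noteq> 0" using nz by (simp add: \<eta>_def r_def)
  define P where "P = \<eta> *s pencil_pt \<kappa> (r / \<eta>)"
  have P1: "P $ 1 = r" using \<eta> by (simp add: P_def pencil_pt_def)
  have "P $ 2 = \<eta> * (1 + \<kappa> * (r / \<eta>))"
    by (simp only: P_def pencil_pt_def vector_smult_component vector_3)
  also have "\<dots> = \<eta> + \<kappa> * r" using \<eta> by (simp add: distrib_left)
  finally have P2: "P $ 2 = x $ 2 - q $ 2 * x $ 3" by (simp add: \<eta>_def)
  have P3: "P $ 3 = 0" by (simp add: P_def pencil_pt_def)
  have "x = P + x $ 3 *s q"
    unfolding vec_eq_iff forall_3 vector_add_component vector_smult_component P1 P2 P3 q3
    by (simp add: r_def)
  also have "\<dots> = \<eta> *s (pencil_pt \<kappa> (r / \<eta>) + (x $ 3 / \<eta>) *s q)"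
    using \<eta> by (simp add: P_def vector_add_ldistrib vector_smult_assoc)
  finally have "x = \<eta> *s (pencil_pt \<kappa> (r / \<eta>) + (x $ 3 / \<eta>) *s q)" .
  then have "s x = s (\<eta> *s (pencil_pt \<kappa> (r / \<eta>) + (x $ 3 / \<eta>) *s q))" by (rule arg_cong)
  also have "\<dots> = 0" unfolding hpoly_homogeneous[OF s] mult[of "pencil_pt \<kappa> (r / \<eta>)" "x $ 3 / \<eta>"] 0 by simp
  finally show "s x = 0" .
qed

text \<open>A linear relation between the syzygies of basis curves gives, after pairing with the
  pencil points and with \<open>q\<close>, a curve with zero values and slopes; it is zero, against
  independence. So the number of curves is bounded by the number of syzygies of degree
  \<open>j - 1\<close>.\<close>

lemma dim_curves_le:
  assumes j: "2 \<le> j"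
  shows "fun_space.dim {s \<in> sections_through j Z. vanishes_to_order (j - 1) (abs_proj2 q) s}
    \<le> nat (int j - a) + nat (int j - b)"
proof (rule ccontr)
  define X where "X = {s \<in> sections_through j Z. vanishes_to_order (j - 1) (abs_proj2 q) s}"
  define k where "k = j - 1"
  have k: "0 < k" "j = Suc k" using j by (auto simp: k_def)
  assume "\<not> fun_space.dim {s \<in> sections_through j Z. vanishes_to_order (j - 1) (abs_proj2 q) s}
    \<le> nat (int j - a) + nat (int j - b)"
  then have big: "nat (int k + 1 - a) + nat (int k + 1 - b) < fun_space.dim X" using k by (simp add: X_def add.commute)
  obtain B where B: "B \<subseteq> X" "fun_space.independent B" "X \<subseteq> fun_space.span B" "card B = fun_space.dim X"
    by (rule fun_space.basis_exists)
  then have finB: "finite B" using big by (intro card_ge_0_finite) simp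
  obtain \<kappa> where \<kappa>: "\<forall>p\<in>Z. dual_form p (v \<kappa>) \<noteq> 0" using ex_transverse by blast
  have BX: "hpoly (Suc k) s" "\<forall>p\<in>Z. s (rep_proj2 p) = 0" "vanishes_to_order k (abs_proj2 q) s" if "s \<in> B" for s
    using B(1) that sections_through_iff[of j s Z] k by (auto simp: X_def)
  have "\<exists>R. R \<in> line_syz f u (v \<kappa>) k \<and> (\<forall>t.
    (\<Sum>i\<in>UNIV. q $ i * poly (R $ i) t) = s (pencil_pt \<kappa> t + q) - s (pencil_pt \<kappa> t) \<and>
    (\<Sum>i\<in>UNIV. pencil_pt \<kappa> t $ i * poly (R $ i) t) = s (pencil_pt \<kappa> t))" if "s \<in> B" for s
    using curve_syzygy[OF k(1) BX(1)[OF that] BX(2)[OF that] BX(3)[OF that] \<kappa>] by blast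
  then have "\<forall>s\<in>B. \<exists>R. R \<in> line_syz f u (v \<kappa>) k \<and> (\<forall>t.
    (\<Sum>i\<in>UNIV. q $ i * poly (R $ i) t) = s (pencil_pt \<kappa> t + q) - s (pencil_pt \<kappa> t) \<and>
    (\<Sum>i\<in>UNIV. pencil_pt \<kappa> t $ i * poly (R $ i) t) = s (pencil_pt \<kappa> t))" by (rule ballI)
  from bchoice[OF this] obtain R where R: "\<And>s. s \<in> B \<Longrightarrow> R s \<in> line_syz f u (v \<kappa>) k"
    "\<And>s t. s \<in> B \<Longrightarrow> (\<Sum>i\<in>UNIV. q $ i * poly (R s $ i) t) = s (pencil_pt \<kappa> t + q) - s (pencil_pt \<kappa> t)"
    "\<And>s t. s \<in> B \<Longrightarrow> (\<Sum>i\<in>UNIV. pencil_pt \<kappa> t $ i * poly (R s $ i) t) = s (pencil_pt \<kappa> t)"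
    by (elim exE) blast
  obtain c where c: "\<exists>s\<in>B. c s \<noteq> 0" "(\<Sum>s\<in>B. [:c s:] *s R s) = 0"
    using line_syz_dependent[of B k R \<kappa>] finB big B(4) R(1) by auto
  have cR: "(\<Sum>s\<in>B. c s * poly (R s $ i) t) = 0" for i t
  proof -
    have "poly ((\<Sum>s\<in>B. [:c s:] *s R s) $ i) t = 0" unfolding c(2) by simp
    then show ?thesis by (simp add: poly_sum)
  qed
  define S where "S x = (\<Sum>s\<in>B. c s * s x)" for x
  have lin: "(\<Sum>s\<in>B. c s * (\<Sum>i\<in>UNIV. w $ i * poly (R s $ i) t)) = 0" for w :: "complex^3" and t
  proof -
    have "(\<Sum>s\<in>B. c s * (\<Sum>i\<in>UNIV. w $ i * poly (R s $ i) t)) = (\<Sum>i\<in>UNIV. w $ i * (\<Sum>s\<in>B. c s * poly (R s $ i) t))"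
      by (simp add: sum_distrib_left sum.swap[of _ UNIV B] mult.left_commute)
    then show ?thesis by (simp add: cR)
  qed
  have S1: "S (pencil_pt \<kappa> t) = 0" for t
    using lin[of "pencil_pt \<kappa> t" t] R(3) by (simp add: S_def)
  have "S (pencil_pt \<kappa> t + q) - S (pencil_pt \<kappa> t) = 0" for t
    using lin[of q t] R(2) by (simp add: S_def right_diff_distrib sum_subtractf)
  then have S2: "S (pencil_pt \<kappa> t + q) = 0" for t using S1 by simp
  have "S x = 0" for x
  proof (rule curve_eq_0[of k S \<kappa>])
    show "hpoly (Suc k) S" unfolding S_def [abs_def] by (intro hpoly_sum hpoly_cmult BX(1))
    fix y t
    have "s (y + t *s q) = s y + t * (s (y + q) - s y)" if "s \<in> B" for s
      by (rule multiplicity_linear[OF BX(1)[OF that] q_nonzero BX(3)[OF that]])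
    then have "S (y + t *s q) = (\<Sum>s\<in>B. c s * (s y + t * (s (y + q) - s y)))"
      unfolding S_def by (intro sum.cong) auto
    then show "S (y + t *s q) = S y + t * (S (y + q) - S y)"
      by (simp add: S_def algebra_simps sum.distrib sum_subtractf sum_distrib_left)
  qed (rule S1, rule S2)
  then have "(\<Sum>s\<in>B. (\<lambda>v. c s * s v)) = 0"
    by (simp add: fun_eq_iff sum_fun_apply S_def)
  then have "c s = 0" if "s \<in> B" for s
    using fun_space.independentD[OF B(2) finB subset_refl _ that, of c] by simp
  then show False using c(1) by blast
qed

lemma unexpected_gap:
  assumes j: "2 \<le> j"
    and unexp: "int (fun_space.dim {s \<in> sections_through j Z. vanishes_to_order (j - 1) (abs_proj2 q) s}) >
       max 0 (int (fun_space.dim (sections_through j Z)) - int (j choose 2))"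
  shows "a + 2 \<le> b"
proof -
  define D where "D = fun_space.dim {s \<in> sections_through j Z. vanishes_to_order (j - 1) (abs_proj2 q) s}"
  have D: "D \<le> nat (int j - a) + nat (int j - b)" unfolding D_def by (rule dim_curves_le[OF j])
  have ch: "int ((j + 2) choose 2) = int (j choose 2) + 2 * int j + 1"
    by (simp add: numeral_2_eq_2)
  have ge: "int ((j + 2) choose 2) \<le> int (fun_space.dim (sections_through j Z)) + int d"
  proof (cases "d \<le> (j + 2) choose 2")
    case True
    then show ?thesis using dim_sections_through_ge[OF finZ, of j] cardZ j by simp
  qed simp
  have "0 < D" "2 * int j + 1 - int d < int D" using unexp ge ch unfolding D_def by linarith+
  then show ?thesis using D sum_eq ab by linarith
qed

end

section \<open>Families of syzygies over the dual plane\<close>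

definition eval2 :: "complex \<Rightarrow> complex \<Rightarrow> complex poly poly \<Rightarrow> complex" where
  "eval2 x y F = poly (poly F [:y:]) x"

text \<open>The nesting puts \<open>x\<close> innermost, then \<open>y\<close>, and \<open>t\<close>
  outermost. So the coefficients in \<open>t\<close> are polynomials on the dual plane, and
  \<open>content\<close> is taken over C[x, y].\<close>

definition eval3 :: "complex \<Rightarrow> complex \<Rightarrow> complex \<Rightarrow> complex poly poly poly \<Rightarrow> complex" where
  "eval3 x y t G = eval2 x y (poly G [:[:t:]:])"

lemma eval2_simps [simp]:
  "eval2 x y (F + G) = eval2 x y F + eval2 x y G" "eval2 x y (F - G) = eval2 x y F - eval2 x y G"
  "eval2 x y (F * G) = eval2 x y F * eval2 x y G" "eval2 x y 0 = 0" "eval2 x y 1 = 1"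
  "eval2 x y (pCons e F) = poly e x + y * eval2 x y F"
  "eval2 x y (- F) = - eval2 x y F" "eval2 x y (smult e F) = poly e x * eval2 x y F"
  by (simp_all add: eval2_def)

lemma eval2_sum: "eval2 x y (\<Sum>i\<in>I. F i) = (\<Sum>i\<in>I. eval2 x y (F i))"
  by (simp add: eval2_def poly_sum)

lemma eval3_simps [simp]:
  "eval3 x y t (F + G) = eval3 x y t F + eval3 x y t G" "eval3 x y t (F - G) = eval3 x y t F - eval3 x y t G"
  "eval3 x y t (F * G) = eval3 x y t F * eval3 x y t G" "eval3 x y t 0 = 0" "eval3 x y t 1 = 1"
  "eval3 x y t (pCons c G) = eval2 x y c + t * eval3 x y t G"
  "eval3 x y t (- F) = - eval3 x y t F"
  by (simp_all add: eval3_def)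

lemma eval3_sum: "eval3 x y t (\<Sum>i\<in>I. F i) = (\<Sum>i\<in>I. eval3 x y t (F i))"
  by (simp add: eval3_def poly_sum eval2_sum)

lemma infinite_range_complex: "inj (g :: complex \<Rightarrow> 'b) \<Longrightarrow> infinite (range g)"
  using finite_imageD infinite_UNIV_char_0 by blast

lemma eval2_eq_0:
  assumes "\<And>x y. eval2 x y F = 0"
  shows "F = 0"
proof (rule ccontr)
  assume "F \<noteq> 0"
  then have "finite {z. poly F z = 0}" by (rule poly_roots_finite)
  moreover have "poly F [:y:] = 0" for y
  proof -
    have "\<forall>x. poly (poly F [:y:]) x = 0" using assms by (simp add: eval2_def)
    then show ?thesis using poly_all_0_iff_0 by blast
  qed
  then have "range (\<lambda>y. [:y:]) \<subseteq> {z. poly F z = 0}" by auto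
  moreover have "infinite (range (\<lambda>y::complex. [:y:]))"
    by (rule infinite_range_complex) (simp add: inj_def)
  ultimately show False using finite_subset by blast
qed

lemma eval3_eq_0:
  assumes "\<And>x y t. eval3 x y t G = 0"
  shows "G = 0"
proof (rule ccontr)
  assume "G \<noteq> 0"
  then have "finite {z. poly G z = 0}" by (rule poly_roots_finite)
  moreover have "poly G [:[:t:]:] = 0" for t
    using assms unfolding eval3_def by (intro eval2_eq_0)
  then have "range (\<lambda>t. [:[:t:]:]) \<subseteq> {z. poly G z = 0}" by auto
  moreover have "infinite (range (\<lambda>t::complex. [:[:t:]:]))"
    by (rule infinite_range_complex) (simp add: inj_def)
  ultimately show False using finite_subset by blast
qed

lemma eval3_specialize: "eval3 x y t G = poly (map_poly (eval2 x y) G) t"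
  by (induction G) (simp_all add: map_poly_pCons)

lemma hpoly_eval2: "hpoly r g \<Longrightarrow> \<exists>F. \<forall>x y. g (vector [x, y, 1]) = eval2 x y F"
proof (induction rule: hpoly.induct)
  case (const c)
  show ?case by (rule exI[of _ "[:[:c:]:]"]) simp
next
  case (zero r)
  show ?case by (rule exI[of _ 0]) simp
next
  case (add r g h)
  then obtain F F' where "\<forall>x y. g (vector [x, y, 1]) = eval2 x y F" "\<forall>x y. h (vector [x, y, 1]) = eval2 x y F'"
    by blast
  then show ?case by (intro exI[of _ "F + F'"]) simp
next
  case (coord r g i)
  then obtain F where F: "\<forall>x y. g (vector [x, y, 1]) = eval2 x y F" by blast
  consider "i = 1" | "i = 2" | "i = 3" using exhaust_3 by blast
  then show ?case
  proof cases
    case 1 then show ?thesis using F by (intro exI[of _ "[:[:0, 1:]:] * F"]) simp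
  next
    case 2 then show ?thesis using F by (intro exI[of _ "[:0, 1:] * F"]) simp
  next
    case 3 then show ?thesis using F by (intro exI[of _ F]) simp
  qed
qed

lemma hpoly_eval3: "hpoly r g \<Longrightarrow> \<exists>G. \<forall>x y t. g (vector [-1, t, x - t * y]) = eval3 x y t G"
proof (induction rule: hpoly.induct)
  case (const c)
  show ?case by (rule exI[of _ "[:[:[:c:]:]:]"]) simp
next
  case (zero r)
  show ?case by (rule exI[of _ 0]) simp
next
  case (add r g h)
  then obtain F F' where "\<forall>x y t. g (vector [-1, t, x - t * y]) = eval3 x y t F"
     "\<forall>x y t. h (vector [-1, t, x - t * y]) = eval3 x y t F'"
    by blast
  then show ?case by (intro exI[of _ "F + F'"]) simp
next
  case (coord r g i)
  then obtain F where F: "\<forall>x y t. g (vector [-1, t, x - t * y]) = eval3 x y t F" by blast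
  consider "i = 1" | "i = 2" | "i = 3" using exhaust_3 by blast
  then show ?case
  proof cases
    case 1 then show ?thesis using F by (intro exI[of _ "- F"]) simp
  next
    case 2 then show ?thesis using F by (intro exI[of _ "[:0, 1:] * F"]) (simp del: mult_pCons_left)
  next
    case 3 then show ?thesis using F
      by (intro exI[of _ "[:[:[:0, 1:]:], - [:0, 1:]:] * F"]) (simp del: mult_pCons_left)
  qed
qed

text \<open>The derivation t d/dx + d/dy moves the line through the fixed point (-1 : t : x - t y).\<close>
definition pencil_deriv :: "complex poly poly poly \<Rightarrow> complex poly poly poly" where
  "pencil_deriv G = pCons 0 (map_poly (map_poly pderiv) G) + map_poly pderiv G"

lemma degree_pencil_deriv: "degree (pencil_deriv G) \<le> Suc (degree G)"
  unfolding pencil_deriv_def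
  by (intro degree_add_le order_trans[OF degree_pCons_le])
    (auto intro: order_trans[OF map_poly_degree_leq])

lemma eval2_path_deriv:
  "((\<lambda>s. eval2 (x + s * t) (y + s) F) has_field_derivative
     (t * eval2 (x + s * t) (y + s) (map_poly pderiv F) + eval2 (x + s * t) (y + s) (pderiv F))) (at s)"
proof (induction F)
  case (pCons e F)
  have "((\<lambda>s. poly e (x + s * t)) has_field_derivative poly (pderiv e) (x + s * t) * t) (at s)"
    by (rule DERIV_chain2[OF poly_DERIV]) (auto intro!: derivative_eq_intros)
  then have "((\<lambda>s. poly e (x + s * t) + (y + s) * eval2 (x + s * t) (y + s) F) has_field_derivative
     (poly (pderiv e) (x + s * t) * t + (1 * eval2 (x + s * t) (y + s) F +
       (t * eval2 (x + s * t) (y + s) (map_poly pderiv F) + eval2 (x + s * t) (y + s) (pderiv F)) * (y + s)))) (at s)"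
    by (intro DERIV_add DERIV_mult pCons.IH) (auto intro!: derivative_eq_intros)
  then show ?case by (simp add: map_poly_pCons pderiv_pCons algebra_simps)
qed simp

text \<open>Identifies the formal derivation with the derivative along the path that keeps
  \<open>t\<close> and \<open>x - t * y\<close> constant.\<close>

lemma eval3_path_deriv:
  "((\<lambda>s. eval3 (x + s * t) (y + s) t G) has_field_derivative eval3 (x + s * t) (y + s) t (pencil_deriv G)) (at s)"
proof (induction G)
  case (pCons c G)
  have "((\<lambda>s. eval2 (x + s * t) (y + s) c + t * eval3 (x + s * t) (y + s) t G) has_field_derivative
    ((t * eval2 (x + s * t) (y + s) (map_poly pderiv c) + eval2 (x + s * t) (y + s) (pderiv c)) +
      t * eval3 (x + s * t) (y + s) t (pencil_deriv G))) (at s)"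
    by (intro DERIV_add eval2_path_deriv DERIV_cmult pCons.IH)
  then show ?case by (simp add: pencil_deriv_def map_poly_pCons algebra_simps)
qed (simp add: pencil_deriv_def)

lemma eval3_path_poly: "\<exists>p. \<forall>s. eval3 (x + s * t) (y + s) t G = poly p s"
proof -
  have 2: "\<exists>p. \<forall>s. eval2 (x + s * t) (y + s) F = poly p s" for F
  proof (induction F)
    case 0 show ?case by (rule exI[of _ 0]) simp
  next
    case (pCons e F)
    then obtain p where p: "\<forall>s. eval2 (x + s * t) (y + s) F = poly p s" by blast
    have "poly e (x + s * t) = poly (pcompose e [:x, t:]) s" for s by (simp add: poly_pcompose mult.commute)
    then show ?case using p
      by (intro exI[of _ "pcompose e [:x, t:] + [:y, 1:] * p"]) (simp add: algebra_simps)
  qed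
  show ?thesis
  proof (induction G)
    case 0 show ?case by (rule exI[of _ 0]) simp
  next
    case (pCons c G)
    then obtain p where p: "\<forall>s. eval3 (x + s * t) (y + s) t G = poly p s" by blast
    obtain p' where p': "\<forall>s. eval2 (x + s * t) (y + s) c = poly p' s" using 2 by blast
    show ?case using p p' by (intro exI[of _ "p' + smult t p"]) simp
  qed
qed

text \<open>The range \<open>{..n}\<close> does not depend on \<open>r\<close>, so the condition
  that a product vanishes becomes a linear system in a fixed set of unknown coefficients.\<close>

lemma coeff_mult_upto:
  fixes R G :: "'a::comm_ring_1 poly"
  assumes "degree R \<le> n"
  shows "coeff (R * G) r = (\<Sum>m\<le>n. coeff R m * (if m \<le> r then coeff G (r - m) else 0))"
proof -
  have "coeff (R * G) r = (\<Sum>m\<le>r. coeff R m * (if m \<le> r then coeff G (r - m) else 0))"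
    by (simp add: coeff_mult)
  also have "\<dots> = (\<Sum>m\<le>r + n. coeff R m * (if m \<le> r then coeff G (r - m) else 0))"
    by (rule sum.mono_neutral_left) auto
  also have "\<dots> = (\<Sum>m\<le>n. coeff R m * (if m \<le> r then coeff G (r - m) else 0))"
    using assms by (intro sum.mono_neutral_right) (auto simp: coeff_eq_0)
  finally show ?thesis .
qed

section \<open>Primitive families and the derivation\<close>

lemma content_smult_normalize:
  fixes p :: "complex poly poly poly"
  shows "content (smult c p) = normalize c * content p"
  by simp

lemma primitive_family:
  fixes R :: "3 \<Rightarrow> complex poly poly poly"
  assumes "\<exists>i. R i \<noteq> 0"
  shows "\<exists>h R'. h \<noteq> 0 \<and> (\<forall>i. R i = smult h (R' i)) \<and>
    gcd (content (R' 1)) (gcd (content (R' 2)) (content (R' 3))) = 1"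
proof -
  define h where "h = gcd (content (R 1)) (gcd (content (R 2)) (content (R 3)))"
  have h0: "h \<noteq> 0"
  proof
    assume "h = 0"
    then have "content (R 1) = 0" "content (R 2) = 0" "content (R 3) = 0" by (simp_all add: h_def)
    then have "R i = 0" for i using exhaust_3[of i] by auto
    then show False using assms by blast
  qed
  have "h dvd content (R i)" for i
    using exhaust_3[of i] by (auto simp: h_def intro: dvd_trans[OF gcd_dvd2])
  then have "[:h:] dvd R i" for i by (simp add: const_poly_dvd_iff_dvd_content)
  then have "\<exists>Q. R i = smult h Q" for i by (auto simp: dvd_def)
  then obtain R' where R': "\<And>i. R i = smult h (R' i)" by metis
  have nh: "normalize h = h" by (simp add: h_def)
  have cR: "content (R i) = h * content (R' i)" for i
    by (subst R', subst content_smult_normalize, subst nh) (rule refl)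
  have "h = gcd (h * content (R' 1)) (gcd (h * content (R' 2)) (h * content (R' 3)))"
    unfolding cR[symmetric] by (rule h_def)
  also have "\<dots> = h * gcd (content (R' 1)) (gcd (content (R' 2)) (content (R' 3)))"
    by (simp add: gcd_mult_left normalize_mult nh)
  finally have "gcd (content (R' 1)) (gcd (content (R' 2)) (content (R' 3))) = 1"
    using h0 by simp
  then show ?thesis using h0 R' by (intro exI[of _ h] exI[of _ R'] conjI allI)
qed

text \<open>Gauss's lemma for a triple: \<open>c\<close> divides
  \<open>content l * content (R i)\<close> for each \<open>i\<close>, hence \<open>content l\<close>
  times the gcd of the three contents, which is 1.\<close>

lemma primitive_family_divide:
  fixes R D :: "3 \<Rightarrow> complex poly poly poly"
  assumes c: "c \<noteq> 0" and prim: "gcd (content (R 1)) (gcd (content (R 2)) (content (R 3))) = 1"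
    and eq: "\<And>i. smult c (D i) = l * R i"
  shows "\<exists>l'. \<forall>i. D i = l' * R i"
proof -
  have "c dvd content l * content (R i)" for i
  proof -
    have "content l * content (R i) = normalize c * content (D i)"
      using arg_cong[OF eq[of i], of content] by (simp add: content_mult)
    then show ?thesis by simp
  qed
  then have "c dvd gcd (content l * content (R 1)) (gcd (content l * content (R 2)) (content l * content (R 3)))"
    by simp
  also have "\<dots> = content l * gcd (content (R 1)) (gcd (content (R 2)) (content (R 3)))"
    by (simp add: gcd_mult_left normalize_mult)
  finally have "c dvd content l" using prim by simp
  then have "[:c:] dvd l" by (simp add: const_poly_dvd_iff_dvd_content)
  then obtain l' where l': "l = smult c l'" by (auto simp: dvd_def)
  have "D i = l' * R i" for i
  proof -
    have "smult c (D i - l' * R i) = 0" using eq[of i] by (simp add: l' smult_diff_right)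
    then show ?thesis using c by simp
  qed
  then show ?thesis by blast
qed

text \<open>Along the path (x + s t, y + s) an eigenvector of the derivation solves p' = l p with
  polynomial l, which forces l = 0 by degree reasons.\<close>
lemma pencil_deriv_eigenvector:
  assumes eq: "pencil_deriv R = l * R" and R: "R \<noteq> 0"
  shows "l = 0"
proof -
  have "eval3 x y t (l * R) = 0" for x y t
  proof (cases "eval3 x y t R = 0")
    case False
    obtain p where p: "\<And>s. eval3 (x + s * t) (y + s) t R = poly p s" using eval3_path_poly by metis
    obtain m where m: "\<And>s. eval3 (x + s * t) (y + s) t l = poly m s" using eval3_path_poly by metis
    have "poly (pderiv p) s = poly (m * p) s" for s
    proof -
      have "((\<lambda>s. eval3 (x + s * t) (y + s) t R) has_field_derivative poly (pderiv p) s) (at s)"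
        unfolding p by (rule poly_DERIV)
      from DERIV_unique[OF this eval3_path_deriv] show ?thesis by (simp add: eq p m)
    qed
    then have pm: "pderiv p = m * p" by (simp add: poly_eq_poly_eq_iff[symmetric] fun_eq_iff)
    have p0: "poly p 0 \<noteq> 0" using p[of 0] False by simp
    have "m = 0"
    proof (rule ccontr)
      assume "m \<noteq> 0"
      then have ne: "pderiv p \<noteq> 0" using pm p0 by auto
      then have "degree p \<noteq> 0" by (auto simp: pderiv_eq_0_iff)
      moreover have "degree p \<le> degree (pderiv p)"
        using \<open>m \<noteq> 0\<close> p0 unfolding pm by (subst degree_mult_eq) auto
      ultimately show False by (simp add: degree_pderiv)
    qed
    then show ?thesis using m[of 0] by simp
  qed simp
  then have "l * R = 0" by (rule eval3_eq_0)
  then show ?thesis using R by simp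
qed

text \<open>The family is constant along the path, and \<open>s = - y\<close> brings the second
  coordinate to 0.\<close>

lemma pencil_deriv_eq_0:
  assumes "pencil_deriv R = 0"
  shows "eval3 x y t R = eval3 (x - t * y) 0 t R"
proof -
  have "((\<lambda>s. eval3 (x + s * t) (y + s) t R) has_field_derivative 0) (at s)" for s
    using eval3_path_deriv[of x t y R s] assms by simp
  then have "\<exists>c. \<forall>s\<in>UNIV. eval3 (x + s * t) (y + s) t R = c"
    by (intro has_field_derivative_zero_constant) auto
  then obtain c where c: "\<And>s. eval3 (x + s * t) (y + s) t R = c" by blast
  show ?thesis using c[of 0] c[of "- y"] by (simp add: mult.commute)
qed

lemma eval3_bivariate: "\<exists>n c. \<forall>x t. eval3 x 0 t G = (\<Sum>i\<le>n. \<Sum>k\<le>n. c i k * x ^ i * t ^ k)"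
proof -
  define P where "P k = poly (coeff G k) 0" for k
  define n where "n = degree G + (\<Sum>k\<le>degree G. degree (P k))"
  have degP: "degree (P k) \<le> n" for k
  proof (cases "k \<le> degree G")
    case True
    then have "degree (P k) \<le> (\<Sum>k\<le>degree G. degree (P k))" by (intro member_le_sum) auto
    then show ?thesis by (simp add: n_def)
  next
    case False
    then show ?thesis by (simp add: P_def coeff_eq_0)
  qed
  have "eval3 x 0 t G = (\<Sum>i\<le>n. \<Sum>k\<le>n. coeff (P k) i * x ^ i * t ^ k)" for x t
  proof -
    have "eval3 x 0 t G = poly (map_poly (eval2 x 0) G) t" by (rule eval3_specialize)
    also have "\<dots> = (\<Sum>k\<le>n. coeff (map_poly (eval2 x 0) G) k * t ^ k)"
      by (rule poly_sum_upto) (auto simp: n_def intro: order_trans[OF map_poly_degree_leq])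
    also have "\<dots> = (\<Sum>k\<le>n. (\<Sum>i\<le>n. coeff (P k) i * x ^ i) * t ^ k)"
      by (intro sum.cong refl) (simp add: coeff_map_poly eval2_def P_def[symmetric] poly_sum_upto[OF degP])
    also have "\<dots> = (\<Sum>k\<le>n. \<Sum>i\<le>n. coeff (P k) i * x ^ i * t ^ k)" by (simp add: sum_distrib_right)
    also have "\<dots> = (\<Sum>i\<le>n. \<Sum>k\<le>n. coeff (P k) i * x ^ i * t ^ k)" by (rule sum.swap)
    finally show ?thesis .
  qed
  then show ?thesis by (intro exI[of _ n] exI[of _ "\<lambda>i k. coeff (P k) i"] allI)
qed

text \<open>Invariance makes \<open>R\<close> a polynomial in \<open>x - t * y\<close> and
  \<open>t\<close>, but only its degree in \<open>t\<close> is bounded. Moving the point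
  \<open>(r * x, 0)\<close> to \<open>(0, - x)\<close> shows that along \<open>(r * x, r)\<close>
  the value is a polynomial in \<open>r\<close> of degree at most \<open>N\<close>. So
  \<open>N\<close> bounds the total degree, and homogenisation with \<open>- v $ 1\<close> is
  possible.\<close>

lemma homogenize_invariant:
  assumes inv: "\<And>x y t. eval3 x y t R = eval3 (x - t * y) 0 t R" and deg: "degree R \<le> N"
  shows "\<exists>\<rho>. hpoly N \<rho> \<and> (\<forall>v. v $ 1 \<noteq> 0 \<longrightarrow> \<rho> v = (- v $ 1) ^ N * eval3 (v $ 3 / - v $ 1) 0 (v $ 2 / - v $ 1) R)"
proof -
  obtain n c where c: "\<And>x t. eval3 x 0 t R = (\<Sum>i\<le>n. \<Sum>k\<le>n. c i k * x ^ i * t ^ k)"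
    using eval3_bivariate[of R] by (elim exE) (simp only:)
  have "\<exists>p. degree p \<le> N \<and> (\<forall>r. eval3 (r * x) 0 r R = poly p r)" for x
  proof (intro exI[of _ "map_poly (eval2 0 (- x)) R"] conjI allI)
    show "degree (map_poly (eval2 0 (- x)) R) \<le> N" using map_poly_degree_leq deg by (rule order_trans)
    show "eval3 (r * x) 0 r R = poly (map_poly (eval2 0 (- x)) R) r" for r
      using inv[of 0 "- x" r] by (simp add: eval3_specialize[symmetric])
  qed
  note c0 = total_degree_bound[OF c this]
  define \<rho> where "\<rho> v = (\<Sum>i\<le>n. \<Sum>k\<le>n. if i + k \<le> N then c i k * (v $ 3 ^ i * (v $ 2 ^ k * (- v $ 1) ^ (N - i - k))) else 0)" for v :: "complex^3"
  have "hpoly N \<rho>" unfolding \<rho>_def [abs_def] by (intro hpoly_homogenization hpoly_coord hpoly_minus)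
  moreover have "\<rho> v = (- v $ 1) ^ N * eval3 (v $ 3 / - v $ 1) 0 (v $ 2 / - v $ 1) R" if "v $ 1 \<noteq> 0" for v
    unfolding \<rho>_def by (rule homogenization_eval[OF _ c c0]) (use that in simp_all)
  ultimately show ?thesis by (intro exI[of _ \<rho>] conjI allI impI)
qed

lemma eval2_generic_elimination:
  fixes c :: "'j \<Rightarrow> 'i \<Rightarrow> complex poly poly"
  assumes "finite J"
  shows "(\<exists>v. (\<exists>j\<in>J. v j \<noteq> 0) \<and> (\<forall>i. (\<Sum>j\<in>J. v j * c j i) = 0)) \<or>
    (\<exists>D. D \<noteq> 0 \<and> (\<forall>x y. eval2 x y D \<noteq> 0 \<longrightarrow>
       (\<forall>w. (\<forall>i. (\<Sum>j\<in>J. w j * eval2 x y (c j i)) = 0) \<longrightarrow> (\<forall>j\<in>J. w j = 0))))"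
proof -
  define H where "H = {eval2 x y | x y. True}"
  have "(\<exists>v. (\<exists>j\<in>J. v j \<noteq> 0) \<and> (\<forall>i. (\<Sum>j\<in>J. v j * c j i) = 0)) \<or>
    (\<exists>D. D \<noteq> 0 \<and> (\<forall>h\<in>H. h D \<noteq> 0 \<longrightarrow>
       (\<forall>w. (\<forall>i. (\<Sum>j\<in>J. w j * h (c j i)) = 0) \<longrightarrow> (\<forall>j\<in>J. w j = 0))))"
    by (rule generic_elimination[OF assms]) (auto simp: H_def)
  then show ?thesis
  proof (elim disjE)
    assume "\<exists>D. D \<noteq> 0 \<and> (\<forall>h\<in>H. h D \<noteq> 0 \<longrightarrow>
       (\<forall>w. (\<forall>i. (\<Sum>j\<in>J. w j * h (c j i)) = 0) \<longrightarrow> (\<forall>j\<in>J. w j = 0)))"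
    then obtain D where D: "D \<noteq> 0" "\<forall>h\<in>H. h D \<noteq> 0 \<longrightarrow>
       (\<forall>w. (\<forall>i. (\<Sum>j\<in>J. w j * h (c j i)) = 0) \<longrightarrow> (\<forall>j\<in>J. w j = 0))" by (elim exE conjE)
    have H: "eval2 x y \<in> H" for x y by (auto simp: H_def)
    have "eval2 x y D \<noteq> 0 \<longrightarrow>
       (\<forall>w. (\<forall>i. (\<Sum>j\<in>J. w j * eval2 x y (c j i)) = 0) \<longrightarrow> (\<forall>j\<in>J. w j = 0))" for x y
      by (rule bspec[OF D(2) H])
    then show ?thesis using D(1) by (intro disjI2 exI[of _ D] conjI allI)
  qed (rule disjI1)
qed

lemma eval2_mult_nonzero:
  assumes "D \<noteq> 0" "D' \<noteq> 0"
  obtains x y where "eval2 x y D \<noteq> 0" "eval2 x y D' \<noteq> 0"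
proof -
  have "D * D' \<noteq> 0" using assms by simp
  then obtain x y where "eval2 x y (D * D') \<noteq> 0" using eval2_eq_0 by blast
  then show ?thesis by (intro that[of x y]) auto
qed

lemma line_pt_affine: "base_pt (vector [x, y, 1]) + t *s dir_pt (vector [x, y, 1]) 0 = vector [-1, t, x - t * y]"
  by (simp add: base_pt_def dir_pt_def vec_eq_iff forall_3)

lemma coeff_sum_mult_upto:
  fixes R G :: "3 \<Rightarrow> 'x::comm_ring_1 poly"
  assumes "\<And>i. degree (R i) \<le> n"
  shows "coeff (\<Sum>i\<in>UNIV. R i * G i) r = (\<Sum>j\<in>UNIV \<times> {..n}.
    coeff (R (fst j)) (snd j) * (if snd j \<le> r then coeff (G (fst j)) (r - snd j) else 0))"
proof -
  have "coeff (\<Sum>i\<in>UNIV. R i * G i) r = (\<Sum>i\<in>UNIV. \<Sum>m\<le>n. coeff (R i) m * (if m \<le> r then coeff (G i) (r - m) else 0))"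
    unfolding coeff_sum by (intro sum.cong refl coeff_mult_upto assms)
  then show ?thesis unfolding sum.cartesian_product case_prod_beta .
qed

text \<open>By the gap, the destabilizing syzygies on the generic lines through a point do not vary to
  first order with the line, hence they glue to a syzygy on the whole plane.\<close>
lemma (in arrangement) grauert_muelich:
  assumes g0: "g0 \<noteq> 0"
    and generic: "\<And>x y. eval2 x y g0 \<noteq> 0 \<Longrightarrow> good_line Z d a b (vector [x, y, 1])"
    and gap: "a + 2 \<le> b"
  shows "\<exists>\<rho>\<in>AR f (nat a). \<rho> \<noteq> (\<lambda>v. 0)"
proof -
  obtain x0 y0 where "eval2 x0 y0 g0 \<noteq> 0" using eval2_mult_nonzero[OF g0 g0] by metis
  from good_line.a_nonneg[OF generic[OF this]] have a0: "0 \<le> a" .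
  define n where "n = nat a"
  have na: "int n = a" using a0 by (simp add: n_def)
  have "\<exists>G. \<forall>x y t. pderiv3 i f (vector [-1, t, x - t * y]) = eval3 x y t G" for i
    by (rule hpoly_eval3[OF hpoly_grad])
  then obtain \<Gamma> where \<Gamma>: "\<And>i x y t. pderiv3 i f (vector [-1, t, x - t * y]) = eval3 x y t (\<Gamma> i)" by metis
  have syz_iff: "W \<in> line_syz f (base_pt (vector [x, y, 1])) (dir_pt (vector [x, y, 1]) 0) k \<longleftrightarrow>
      (\<forall>i. degree (W $ i) \<le> k) \<and> (\<forall>t. (\<Sum>i\<in>UNIV. poly (W $ i) t * eval3 x y t (\<Gamma> i)) = 0)" for W x y k
    by (simp add: line_syz_def line_pt_affine \<Gamma>)
  define J :: "(3 \<times> nat) set" where "J = UNIV \<times> {..n}"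
  define c where "c j r = (if snd j \<le> r then coeff (\<Gamma> (fst j)) (r - snd j) else 0)" for j r
  \<comment> \<open>Otherwise a generic line would carry no nonzero syzygy of degree
    \<open>a\<close>; but for \<open>k = a\<close> the first summand alone contributes one.\<close>
  have no_D: "\<not> (\<exists>D. D \<noteq> 0 \<and> (\<forall>x y. eval2 x y D \<noteq> 0 \<longrightarrow>
       (\<forall>w. (\<forall>i. (\<Sum>j\<in>J. w j * eval2 x y (c j i)) = 0) \<longrightarrow> (\<forall>j\<in>J. w j = 0))))"
  proof (rule notI, elim exE conjE)
    fix D assume D: "D \<noteq> 0" "\<forall>x y. eval2 x y D \<noteq> 0 \<longrightarrow>
       (\<forall>w. (\<forall>i. (\<Sum>j\<in>J. w j * eval2 x y (c j i)) = 0) \<longrightarrow> (\<forall>j\<in>J. w j = 0))"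
    obtain x y where xy: "eval2 x y g0 \<noteq> 0" "eval2 x y D \<noteq> 0" by (rule eval2_mult_nonzero[OF g0 D(1)])
    interpret good_line Z d a b "vector [x, y, 1]" by (rule generic[OF xy(1)])
    obtain K :: "(2 \<times> nat) set" and X where K: "finite K" "card K = nat (int n + 1 - a) + nat (int n + 1 - b)"
      "\<forall>l\<in>K. X l \<in> line_syz f u (v 0) n" "\<forall>c. (\<Sum>l\<in>K. [:c l:] *s X l) = 0 \<longrightarrow> (\<forall>l\<in>K. c l = 0)"
      using line_syz_independent[of n 0] by blast
    have "K \<noteq> {}" using K(2) na by auto
    then obtain l where l: "l \<in> K" by blast
    have X0: "X l \<noteq> 0"
    proof
      assume "X l = 0"
      then have "(\<Sum>m\<in>K. [:(if m = l then 1 else 0):] *s X m) = 0" by (intro sum.neutral) auto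
      from K(4)[rule_format, OF this l] show False by simp
    qed
    have Xs: "\<And>i. degree (X l $ i) \<le> n" "\<And>t. (\<Sum>i\<in>UNIV. poly (X l $ i) t * eval3 x y t (\<Gamma> i)) = 0"
      using K(3) l syz_iff by blast+
    define \<gamma> where "\<gamma> i = map_poly (eval2 x y) (\<Gamma> i)" for i
    have "poly (\<Sum>i\<in>UNIV. X l $ i * \<gamma> i) t = 0" for t
      using Xs(2)[of t] by (simp add: poly_sum \<gamma>_def eval3_specialize)
    then have z: "(\<Sum>i\<in>UNIV. X l $ i * \<gamma> i) = 0" using poly_all_0_iff_0 by blast
    have "(\<Sum>j\<in>J. coeff (X l $ fst j) (snd j) * eval2 x y (c j r)) = 0" for r
    proof -
      have "(\<Sum>j\<in>J. coeff (X l $ fst j) (snd j) * eval2 x y (c j r)) = coeff (\<Sum>i\<in>UNIV. X l $ i * \<gamma> i) r"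
        unfolding coeff_sum_mult_upto[of "\<lambda>i. X l $ i", OF Xs(1)] J_def by (intro sum.cong) (auto simp: c_def \<gamma>_def coeff_map_poly)
      then show ?thesis by (simp add: z)
    qed
    then have w0: "\<forall>j\<in>J. coeff (X l $ fst j) (snd j) = 0"
      using D(2)[rule_format, OF xy(2), of "\<lambda>j. coeff (X l $ fst j) (snd j)"] by blast
    have "coeff (X l $ i) m = 0" for i m
    proof (cases "m \<le> n")
      case True
      then show ?thesis using w0 by (auto simp: J_def)
    next
      case False
      then show ?thesis using Xs(1)[of i] by (intro coeff_eq_0) simp
    qed
    then have "X l = 0" by (simp add: vec_eq_iff poly_eq_iff)
    then show False using X0 by simp
  qed
  have finJ: "finite J" by (simp add: J_def)
  obtain w where w: "\<exists>j\<in>J. w j \<noteq> 0" "\<forall>r. (\<Sum>j\<in>J. w j * c j r) = 0"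
    using eval2_generic_elimination[OF finJ, of c] no_D by blast
  define R0 where "R0 i = (\<Sum>m\<le>n. monom (w (i, m)) m)" for i
  have coeffR0: "coeff (R0 i) m = (if m \<le> n then w (i, m) else 0)" for i m
    by (auto simp: R0_def coeff_sum)
  have degR0: "degree (R0 i) \<le> n" for i by (rule degree_le) (simp add: coeffR0)
  have R0\<Gamma>: "(\<Sum>i\<in>UNIV. R0 i * \<Gamma> i) = 0"
  proof (rule poly_eqI)
    fix r
    have "coeff (\<Sum>i\<in>UNIV. R0 i * \<Gamma> i) r = (\<Sum>j\<in>J. w j * c j r)"
      unfolding coeff_sum_mult_upto[of R0, OF degR0] J_def by (intro sum.cong) (auto simp: c_def coeffR0)
    then show "coeff (\<Sum>i\<in>UNIV. R0 i * \<Gamma> i) r = coeff 0 r" using w(2) by simp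
  qed
  have "\<exists>i. R0 i \<noteq> 0"
  proof -
    obtain j where j: "j \<in> J" "w j \<noteq> 0" using w(1) by blast
    then have "coeff (R0 (fst j)) (snd j) \<noteq> 0" by (auto simp: coeffR0 J_def)
    then show ?thesis by (intro exI[of _ "fst j"]) auto
  qed
  from primitive_family[OF this] obtain h R where R: "h \<noteq> 0" "\<forall>i. R0 i = smult h (R i)"
    "gcd (content (R 1)) (gcd (content (R 2)) (content (R 3))) = 1" by (elim exE conjE)
  obtain i0 where i0: "R i0 \<noteq> 0" using R(2) \<open>\<exists>i. R0 i \<noteq> 0\<close> by auto
  have degR: "degree (R i) \<le> n" for i
    using degR0[of i] R(1) R(2)[rule_format, of i] by simp
  have "smult h (\<Sum>i\<in>UNIV. R i * \<Gamma> i) = (\<Sum>i\<in>UNIV. R0 i * \<Gamma> i)"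
    using R(2) by (simp add: sum_3 smult_add_right)
  then have "smult h (\<Sum>i\<in>UNIV. R i * \<Gamma> i) = 0" unfolding R0\<Gamma> .
  then have R\<Gamma>: "(\<Sum>i\<in>UNIV. R i * \<Gamma> i) = 0" using R(1) by simp
  have RG: "(\<Sum>i\<in>UNIV. eval3 x y t (R i) * eval3 x y t (\<Gamma> i)) = 0" for x y t
    using arg_cong[OF R\<Gamma>, of "eval3 x y t"] by (simp add: eval3_sum)
  have DG: "(\<Sum>i\<in>UNIV. eval3 x y t (pencil_deriv (R i)) * eval3 x y t (\<Gamma> i)) = 0" for x y t
  proof -
    \<comment> \<open>The gradient is evaluated at a point that does not move along the path.
      Differentiating the relation therefore affects the coefficients \<open>R i\<close>
      only.\<close>
    have const: "eval3 (x + s * t) (y + s) t (\<Gamma> i) = eval3 x y t (\<Gamma> i)" for s i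
      unfolding \<Gamma>[symmetric] by (simp add: algebra_simps)
    have "((\<lambda>s. \<Sum>i\<in>UNIV. eval3 (x + s * t) (y + s) t (R i) * eval3 x y t (\<Gamma> i)) has_field_derivative
      (\<Sum>i\<in>UNIV. eval3 (x + 0 * t) (y + 0) t (pencil_deriv (R i)) * eval3 x y t (\<Gamma> i))) (at 0)"
      by (intro DERIV_sum DERIV_cmult_right eval3_path_deriv)
    moreover have "(\<Sum>i\<in>UNIV. eval3 (x + s * t) (y + s) t (R i) * eval3 x y t (\<Gamma> i)) = 0" for s
      using RG[of "x + s * t" "y + s" t] by (simp add: const)
    ultimately have "((\<lambda>s. 0) has_field_derivative
      (\<Sum>i\<in>UNIV. eval3 x y t (pencil_deriv (R i)) * eval3 x y t (\<Gamma> i))) (at (0::complex))" by simp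
    from DERIV_unique[OF this DERIV_const] show ?thesis .
  qed
  \<comment> \<open>The three families \<open>R\<close>, \<open>t * R\<close> and the derivative of
    \<open>R\<close>, all of degree at most \<open>a + 1\<close> in \<open>t\<close>.\<close>
  define V where "V j i = (if j = 0 then R i else if j = 1 then pCons 0 (R i) else pencil_deriv (R i))" for j :: nat and i :: 3
  have degV: "degree (V j i) \<le> Suc n" for j i
    using degR[of i] degree_pencil_deriv[of "R i"] degree_pCons_le[of 0 "R i"] by (auto simp: V_def)
  have VG: "(\<Sum>i\<in>UNIV. eval3 x y t (V j i) * eval3 x y t (\<Gamma> i)) = 0" for j x y t
  proof -
    have "(\<Sum>i\<in>UNIV. eval3 x y t (pCons 0 (R i)) * eval3 x y t (\<Gamma> i)) = t * (\<Sum>i\<in>UNIV. eval3 x y t (R i) * eval3 x y t (\<Gamma> i))"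
      by (simp add: sum_distrib_left mult.assoc)
    then have "(\<Sum>i\<in>UNIV. eval3 x y t (pCons 0 (R i)) * eval3 x y t (\<Gamma> i)) = 0" unfolding RG by simp
    then show ?thesis using RG[of x y t] DG[of x y t] by (cases "j = 0"; cases "j = 1") (simp_all add: V_def del: eval3_simps(6))
  qed
  \<comment> \<open>On a good line the syzygies of degree \<open>a + 1\<close> have dimension 2 + 0,
    the second summand being empty because of the gap. Three families cannot stay independent at
    generic points.\<close>
  have no_D: "\<not> (\<exists>D. D \<noteq> 0 \<and> (\<forall>x y. eval2 x y D \<noteq> 0 \<longrightarrow>
       (\<forall>w. (\<forall>i. (\<Sum>j\<in>{..<3}. w j * eval2 x y (coeff (V j (fst i)) (snd i))) = 0) \<longrightarrow> (\<forall>j\<in>{..<3}. w j = 0))))"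
  proof (rule notI, elim exE conjE)
    fix D assume D: "D \<noteq> 0" "\<forall>x y. eval2 x y D \<noteq> 0 \<longrightarrow>
       (\<forall>w. (\<forall>i. (\<Sum>j\<in>{..<3}. w j * eval2 x y (coeff (V j (fst i)) (snd i))) = 0) \<longrightarrow> (\<forall>j\<in>{..<3}. w j = 0))"
    obtain x y where xy: "eval2 x y g0 \<noteq> 0" "eval2 x y D \<noteq> 0" by (rule eval2_mult_nonzero[OF g0 D(1)])
    interpret good_line Z d a b "vector [x, y, 1]" by (rule generic[OF xy(1)])
    define W :: "nat \<Rightarrow> complex poly^3" where "W j = (\<chi> i. map_poly (eval2 x y) (V j i))" for j
    have "W j \<in> line_syz f u (v 0) (Suc n)" for j
      unfolding syz_iff
    proof (intro conjI allI)
      show "degree (W j $ i) \<le> Suc n" for i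
        using map_poly_degree_leq[of "eval2 x y" "V j i"] degV[of j i] by (simp add: W_def)
      show "(\<Sum>i\<in>UNIV. poly (W j $ i) t * eval3 x y t (\<Gamma> i)) = 0" for t
        using VG[where x = x and y = y and t = t and j = j] by (simp add: W_def eval3_specialize)
    qed
    moreover have "nat (int (Suc n) + 1 - a) + nat (int (Suc n) + 1 - b) < card {..<3::nat}"
      using na gap by simp
    ultimately obtain e where e: "\<exists>l\<in>{..<3}. e l \<noteq> 0" "(\<Sum>l\<in>{..<3}. [:e l:] *s W l) = 0"
      using line_syz_dependent[of "{..<3::nat}" "Suc n" W 0] by blast
    have "(\<Sum>j\<in>{..<3}. e j * eval2 x y (coeff (V j (fst i)) (snd i))) = 0" for i
    proof -
      have "coeff ((\<Sum>l\<in>{..<3}. [:e l:] *s W l) $ fst i) (snd i) = 0" unfolding e(2) by simp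
      then show ?thesis by (simp add: coeff_sum W_def coeff_map_poly)
    qed
    then have "\<forall>j\<in>{..<3}. e j = 0" using D(2)[rule_format, OF xy(2), of e] by blast
    then show False using e(1) by blast
  qed
  obtain w where w: "\<exists>j\<in>{..<3::nat}. w j \<noteq> 0" "\<forall>i :: 3 \<times> nat. (\<Sum>j\<in>{..<3}. w j * coeff (V j (fst i)) (snd i)) = 0"
    using eval2_generic_elimination[of "{..<3::nat}" "\<lambda>j i. coeff (V j (fst i)) (snd i)"] no_D by blast
  have rel: "smult (w 0) (R i) + pCons 0 (smult (w 1) (R i)) + smult (w 2) (pencil_deriv (R i)) = 0" for i
  proof (rule poly_eqI)
    fix m
    have "(\<Sum>j<3. w j * coeff (V j i) m) = 0" using w(2)[rule_format, of "(i, m)"] by simp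
    then show "coeff (smult (w 0) (R i) + pCons 0 (smult (w 1) (R i)) + smult (w 2) (pencil_deriv (R i))) m = coeff 0 m"
      by (simp add: V_def numeral_3_eq_3 numeral_2_eq_2 coeff_pCons split: nat.splits)
  qed
  define l where "l = - [:w 0, w 1:]"
  have lR: "smult (w 2) (pencil_deriv (R i)) = l * R i" for i
  proof -
    have l: "l * R i = - (smult (w 0) (R i) + pCons 0 (smult (w 1) (R i)))" by (simp add: l_def)
    show ?thesis using rel[of i] unfolding l by (simp only: eq_neg_iff_add_eq_0 add_ac)
  qed
  \<comment> \<open>Without the derivative the relation would read
    \<open>(w 0 + w 1 * t) * R = 0\<close>, which is impossible for a nonzero polynomial
    family.\<close>
  have w2: "w 2 \<noteq> 0"
  proof
    assume w2: "w 2 = 0"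
    then have "l * R i0 = 0" using lR[of i0] by simp
    then have "l = 0" using i0 by simp
    then have "w 0 = 0" "w 1 = 0" by (simp_all add: l_def)
    then show False using w(1) w2 by (auto simp: numeral_3_eq_3 numeral_2_eq_2 less_Suc_eq)
  qed
  from primitive_family_divide[OF w2 R(3) lR] obtain l' where l': "\<And>i. pencil_deriv (R i) = l' * R i" by blast
  have "l' = 0" by (rule pencil_deriv_eigenvector[OF l' i0])
  then have inv: "eval3 x y t (R i) = eval3 (x - t * y) 0 t (R i)" for x y t i
    using l' by (intro pencil_deriv_eq_0) simp
  have "\<exists>\<rho>. hpoly n \<rho> \<and> (\<forall>v. v $ 1 \<noteq> 0 \<longrightarrow> \<rho> v = (- v $ 1) ^ n * eval3 (v $ 3 / - v $ 1) 0 (v $ 2 / - v $ 1) (R i))" for i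
    by (rule homogenize_invariant[OF inv degR])
  then obtain \<rho> where \<rho>: "\<And>i. hpoly n (\<rho> i)"
    "\<And>i v. v $ 1 \<noteq> 0 \<Longrightarrow> \<rho> i v = (- v $ 1) ^ n * eval3 (v $ 3 / - v $ 1) 0 (v $ 2 / - v $ 1) (R i)" by metis
  define \<psi> where "\<psi> v = (\<Sum>i\<in>UNIV. \<rho> i v * pderiv3 i f v)" for v
  have h\<psi>: "hpoly (n + (d - 1)) \<psi>" unfolding \<psi>_def [abs_def] by (intro hpoly_sum hpoly_mult \<rho>(1) hpoly_grad)
  have \<psi>0: "\<psi> v = 0" for v
  proof (rule vanish_off_hyperplane[OF open_UNIV hpoly_continuous[OF h\<psi>] UNIV_I, of "axis 1 1"])
    show "axis 1 1 \<noteq> (0 :: complex^3)" by (simp add: axis_eq_0_iff)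
    fix v :: "complex^3" assume "(\<Sum>i\<in>UNIV. axis 1 1 $ i * v $ i) \<noteq> 0"
    then have v1: "v $ 1 \<noteq> 0" by (simp add: sum_3 axis_def)
    define x where "x = v $ 3 / - v $ 1"
    define t where "t = v $ 2 / - v $ 1"
    have veq: "v = (- v $ 1) *s vector [-1, t, x - t * 0]"
      using v1 by (simp add: vec_eq_iff forall_3 x_def t_def)
    have "pderiv3 i f v = (- v $ 1) ^ (d - 1) * eval3 x 0 t (\<Gamma> i)" for i
    proof -
      have "pderiv3 i f v = pderiv3 i f ((- v $ 1) *s vector [-1, t, x - t * 0])" using veq by (rule arg_cong)
      then show ?thesis unfolding hpoly_homogeneous[OF hpoly_grad] \<Gamma> .
    qed
    moreover have "\<rho> i v = (- v $ 1) ^ n * eval3 x 0 t (R i)" for i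
      unfolding x_def t_def by (rule \<rho>(2)[OF v1])
    ultimately have "\<psi> v = (- v $ 1) ^ n * ((- v $ 1) ^ (d - 1) * (\<Sum>i\<in>UNIV. eval3 x 0 t (R i) * eval3 x 0 t (\<Gamma> i)))"
      unfolding \<psi>_def sum_distrib_left by (intro sum.cong) (simp_all add: mult_ac)
    then show "\<psi> v = 0" unfolding RG by simp
  qed
  define P :: "complex^3 \<Rightarrow> complex^3" where "P v = (\<chi> i. \<rho> i v)" for v
  have "P \<in> AR f n"
    using \<rho>(1) \<psi>0 by (simp add: AR_def P_def hom_poly_iff_hpoly \<psi>_def)
  moreover have "P \<noteq> (\<lambda>v. 0)"
  proof
    assume P0: "P = (\<lambda>v. 0)"
    have "eval3 x y t (R i0) = 0" for x y t
    proof -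
      define v :: "complex^3" where "v = vector [-1, t, x - t * y]"
      have "\<rho> i0 v = 0" using arg_cong[OF fun_cong[OF P0, of v], of "\<lambda>v. v $ i0"] by (simp add: P_def)
      then show ?thesis using \<rho>(2)[of v i0] inv[of x y t i0] by (simp add: v_def)
    qed
    then show False using i0 eval3_eq_0 by blast
  qed
  ultimately show ?thesis unfolding n_def by blast
qed

section \<open>Global syzygies against the generic splitting type\<close>

context arrangement
begin

lemma generic_good_line:
  assumes "generic_splitting_type Z a b"
  obtains r g x where "hpoly r g" "g x \<noteq> 0" "\<And>q. q $ 3 = 1 \<Longrightarrow> g q \<noteq> 0 \<Longrightarrow> good_line Z d a b q"
proof -
  have ab: "a \<le> b" and gen: "generically (\<lambda>p. restriction_splits f (dual_line p) a b)"
    using assms by (auto simp: generic_splitting_type_def)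
  obtain r1 g1 x1 where 1: "hpoly r1 g1" "g1 x1 \<noteq> 0"
    "\<And>v. v \<noteq> 0 \<Longrightarrow> g1 v \<noteq> 0 \<Longrightarrow> restriction_splits f (dual_line (abs_proj2 v)) a b"
    by (rule generically_hpoly[OF gen]) blast
  obtain r2 g2 x2 where 2: "hpoly r2 g2" "g2 x2 \<noteq> 0" "\<And>q. q $ 3 = 1 \<Longrightarrow> g2 q \<noteq> 0 \<Longrightarrow> good_point q"
    using good_point_generic by blast
  obtain x where x: "g1 x * g2 x \<noteq> 0" using hpoly_mult_nonzero[OF 1(1) 2(1) 1(2) 2(2)] by blast
  have "good_line Z d a b q" if q: "q $ 3 = 1" "g1 q * g2 q \<noteq> 0" for q
  proof
    show "a \<le> b" by (rule ab)
    show "good_point q" using 2(3) q by simp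
    have "q \<noteq> 0" using q(1) by auto
    then show "restriction_splits f (dual_line (abs_proj2 q)) a b" using 1(3) q(2) by simp
  qed
  then show ?thesis using that[OF hpoly_mult[OF 1(1) 2(1)] x] by blast
qed

lemma ex_good_line:
  assumes "generic_splitting_type Z a b" and h: "hpoly s h" "h y \<noteq> 0"
  obtains q where "good_line Z d a b q" "h q \<noteq> 0" "q $ 3 = 1"
proof -
  obtain r g x where g: "hpoly r g" "g x \<noteq> 0" "\<And>q. q $ 3 = 1 \<Longrightarrow> g q \<noteq> 0 \<Longrightarrow> good_line Z d a b q"
    using generic_good_line[OF assms(1)] by metis
  obtain z where "g z * h z \<noteq> 0" using hpoly_mult_nonzero[OF g(1) h(1) g(2) h(2)] by blast
  then obtain q where q: "q $ 3 = 1" "g q * h q \<noteq> 0"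
    using hpoly_nonzero_affine[OF hpoly_mult[OF g(1) h(1)]] by blast
  have "g q \<noteq> 0" "h q \<noteq> 0" using q(2) by auto
  then show ?thesis by (intro that[of q] g(3) q(1))
qed

text \<open>The line has to be generic and yet not lie in the zero set of \<open>\<rho>\<close>. A
  point \<open>z\<close> with a nonzero component of \<open>\<rho>\<close> has a parameter
  \<open>t0\<close>; \<open>pt q\<close> is the point with this parameter on the line dual to
  \<open>q\<close>, linear in \<open>q\<close>. Nonvanishing of that component at
  \<open>pt q\<close> is thus a polynomial condition on \<open>q\<close>, satisfied at
  \<open>q0\<close>, whose dual line passes through \<open>z\<close>.\<close>

lemma AR_degree_ge:
  assumes split: "generic_splitting_type Z a b" and \<rho>: "\<rho> \<in> AR f r" "\<rho> \<noteq> (\<lambda>v. 0)"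
  shows "a \<le> int r"
proof -
  have hp: "hpoly r (\<lambda>v. \<rho> v $ k)" for k using \<rho>(1) by (simp add: AR_def hom_poly_iff_hpoly)
  obtain v0 where "\<rho> v0 \<noteq> 0" using \<rho>(2) by (auto simp: fun_eq_iff)
  then obtain i where i: "\<rho> v0 $ i \<noteq> 0" by (metis vec_eq_iff zero_index)
  obtain z where z: "\<rho> z $ i * z $ 1 \<noteq> 0"
    using hpoly_mult_nonzero[OF hp[of i] hpoly_coord[of 1] i, of "axis 1 1"] by (auto simp: axis_def)
  define t0 where "t0 = z $ 2 / - z $ 1"
  define pt :: "complex^3 \<Rightarrow> complex^3" where "pt q = vector [- q $ 3, t0 * q $ 3, q $ 1 - t0 * q $ 2]" for q
  have pt: "hpoly 1 (\<lambda>q. pt q $ k)" for k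
  proof -
    have "hpoly 1 (\<lambda>q. - q $ 3)" "hpoly 1 (\<lambda>q. t0 * q $ 3)" "hpoly 1 (\<lambda>q. q $ 1 - t0 * q $ 2)"
      by (intro hpoly_minus hpoly_diff hpoly_cmult hpoly_coord)+
    then show ?thesis using exhaust_3[of k] by (auto simp: pt_def)
  qed
  define q0 :: "complex^3" where "q0 = vector [z $ 3 / - z $ 1, 0, 1]"
  have "pt q0 = (1 / - z $ 1) *s z"
    using z by (simp add: pt_def q0_def t0_def vec_eq_iff forall_3)
  then have "\<rho> (pt q0) $ i = (1 / - z $ 1) ^ r * \<rho> z $ i"
    using hpoly_homogeneous[OF hp[of i], of "1 / - z $ 1" z] by simp
  then have "\<rho> (pt q0) $ i \<noteq> 0" using z by simp
  then obtain q where q: "good_line Z d a b q" "\<rho> (pt q) $ i \<noteq> 0" "q $ 3 = 1"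
    by (rule ex_good_line[OF split hpoly_compose[OF hp[of i] pt], of q0]) blast
  interpret good_line Z d a b q by (rule q(1))
  have "\<exists>p. degree p \<le> r \<and> (\<forall>t. \<rho> (u + t *s v 0) $ k = poly p t)" for k
    by (rule hpoly_line_poly[OF hp])
  then obtain P where P: "\<And>k. degree (P k) \<le> r" "\<And>k t. \<rho> (u + t *s v 0) $ k = poly (P k) t" by metis
  define R :: "complex poly^3" where "R = (\<chi> k. P k)"
  have "(\<Sum>k\<in>UNIV. poly (R $ k) t * pderiv3 k f (u + t *s v 0)) = 0" for t
  proof -
    have "(\<Sum>k\<in>UNIV. \<rho> (u + t *s v 0) $ k * pderiv3 k f (u + t *s v 0)) = 0"
      using \<rho>(1) by (simp add: AR_def)
    then show ?thesis by (simp add: P(2) R_def)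
  qed
  then have "R \<in> line_syz f u (v 0) r" using P(1) by (simp add: line_syz_def R_def)
  moreover have "R \<noteq> 0"
  proof
    assume "R = 0"
    then have "P i = 0" by (metis R_def vec_lambda_beta zero_index)
    then have "\<rho> (u + t0 *s v 0) $ i = 0" using P(2) by simp
    moreover have "u + t0 *s v 0 = pt q"
      by (simp add: pt_def base_pt_def dir_pt_def vec_eq_iff forall_3 q(3))
    ultimately show False using q(2) by simp
  qed
  ultimately show ?thesis by (rule line_syz_degree_ge)
qed

text \<open>A Koszul syzygy, exchanging two partial derivatives with a sign, is nonzero because
  Euler's relation gives a nonzero partial derivative. It ensures that the minimum in
  \<open>mdr\<close> is attained.\<close>

lemma AR_nontrivial:
  assumes "0 < d"
  shows "\<exists>r. \<exists>\<rho>\<in>AR f r. \<rho> \<noteq> (\<lambda>v. 0)"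
proof -
  obtain v where v: "f v \<noteq> 0" using f_nonzero by blast
  then have "(\<Sum>i\<in>UNIV. v $ i * pderiv3 i f v) \<noteq> 0" unfolding euler using assms by simp
  then obtain i where i: "pderiv3 i f v \<noteq> 0" by (metis (no_types, lifting) mult_zero_right sum.neutral)
  define j :: 3 where "j = (if i = 1 then 2 else 1)"
  have ij: "i \<noteq> j" by (auto simp: j_def)
  define \<rho> :: "complex^3 \<Rightarrow> complex^3"
    where "\<rho> v = (\<chi> k. (if k = j then 1 else 0) * pderiv3 i f v - (if k = i then 1 else 0) * pderiv3 j f v)" for v
  have "(\<Sum>k\<in>UNIV. \<rho> v $ k * pderiv3 k f v) = 0" for v
  proof -
    have "(\<Sum>k\<in>UNIV. \<rho> v $ k * pderiv3 k f v) = (\<Sum>k\<in>UNIV.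
      (if k = j then pderiv3 i f v * pderiv3 j f v else 0) - (if k = i then pderiv3 j f v * pderiv3 i f v else 0))"
      by (intro sum.cong) (auto simp: \<rho>_def left_diff_distrib)
    then show ?thesis by (simp add: sum_subtractf mult.commute)
  qed
  moreover have "hom_poly (d - 1) (\<lambda>v. \<rho> v $ k)" for k
    unfolding hom_poly_iff_hpoly \<rho>_def vec_lambda_beta by (intro hpoly_diff hpoly_cmult hpoly_grad)
  ultimately have "\<rho> \<in> AR f (d - 1)" by (simp add: AR_def)
  moreover have "\<rho> v $ j \<noteq> 0" using i ij by (simp add: \<rho>_def)
  then have "\<rho> \<noteq> (\<lambda>v. 0)" by auto
  ultimately show ?thesis by blast
qed

end

theorem theorem3p1:
  fixes Z :: "proj2 set" and d :: nat and a b :: int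
  assumes "finite Z" and "card Z = d"
    and "generic_splitting_type Z a b"
  shows "a \<le> min (int (mdr (arr_poly Z))) \<lfloor>(real d - 1) / 2\<rfloor> \<and>
         ((\<exists>j. admits_unexpected_curves Z j) \<longrightarrow> a = int (mdr (arr_poly Z)))"
proof -
  interpret arrangement Z d by unfold_locales (rule assms(1,2))+
  note split = assms(3)
  obtain q where q: "good_line Z d a b q"
    using ex_good_line[OF split hpoly.const[of 1]] by auto
  interpret good_line Z d a b q by (rule q)
  have half: "a \<le> \<lfloor>(real d - 1) / 2\<rfloor>"
  proof -
    have "2 * a \<le> int d - 1" using sum_eq ab by linarith
    then have "real_of_int (2 * a) \<le> real_of_int (int d - 1)" by (simp only: of_int_le_iff)
    then have "real_of_int a \<le> (real d - 1) / 2" by simp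
    then show ?thesis by (simp only: le_floor_iff)
  qed
  have "\<exists>\<rho>\<in>AR f (mdr f). \<rho> \<noteq> (\<lambda>v. 0)"
    unfolding mdr_def by (rule LeastI_ex[OF AR_nontrivial[OF d_pos]])
  then have a_le: "a \<le> int (mdr f)" using AR_degree_ge[OF split] by blast
  have "a = int (mdr f)" if "admits_unexpected_curves Z j" for j
  proof -
    have j: "2 \<le> j" and gen: "generically (\<lambda>q.
       int (fun_space.dim {s \<in> sections_through j Z. vanishes_to_order (j - 1) q s}) >
       max 0 (int (fun_space.dim (sections_through j Z)) - int (j choose 2)))"
      using that by (auto simp: admits_unexpected_curves_def)
    obtain r h x where h: "hpoly r h" "h x \<noteq> 0" "\<And>v. v \<noteq> 0 \<Longrightarrow> h v \<noteq> 0 \<Longrightarrow>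
       int (fun_space.dim {s \<in> sections_through j Z. vanishes_to_order (j - 1) (abs_proj2 v) s}) >
       max 0 (int (fun_space.dim (sections_through j Z)) - int (j choose 2))"
      by (rule generically_hpoly[OF gen]) blast
    \<comment> \<open>Since \<open>a\<close> and \<open>b\<close> are fixed numbers, one point where
      the curve is unexpected and the line good suffices for the gap. The gluing argument then uses
      all good lines.\<close>
    obtain q' where q': "good_line Z d a b q'" "h q' \<noteq> 0"
      using ex_good_line[OF split h(1,2)] by metis
    have gap: "a + 2 \<le> b"
      by (rule good_line.unexpected_gap[OF q'(1) j h(3)[OF good_line.q_nonzero[OF q'(1)] q'(2)]])
    obtain r' g x' where g: "hpoly r' g" "g x' \<noteq> 0" "\<And>q. q $ 3 = 1 \<Longrightarrow> g q \<noteq> 0 \<Longrightarrow> good_line Z d a b q"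
      using generic_good_line[OF split] by metis
    obtain F where F: "\<forall>x y. g (vector [x, y, 1]) = eval2 x y F" using hpoly_eval2[OF g(1)] by blast
    obtain q'' where q'': "q'' $ 3 = 1" "g q'' \<noteq> 0" using hpoly_nonzero_affine[OF g(1,2)] by blast
    have "q'' = vector [q'' $ 1, q'' $ 2, 1]" using q''(1) by (simp add: vec_eq_iff forall_3)
    then have "F \<noteq> 0" using F q''(2) by (metis eval2_simps(4))
    moreover have "good_line Z d a b (vector [x, y, 1])" if "eval2 x y F \<noteq> 0" for x y
      using g(3)[of "vector [x, y, 1]"] F that by simp
    ultimately have "\<exists>\<rho>\<in>AR f (nat a). \<rho> \<noteq> (\<lambda>v. 0)" using gap by (intro grauert_muelich)
    then have "mdr f \<le> nat a" unfolding mdr_def by (rule Least_le)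
    then show ?thesis using a_le a_nonneg by linarith
  qed
  then show ?thesis using a_le half by auto
qed

end
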